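(* Let $k\ge 3$ be an integer, let $\gamma\subset\mathbb{R}^2$ be a $C^2$-smooth, planar, strictly convex closed curve which is invariant under a linear map of order $k$, and let $K$ be the interior of $\gamma$. Suppose that the Minkowski billiard map in $K$, with the norm induced by $K$, has a rotational invariant curve of rotation number $\frac{r}{k}$, with $r$ coprime to $k$. If this invariant curve has a neighborhood $U$ in which the Minkowski billiard map is totally integrable, then $K$ is also invariant under a linear map of order $ak$, where $$a=\begin{cases}1, & k\equiv 2 \pmod 4,\\ 2, & k\equiv 0\pmod 4,\\ 4, & k\equiv 1\pmod 2.\end{cases}$$
   Context: A linear map $A$ has order $k$ if $k$ is the least positive integer with $A^k=I$. The norm (not necessarily symmetric) induced by $K$ is the gauge function $g_K(x)=\inf\{r>0 : x\in rK\}$. Minkowski billiard map in $K$ with the norm induced by $K$: parametrize $\gamma$ counterclockwise so that $g_K(\dot\gamma(t))=1$. The map $T$ is the twist map of the phase cylinder (oriented chords of $\gamma$, i.e. ordered pairs of distinct points $\gamma(t),\gamma(t_1)$) with generating function $L(t,t_1)=g_K(\gamma(t_1)-\gamma(t))$, i.e. $T(t,s)=(t_1,s_1)$ iff $s=-\partial L/\partial t\,(t,t_1)$ and $s_1=\partial L/\partial t_1\,(t,t_1)$. Equivalently, $\gamma(t_0),\gamma(t_1),\gamma(t_2)$ are consecutive bounce points iff $t_1$ is a critical point of $\tau\mapsto L(t_0,\tau)+L(\tau,t_2)$. A rotational invariant curve is a simple closed curve in the phase cylinder, homotopically non-trivial (winding once around the cylinder), that is mapped to itself by $T$. Its rotation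 number is the rotation number of the circle map $T$ induces on it, where one full turn around $\gamma$ counts as $1$ and each step advances the base point by a positive amount less than one turn. $T$ is totally integrable in an open subset $U$ of the phase cylinder if $U$ admits a $C^1$ foliation by rotational invariant curves of $T$. *)

theory Defs
  imports "HOL-Analysis.Analysis" "HOL-Library.Disjoint_Sets"
begin

section \<open>Linear maps of finite order, gauge function\<close>

definition has_order :: "('a \<Rightarrow> 'a) \<Rightarrow> nat \<Rightarrow> bool" where
  "has_order A n \<longleftrightarrow> 0 < n \<and> A ^^ n = id \<and> (\<forall>m. 0 < m \<and> m < n \<longrightarrow> A ^^ m \<noteq> id)"

definition gauge_function :: "'a::real_vector set \<Rightarrow> 'a \<Rightarrow> real" where
  "gauge_function K x = Inf {r. 0 < r \<and> x \<in> (\<lambda>y. r *\<^sub>R y) ` K}"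

section \<open>Closed curves in the plane\<close>

text \<open>Regular \<open>C\<^sup>2\<close> parametrizations, of minimal period \<open>l\<close>, of a simple closed curve.\<close>

definition C2_closed_param :: "(real \<Rightarrow> real^2) \<Rightarrow> real \<Rightarrow> bool" where
  "C2_closed_param \<gamma> l \<longleftrightarrow>
     0 < l \<and> (\<forall>t. \<gamma> (t + l) = \<gamma> t) \<and> inj_on \<gamma> {0..<l} \<and>
     (\<exists>\<gamma>1 \<gamma>2. (\<forall>t. (\<gamma> has_vector_derivative \<gamma>1 t) (at t)) \<and>
             (\<forall>t. (\<gamma>1 has_vector_derivative \<gamma>2 t) (at t)) \<and>
             continuous_on UNIV \<gamma>2 \<and> (\<forall>t. \<gamma>1 t \<noteq> 0))"

definition C2_closed_curve :: "(real^2) set \<Rightarrow> bool" where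
  "C2_closed_curve \<Gamma> \<longleftrightarrow> (\<exists>\<gamma> l. C2_closed_param \<gamma> l \<and> range \<gamma> = \<Gamma>)"

definition strictly_convex :: "'a::real_normed_vector set \<Rightarrow> bool" where
  "strictly_convex S \<longleftrightarrow> (\<forall>x\<in>S. \<forall>y\<in>S. x \<noteq> y \<longrightarrow> open_segment x y \<subseteq> interior S)"

text \<open>
  A simple closed curve is strictly convex if the closed region it bounds is. In particular it
  contains no line segment, but its curvature may vanish at some points.
\<close>

definition strictly_convex_curve :: "(real^2) set \<Rightarrow> bool" where
  "strictly_convex_curve \<Gamma> \<longleftrightarrow> strictly_convex (\<Gamma> \<union> inside \<Gamma>)"

definition cross2 :: "real^2 \<Rightarrow> real^2 \<Rightarrow> real" where
  "cross2 u v = u $ 1 * v $ 2 - u $ 2 * v $ 1"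

text \<open>
  Counterclockwise parametrization of \<open>\<Gamma>\<close> by arc length with respect to the gauge of
  \<open>inside \<Gamma>\<close>. For a convex curve, counterclockwise means that the region lies strictly to the
  left of every oriented tangent line. When \<open>\<Gamma>\<close> is a strictly convex \<open>C\<^sup>2\<close> curve around the
  origin, the gauge is \<open>C\<^sup>2\<close> away from the origin, so that this parametrization exists and is
  again \<open>C\<^sup>2\<close>; it is unique up to a translation of the parameter.
\<close>

definition gauge_arclength_param :: "(real^2) set \<Rightarrow> (real \<Rightarrow> real^2) \<Rightarrow> real \<Rightarrow> bool" where
  "gauge_arclength_param \<Gamma> \<gamma> l \<longleftrightarrow>
     C2_closed_param \<gamma> l \<and> range \<gamma> = \<Gamma> \<and>
     (\<forall>t. gauge_function (inside \<Gamma>) (vector_derivative \<gamma> (at t)) = 1) \<and>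
     (\<forall>t. \<forall>p\<in>inside \<Gamma>. 0 < cross2 (vector_derivative \<gamma> (at t)) (p - \<gamma> t))"

section \<open>The Minkowski billiard map\<close>

text \<open>
  The cylinder with coordinates \<open>(t, s)\<close>, \<open>t \<in> \<real> / l\<int>\<close>, is described on its universal cover
  \<open>\<real> \<times> \<real>\<close>: a subset of the cylinder is represented by its full preimage, which is invariant
  under the deck transformation \<open>(t, s) \<mapsto> (t + l, s)\<close>. The billiard map is represented by the lift
  that advances the base point by an amount in \<open>{0<..<l}\<close>; this lift commutes with the deck
  transformation. Chords \<open>(\<gamma> t, \<gamma> t1)\<close> are represented by \<open>t < t1 < t + l\<close>.
\<close>

definition generating_function ::
    "(real^2) set \<Rightarrow> (real \<Rightarrow> real^2) \<Rightarrow> real \<Rightarrow> real \<Rightarrow> real" where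
  "generating_function K \<gamma> t t1 = gauge_function K (\<gamma> t1 - \<gamma> t)"

definition phase_cylinder ::
    "(real^2) set \<Rightarrow> (real \<Rightarrow> real^2) \<Rightarrow> real \<Rightarrow> (real \<times> real) set" where
  "phase_cylinder K \<gamma> l = {(t, s). \<exists>t1. t < t1 \<and> t1 < t + l \<and>
     ((\<lambda>\<tau>. generating_function K \<gamma> \<tau> t1) has_real_derivative - s) (at t)}"

definition billiard_map ::
    "(real^2) set \<Rightarrow> (real \<Rightarrow> real^2) \<Rightarrow> real \<Rightarrow> ((real \<times> real) \<times> (real \<times> real)) set" where
  "billiard_map K \<gamma> l = {((t, s), (t1, s1)). t < t1 \<and> t1 < t + l \<and>
     ((\<lambda>\<tau>. generating_function K \<gamma> \<tau> t1) has_real_derivative - s) (at t) \<and>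
     ((\<lambda>\<tau>. generating_function K \<gamma> t \<tau>) has_real_derivative s1) (at t1)}"

section \<open>Rotational invariant curves\<close>

text \<open>
  \<open>c\<close> is a lift of a parametrization of \<open>C\<close>, over \<open>\<real> / \<int>\<close>. The equation for \<open>c (u + 1)\<close> says that
  the curve is closed and winds once around the cylinder. Together with it, injectivity of \<open>c\<close>
  says that the curve is simple on the cylinder: \<open>c u = c v + (m * l, 0)\<close> with an integer \<open>m\<close>
  forces \<open>u = v + m\<close>.
\<close>

definition rotational_param :: "real \<Rightarrow> (real \<times> real) set \<Rightarrow> (real \<Rightarrow> real \<times> real) \<Rightarrow> bool" where
  "rotational_param l C c \<longleftrightarrow>
     continuous_on UNIV c \<and> inj c \<and> (\<forall>u. c (u + 1) = c u + (l, 0)) \<and> range c = C"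

definition rotational_invariant_curve ::
    "(real^2) set \<Rightarrow> (real \<Rightarrow> real^2) \<Rightarrow> real \<Rightarrow> (real \<times> real) set \<Rightarrow> bool" where
  "rotational_invariant_curve K \<gamma> l C \<longleftrightarrow>
     C \<subseteq> phase_cylinder K \<gamma> l \<and> (\<exists>c. rotational_param l C c) \<and> billiard_map K \<gamma> l `` C = C"

text \<open>
  \<open>F\<close> is the lift of the circle map induced on \<open>C\<close> for which a step advances the base point by
  an amount in \<open>{0<..<l}\<close>.
\<close>

definition has_rotation_number ::
    "(real^2) set \<Rightarrow> (real \<Rightarrow> real^2) \<Rightarrow> real \<Rightarrow> (real \<times> real) set \<Rightarrow> real \<Rightarrow> bool" where
  "has_rotation_number K \<gamma> l C \<rho> \<longleftrightarrow>
     (\<exists>c F. rotational_param l C c \<and> (\<forall>u. (c u, c (F u)) \<in> billiard_map K \<gamma> l) \<and>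
        (\<forall>u. (\<lambda>n. ((F ^^ n) u - u) / real n) \<longlonglongrightarrow> \<rho>))"

section \<open>Total integrability\<close>

definition C1_on :: "('a::real_normed_vector \<Rightarrow> 'b::real_normed_vector) \<Rightarrow> 'a set \<Rightarrow> bool" where
  "C1_on f S \<longleftrightarrow> (\<exists>f'. (\<forall>x\<in>S. (f has_derivative blinfun_apply (f' x)) (at x)) \<and> continuous_on S f')"

definition C1_diffeomorphism ::
    "'a::real_normed_vector set \<Rightarrow> 'b::real_normed_vector set \<Rightarrow> ('a \<Rightarrow> 'b) \<Rightarrow> bool" where
  "C1_diffeomorphism V W \<phi> \<longleftrightarrow> (\<exists>\<psi>. homeomorphism V W \<phi> \<psi> \<and> C1_on \<phi> V \<and> C1_on \<psi> W)"

text \<open>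
  A \<open>C\<^sup>1\<close> foliation of \<open>U\<close> by curves is a partition into leaves with foliated \<open>C\<^sup>1\<close> charts: in a
  chart, the components of a leaf are plaques, i.e. full horizontal segments of the open unit square.
\<close>

definition C1_foliation :: "(real \<times> real) set \<Rightarrow> (real \<times> real) set set \<Rightarrow> bool" where
  "C1_foliation U \<F> \<longleftrightarrow> partition_on U \<F> \<and>
     (\<forall>p\<in>U. \<exists>V \<phi>. open V \<and> p \<in> V \<and> V \<subseteq> U \<and>
        C1_diffeomorphism V ({0<..<1::real} \<times> {0<..<1::real}) \<phi> \<and>
        (\<forall>\<alpha>\<in>\<F>. \<forall>P\<in>components (\<alpha> \<inter> V). \<exists>y\<in>{0<..<1}. P = {q \<in> V. snd (\<phi> q) = y}))"

definition totally_integrable ::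
    "(real^2) set \<Rightarrow> (real \<Rightarrow> real^2) \<Rightarrow> real \<Rightarrow> (real \<times> real) set \<Rightarrow> bool" where
  "totally_integrable K \<gamma> l U \<longleftrightarrow>
     open U \<and> U \<subseteq> phase_cylinder K \<gamma> l \<and> (\<forall>t s. (t + l, s) \<in> U \<longleftrightarrow> (t, s) \<in> U) \<and>
     (\<exists>\<F>. C1_foliation U \<F> \<and> (\<forall>\<alpha>\<in>\<F>. rotational_invariant_curve K \<gamma> l \<alpha>))"

end

theory Submission
  imports Defs
begin

text \<open>
  Let \<open>Q\<close> be the power of \<open>A\<close> that moves the parameter of the curve by \<open>w = r l / k\<close>. The heart of
  the proof is that every polygon \<open>\<gamma> t, Q (\<gamma> t), Q (Q (\<gamma> t)), \<dots>\<close> is a billiard orbit. Once this is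
  known, the derivative of the side length \<open>t \<mapsto> L t (t + w)\<close>, which is the difference of the two
  momenta of the side, vanishes (\<open>sides_constant\<close>). So the gauge of \<open>Q z - z\<close> is a constant \<open>s\<close> for
  all points \<open>z\<close> of the curve, and \<open>B = (Q - id) / s\<close> is a linear symmetry of the region. In suitable
  coordinates \<open>Q\<close> is the rotation by an angle \<open>\<theta>\<close> between 0 and \<open>2 \<pi>\<close>, and \<open>B\<close> is the rotation by
  \<open>\<theta> / 2 + \<pi> / 2\<close>; indeed \<open>B \<circ> B = - Q\<close> (\<open>bisecting_symmetry\<close>). Counting orders gives the theorem: if
  \<open>k mod 4 = 2\<close>, then \<open>Q\<close> itself has the required order, otherwise \<open>B\<close> has it (\<open>more_symmetry\<close>).

  Total integrability enters through one leaf of the foliation. The given curve has rotation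
  number \<open>r / k\<close>, so it contains a periodic point, and the leaf through that point consists of
  periodic points only (\<open>leaf_map_id\<close>): let \<open>g\<close> be the \<open>k\<close>-th iterate of the billiard map, moved back
  by \<open>r\<close> turns. Around a fixed point of \<open>g\<close>, the map \<open>g \<circ> g\<close> sends every horizontal level of a foliated
  chart to itself, because it preserves the leaves and each leaf has only finitely many levels. If
  it contracted a piece of the leaf towards the fixed point, it would squeeze a thin box around this
  piece, up to small margins, into a strictly shorter one of the same height. As the chart is \<open>C\<^sup>1\<close>, this contradicts
  the preservation of area. So the fixed points of \<open>g\<close> form an open and closed subset of the leaf.

  The periodic orbits on this leaf form a continuous family that sweeps over the whole cylinder.
  The momenta at the ends of a chord are strictly monotone, therefore two orbits of which one lies
  below the other and touches it are equal (\<open>touching_family\<close>). Hence the family contains every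
  periodic orbit of its type and is totally ordered. For an orbit \<open>y\<close> it contains the time shift
  of \<open>y\<close> and, by the symmetry \<open>Q\<close>, the translate of \<open>y\<close> by \<open>w\<close>; both gain \<open>r l\<close> in \<open>k\<close> steps, so neither
  lies strictly above the other and they agree (\<open>symmetric_family\<close>). Thus every orbit of the leaf
  is one of the polygons above, and the leaf has a point over each \<open>t\<close>.

  The curvature of the curve may vanish, so that the billiard map need not be differentiable. It is
  still a homeomorphism, by strict monotonicity and invariance of domain, and it preserves area,
  because the two phase space images of a box of chords both have the second difference of \<open>L\<close>
  as their area (\<open>emeasure_chord_images\<close>).
\<close>

section \<open>Linear maps of finite order in the plane\<close>

lemma has_order_dvd:
  assumes "has_order A n"
  shows "A ^^ m = id \<longleftrightarrow> n dvd m"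
proof -
  have n: "0 < n" "A ^^ n = id" "\<And>m. 0 < m \<Longrightarrow> m < n \<Longrightarrow> A ^^ m \<noteq> id"
    using assms by (auto simp: has_order_def)
  have mult: "A ^^ (n * q) = id" for q
    by (simp only: funpow_mult[symmetric] n(2)) simp
  have "A ^^ m = A ^^ (m mod n) \<circ> A ^^ (n * (m div n))"
    by (simp only: funpow_add[symmetric] mod_mult_div_eq)
  then have "A ^^ m = A ^^ (m mod n)"
    by (simp add: mult)
  then show ?thesis
    using n by (metis dvd_eq_mod_eq_0 funpow_0 id_def eq_id_iff mod_less_divisor neq0_conv)
qed

lemma has_orderI_dvd:
  assumes "0 < n" "\<And>m. A ^^ m = id \<longleftrightarrow> n dvd m"
  shows "has_order A n"
  using assms by (auto simp: has_order_def dest: nat_dvd_not_less)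

lemma has_order_inj:
  assumes "has_order A n"
  shows "inj A"
proof -
  have "0 < n" "A ^^ n = id" using assms by (auto simp: has_order_def)
  then have "A ^^ (n - 1) \<circ> A = id" by (metis Suc_diff_1 funpow_Suc_right)
  then show ?thesis by (metis inj_on_id inj_on_imageI2)
qed

text \<open>
  If \<open>B ^^ j\<close> is the identity, then so is the \<open>j\<close>-th power of \<open>B \<circ> B\<close>; hence \<open>m\<close> divides \<open>j\<close>, so that \<open>j\<close>
  is even and \<open>m\<close> divides \<open>j div 2\<close>.
\<close>
lemma has_order_double:
  assumes "has_order (B \<circ> B) m" "even m"
  shows "has_order B (2 * m)"
proof (rule has_orderI_dvd)
  show "0 < 2 * m"
    using assms by (simp add: has_order_def)
  have unit_square: "(B \<circ> B) ^^ j = B ^^ (2 * j)" for j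
    using funpow_mult[where f=B and m=2 and n=j] by (simp add: numeral_2_eq_2)
  fix j
  show "B ^^ j = id \<longleftrightarrow> 2 * m dvd j"
  proof
    assume j: "B ^^ j = id"
    then have "(B \<circ> B) ^^ j = id"
      by (simp add: unit_square mult_2 funpow_add)
    then have "m dvd j"
      using has_order_dvd[OF assms(1)] by blast
    then have "even j"
      using assms(2) by (meson dvd_trans)
    then obtain i where i: "j = 2 * i" by blast
    then have "(B \<circ> B) ^^ i = id"
      using j by (simp add: unit_square)
    then show "2 * m dvd j"
      using has_order_dvd[OF assms(1)] i by auto
  next
    assume "2 * m dvd j"
    then obtain q where "j = 2 * (m * q)" by (metis dvdE mult.assoc)
    then show "B ^^ j = id"
      using unit_square[of "m * q"] has_order_dvd[OF assms(1), of "m * q"] by simp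
  qed
qed

lemma linear_funpow: "linear A \<Longrightarrow> linear (A ^^ n)" for A :: "'a::real_vector \<Rightarrow> 'a"
  by (induction n) (auto simp: linear_id linear_compose id_def[symmetric])

text \<open>
  If an odd power \<open>m\<close> of \<open>- Q\<close> is the identity, then \<open>k\<close> divides \<open>2 * m\<close>. This is impossible if 4 divides
  \<open>k\<close>; and for odd \<open>k\<close> it makes \<open>Q ^^ m\<close> the identity, so that \<open>-1 = 1\<close>.
\<close>
lemma has_order_neg:
  fixes Q :: "'a::real_vector \<Rightarrow> 'a"
  assumes "linear Q" "has_order Q k" "\<exists>v::'a. v \<noteq> 0" "\<not> k mod 4 = 2"
  shows "has_order (\<lambda>x. - Q x) (if k mod 4 = 0 then k else 2 * k)"
proof (rule has_orderI_dvd)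
  have k: "0 < k" using assms(2) by (simp add: has_order_def)
  then show "0 < (if k mod 4 = 0 then k else 2 * k)" by simp
  obtain v :: 'a where v: "v \<noteq> 0" using assms by blast
  have pw: "((\<lambda>x. - Q x) ^^ m) = (\<lambda>x. (-1) ^ m *\<^sub>R (Q ^^ m) x)" for m
  proof (induction m)
    case (Suc m)
    then show ?case
      by (simp add: fun_eq_iff linear_scale[OF assms(1)])
  qed simp
  have even_case: "((\<lambda>x. - Q x) ^^ m) = id \<longleftrightarrow> k dvd m" if "even m" for m
    using that has_order_dvd[OF assms(2), of m] by (simp add: pw)
  have odd_case: "((\<lambda>x. - Q x) ^^ m) \<noteq> id" if "odd m" "k mod 4 = 0 \<or> odd k" for m
  proof
    assume eq: "((\<lambda>x. - Q x) ^^ m) = id"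
    then have "((\<lambda>x. - Q x) ^^ (2 * m)) = id"
      by (simp add: mult_2 funpow_add)
    then have d: "k dvd 2 * m"
      using even_case by simp
    show False
    proof (cases "odd k")
      case True
      then have "k dvd m" using d by (simp add: coprime_dvd_mult_right_iff)
      then have "Q ^^ m = id" using has_order_dvd[OF assms(2)] by blast
      then have "- v = v" using eq \<open>odd m\<close> by (simp add: pw fun_eq_iff)
      then show False using v by (metis neg_equal_zero scaleR_minus1_left neg_equal_iff_equal add.inverse_neutral eq_neg_iff_add_eq_0 scaleR_2 scaleR_eq_0_iff zero_neq_numeral)
    next
      case False
      then have "4 dvd 2 * m" using that d by (metis dvd_trans mod_0_imp_dvd)
      then have "even m" by presburger
      then show False using that by simp
    qed
  qed
  have kc: "k mod 4 = 0 \<or> odd k" using assms(4) by presburger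
  fix m
  show "((\<lambda>x. - Q x) ^^ m) = id \<longleftrightarrow> (if k mod 4 = 0 then k else 2 * k) dvd m"
  proof (cases "even m")
    case True
    have "2 * k dvd m \<longleftrightarrow> k dvd m" if "odd k"
    proof
      assume "k dvd m"
      moreover have "coprime 2 k" using that by simp
      ultimately show "2 * k dvd m" using True divides_mult by blast
    qed auto
    then show ?thesis using even_case[OF True] kc by auto
  next
    case False
    then have "\<not> (if k mod 4 = 0 then k else 2 * k) dvd m"
      using kc by (auto dest!: dvd_trans[rotated, of k m 2] simp: mod_0_imp_dvd)
    then show ?thesis using odd_case[OF False kc] by blast
  qed
qed

lemma cross2_simps:
  "cross2 (x + y) z = cross2 x z + cross2 y z"
  "cross2 z (x + y) = cross2 z x + cross2 z y"
  "cross2 (x - y) z = cross2 x z - cross2 y z"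
  "cross2 z (x - y) = cross2 z x - cross2 z y"
  "cross2 (a *\<^sub>R x) z = a * cross2 x z"
  "cross2 z (a *\<^sub>R x) = a * cross2 z x"
  "cross2 (- x) z = - cross2 x z"
  "cross2 z (- x) = - cross2 z x"
  "cross2 x x = 0" "cross2 0 x = 0" "cross2 x 0 = 0"
  by (auto simp: cross2_def algebra_simps)

lemma cross2_commute: "cross2 x y = - cross2 y x"
  by (simp add: cross2_def)

lemma linear_plane_cayley_hamilton:
  fixes A :: "real^2 \<Rightarrow> real^2"
  assumes "linear A"
  obtains \<tau> d where "\<And>x. A (A x) = \<tau> *\<^sub>R A x - d *\<^sub>R x"
    "\<And>x y. cross2 (A x) (A y) = d * cross2 x y"
proof -
  define a b c e where "a = A (axis 1 1) $ 1" and "b = A (axis 2 1) $ 1"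
    and "c = A (axis 1 1) $ 2" and "e = A (axis 2 1) $ 2"
  have x: "x = x $ 1 *\<^sub>R axis 1 1 + x $ 2 *\<^sub>R axis 2 1" for x :: "real^2"
    by (simp add: vec_eq_iff forall_2 axis_def)
  have Ax: "A x = x $ 1 *\<^sub>R A (axis 1 1) + x $ 2 *\<^sub>R A (axis 2 1)" for x
    using arg_cong[OF x[of x], of A] by (simp only: linear_add[OF assms] linear_scale[OF assms])
  have A1: "A x $ 1 = a * x $ 1 + b * x $ 2" and A2: "A x $ 2 = c * x $ 1 + e * x $ 2" for x
    using Ax[of x] by (simp_all add: a_def b_def c_def e_def)
  show ?thesis
  proof
    fix x y
    show "A (A x) = (a + e) *\<^sub>R A x - (a * e - b * c) *\<^sub>R x"
      by (simp add: vec_eq_iff forall_2 A1 A2 algebra_simps)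
    show "cross2 (A x) (A y) = (a * e - b * c) * cross2 x y"
      by (simp add: cross2_def A1 A2 algebra_simps)
  qed
qed

text \<open>
  A real eigenvalue of a map of finite order is 1 or -1, and so is the other root of the characteristic
  polynomial. If both are equal, a Jordan block is excluded, because its powers grow linearly; if
  they differ, the characteristic polynomial is \<open>x\<^sup>2 - 1\<close>.
\<close>
lemma finite_order_real_eigenvalue:
  fixes A :: "real^2 \<Rightarrow> real^2"
  assumes lin: "linear A" and k: "A ^^ k = id" "0 < k" and v: "A v = e *\<^sub>R v" "v \<noteq> 0"
  shows "A \<circ> A = id"
proof -
  obtain \<tau> d where ch: "\<And>x. A (A x) = \<tau> *\<^sub>R A x - d *\<^sub>R x"
    using linear_plane_cayley_hamilton[OF lin] by metis
  have pw: "(A ^^ n) w = f ^ n *\<^sub>R w" if "A w = f *\<^sub>R w" for n w f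
    by (induction n) (auto simp: that linear_scale[OF lin])
  have unit: "f = 1 \<or> f = -1" if "A w = f *\<^sub>R w" "w \<noteq> 0" for f w
  proof -
    have "w = f ^ k *\<^sub>R w" using pw[OF that(1), of k] k by simp
    then have "(f ^ k - 1) *\<^sub>R w = 0" by (simp add: algebra_simps)
    then have "f ^ k = 1" using that by simp
    then have "\<bar>f\<bar> ^ k = 1 ^ k" by (simp add: power_abs[symmetric])
    then have "\<bar>f\<bar> = 1" using k(2) power_eq_imp_eq_base[of "\<bar>f\<bar>" k 1] by simp
    then show ?thesis by linarith
  qed
  have ee: "e = 1 \<or> e = -1" using unit v by blast
  have "e *\<^sub>R e *\<^sub>R v = \<tau> *\<^sub>R e *\<^sub>R v - d *\<^sub>R v"
    using ch[of v] v by (simp add: linear_scale[OF lin])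
  then have "(e * e - \<tau> * e + d) *\<^sub>R v = 0"
    by (simp add: algebra_simps)
  \<comment> \<open>e is a root of the characteristic polynomial; f below is the other one\<close>
  then have d: "d = \<tau> * e - e * e" using v by simp
  define f where "f = \<tau> - e"
  have ch': "A (A x) = (e + f) *\<^sub>R A x - (e * f) *\<^sub>R x" for x
    using ch[of x] d by (simp add: f_def algebra_simps)
  show ?thesis
  proof (cases "\<forall>x. A x = e *\<^sub>R x")
    case True
    then show ?thesis using ee by (auto simp: fun_eq_iff)
  next
    case False
    then obtain x where x: "A x - e *\<^sub>R x \<noteq> 0" by auto
    have "A (A x - e *\<^sub>R x) = f *\<^sub>R (A x - e *\<^sub>R x)"
      by (simp add: linear_diff[OF lin] linear_scale[OF lin] ch' algebra_simps)
    then have ff: "f = 1 \<or> f = -1" using unit x by blast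
    show ?thesis
    proof (cases "f = e")
      case True
      define w where "w = A x - e *\<^sub>R x"
      have w: "A w = e *\<^sub>R w"
        using \<open>A (A x - e *\<^sub>R x) = _\<close> True by (simp add: w_def)
      have "(A ^^ n) x = e ^ n *\<^sub>R x + (real n * e ^ (n - 1)) *\<^sub>R w" for n
      proof (induction n)
        case (Suc n)
        have "A x = e *\<^sub>R x + w" by (simp add: w_def)
        then have "(A ^^ Suc n) x = e ^ Suc n *\<^sub>R x + (e ^ n + real n * e ^ (n - 1) * e) *\<^sub>R w"
          by (simp add: Suc linear_add[OF lin] linear_scale[OF lin] w algebra_simps)
        also have "e ^ n + real n * e ^ (n - 1) * e = real (Suc n) * e ^ n"
          by (cases n) (auto simp: algebra_simps)
        finally show ?case by simp
      qed simp
      from this[of k] have kx: "x = e ^ k *\<^sub>R x + (real k * e ^ (k - 1)) *\<^sub>R w"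
        using k by simp
      have "v = e ^ k *\<^sub>R v" using pw[OF v(1), of k] k by simp
      then have "(e ^ k - 1) *\<^sub>R v = 0" by (simp add: algebra_simps)
      then have "e ^ k = 1" using v by simp
      then have "(real k * e ^ (k - 1)) *\<^sub>R w = 0" using kx by simp
      then have "w = 0" using k ee by auto
      then show ?thesis using x by (simp add: w_def)
    next
      case False
      then have "e + f = 0" "e * f = -1" using ee ff by auto
      then show ?thesis using ch' by (auto simp: fun_eq_iff)
    qed
  qed
qed

text \<open>
  Without real eigenvalues the discriminant is negative. Hence the determinant is positive and,
  being a root of unity, equal to 1.
\<close>
lemma finite_order_plane:
  fixes A :: "real^2 \<Rightarrow> real^2"
  assumes lin: "linear A" and ord: "has_order A k" and k3: "k \<ge> 3"
  obtains \<tau> where "\<And>x. A (A x) = \<tau> *\<^sub>R A x - x"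
    "\<And>x y. cross2 (A x) (A y) = cross2 x y" "\<tau> < 2" "\<And>v. A v = v \<Longrightarrow> v = 0"
proof -
  have Ak: "A ^^ k = id" "0 < k" using ord by (auto simp: has_order_def)
  have "A ^^ 2 \<noteq> id" using ord k3 by (auto simp: has_order_def)
  then have noev: "v = 0" if "A v = e *\<^sub>R v" for v e
    using finite_order_real_eigenvalue[OF lin Ak that] by (auto simp: numeral_2_eq_2)
  obtain \<tau> d where ch: "\<And>x. A (A x) = \<tau> *\<^sub>R A x - d *\<^sub>R x"
    and cr: "\<And>x y. cross2 (A x) (A y) = d * cross2 x y"
    using linear_plane_cayley_hamilton[OF lin] by metis
  have disc: "\<tau>\<^sup>2 < 4 * d"
  proof (rule ccontr)
    assume "\<not> ?thesis"
    then have nn: "\<tau>\<^sup>2 - 4 * d \<ge> 0" by simp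
    define s where "s = sqrt (\<tau>\<^sup>2 - 4 * d)"
    have s: "s * s = \<tau> * \<tau> - 4 * d" using nn by (simp add: s_def power2_eq_square)
    \<comment> \<open>otherwise the characteristic polynomial has the real roots e and f\<close>
    define e f where "e = (\<tau> + s) / 2" and "f = (\<tau> - s) / 2"
    have ef: "\<tau> = e + f" by (simp add: e_def f_def field_simps)
    have "4 * (e * f) = (\<tau> + s) * (\<tau> - s)" by (simp add: e_def f_def)
    then have "4 * (e * f) = \<tau> * \<tau> - s * s" by (simp add: algebra_simps)
    then have d: "d = e * f" using s by simp
    define x :: "real^2" where "x = axis 1 1"
    have x: "x \<noteq> 0" by (simp add: x_def)
    have "A (A x - e *\<^sub>R x) = f *\<^sub>R (A x - e *\<^sub>R x)"
      by (simp add: linear_diff[OF lin] linear_scale[OF lin] ch d ef algebra_simps)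
    then have "A x - e *\<^sub>R x = 0" by (rule noev)
    then have "x = 0" using noev[of x e] by simp
    then show False using x by simp
  qed
  have crn: "cross2 ((A ^^ n) x) ((A ^^ n) y) = d ^ n * cross2 x y" for n x y
    by (induction n) (auto simp: cr)
  have "d ^ k = 1"
    using crn[of k "axis 1 1" "axis 2 1"] Ak by (simp add: cross2_def axis_def)
  moreover have "0 < d" using disc zero_le_power2[of \<tau>] by linarith
  ultimately have d: "d = 1"
    using Ak(2) power_eq_imp_eq_base[of d k 1] by simp
  show ?thesis
  proof
    show "A (A x) = \<tau> *\<^sub>R A x - x" for x using ch d by simp
    show "cross2 (A x) (A y) = cross2 x y" for x y using cr d by simp
    have "\<tau>\<^sup>2 < 2\<^sup>2" using disc d by simp
    then show "\<tau> < 2" by (rule power_less_imp_less_base) simp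
    show "v = 0" if "A v = v" for v using noev[of v 1] that by simp
  qed
qed

section \<open>Area preservation of twist maps\<close>

lemma periodic_int:
  fixes f :: "real \<Rightarrow> 'a"
  assumes "\<And>t. f (t + l) = f t"
  shows "f (t + of_int n * l) = f t"
proof -
  have nat: "f (t + real m * l) = f t" for m t
  proof (induction m)
    case (Suc m)
    have "f (t + real (Suc m) * l) = f ((t + real m * l) + l)" by (simp add: algebra_simps)
    then show ?case using assms Suc by simp
  qed simp
  show ?thesis
  proof (cases n rule: int_cases2)
    case (nonneg m)
    then show ?thesis using nat by simp
  next
    case (nonpos m)
    then show ?thesis using nat[of "t - real m * l" m] by simp
  qed
qed

text \<open>
  Fubini reduces the area to the integral of the height, of which \<open>G\<close> is an antiderivative.
\<close>
lemma emeasure_region_between: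
  fixes f g G :: "real \<Rightarrow> real"
  assumes pq: "p \<le> q" and cf: "continuous_on {p..q} f" and cg: "continuous_on {p..q} g"
    and fg: "\<And>t. t \<in> {p..q} \<Longrightarrow> f t \<le> g t"
    and G: "\<And>t. t \<in> {p..q} \<Longrightarrow> (G has_real_derivative g t - f t) (at t)"
  shows "emeasure lborel {(t, s). p < t \<and> t < q \<and> f t < s \<and> s < g t} = ennreal (G q - G p)"
    and "open {(t, s). p < t \<and> t < q \<and> f t < s \<and> s < g t}"
proof -
  define X where "X = {(t, s). p < t \<and> t < q \<and> f t < s \<and> s < g t}"
  have op: "open (({p<..<q} \<times> UNIV) \<inter> (\<lambda>x. (snd x - f (fst x), g (fst x) - snd x)) -` ({0<..} \<times> {0<..}))"
    by (rule continuous_open_preimage)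
       (auto intro!: continuous_intros open_Times continuous_on_subset[OF cf]
         continuous_on_subset[OF cg] continuous_on_compose2[OF cf] continuous_on_compose2[OF cg])
  have X_eq: "X = ({p<..<q} \<times> UNIV) \<inter> (\<lambda>x. (snd x - f (fst x), g (fst x) - snd x)) -` ({0<..} \<times> {0<..})"
    by (auto simp: X_def)
  show "open {(t, s). p < t \<and> t < q \<and> f t < s \<and> s < g t}"
    using op X_eq by (simp add: X_def)
  then have Xb: "X \<in> sets borel" by (simp add: X_def)
  have meas: "X \<in> sets (lborel \<Otimes>\<^sub>M lborel)"
    using Xb by (metis lborel_prod sets_lborel)
  have slice: "emeasure lborel (Pair t -` X) = ennreal ((g t - f t) * indicator {p<..<q} t)" for t
  proof (cases "t \<in> {p<..<q}")
    case True
    then have "Pair t -` X = {f t<..<g t}" by (auto simp: X_def)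
    then show ?thesis using True fg[of t] by simp
  next
    case False
    then have "Pair t -` X = {}" by (auto simp: X_def)
    then show ?thesis using False by simp
  qed
  have I: "((\<lambda>t. g t - f t) has_integral (G q - G p)) {p..q}"
    by (rule fundamental_theorem_of_calculus[OF pq])
       (use G in \<open>auto simp: has_real_derivative_iff_has_vector_derivative[symmetric]
          intro: has_field_derivative_at_within\<close>)
  have "emeasure lborel X = emeasure (lborel \<Otimes>\<^sub>M lborel) X"
    by (simp add: lborel_prod)
  also have "\<dots> = (\<integral>\<^sup>+ t. emeasure lborel (Pair t -` X) \<partial>lborel)"
    by (rule lborel.emeasure_pair_measure_alt[OF meas])
  also have "\<dots> = (\<integral>\<^sup>+ t. ennreal ((g t - f t) * indicator {p<..<q} t) \<partial>lborel)"
    by (simp add: slice)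
  also have "\<dots> = (\<integral>\<^sup>+ t. ennreal ((g t - f t) * indicator {p..q} t) \<partial>lborel)"
  proof (rule nn_integral_cong_AE)
    have "AE t in lborel. t \<noteq> p" "AE t in lborel. t \<noteq> q"
      by (rule AE_lborel_singleton)+
    then show "AE t in lborel. ennreal ((g t - f t) * indicator {p<..<q} t) = ennreal ((g t - f t) * indicator {p..q} t)"
      by eventually_elim (auto simp: indicator_def)
  qed
  also have "\<dots> = ennreal (G q - G p)"
  proof (rule nn_integral_has_integral_lborel)
    have "(\<lambda>t. indicator {p..q} t *\<^sub>R (g t - f t)) \<in> borel_measurable borel"
      by (rule borel_measurable_continuous_on_indicator) (auto intro!: continuous_intros cf cg)
    then show "(\<lambda>t. (g t - f t) * indicator {p..q} t) \<in> borel_measurable borel"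
      by (simp add: mult.commute)
    show "0 \<le> (g t - f t) * indicator {p..q} t" for t
      using fg by (auto simp: indicator_def)
    have "((\<lambda>t. if t \<in> {p..q} then g t - f t else 0) has_integral (G q - G p)) UNIV"
      using I by (subst has_integral_restrict_UNIV)
    then show "((\<lambda>t. (g t - f t) * indicator {p..q} t) has_integral (G q - G p)) UNIV"
      by (rule has_integral_eq[rotated]) (auto simp: indicator_def)
  qed
  finally show "emeasure lborel {(t, s). p < t \<and> t < q \<and> f t < s \<and> s < g t} = ennreal (G q - G p)"
    by (simp add: X_def)
qed

lemma box_Pair_real: "box (p, p') (q, q') = {p<..<q} \<times> {p'<..<q'}" for p p' q q' :: real
  by (auto simp: box_def Basis_prod_def)

lemma cbox_Pair_real: "cbox (p, p') (q, q') = {p..q} \<times> {p'..q'}" for p p' q q' :: real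
  by (auto simp: cbox_def Basis_prod_def)

text \<open>
  A billiard in chord coordinates: for the chord from \<open>t\<close> to \<open>t1\<close>, the numbers \<open>a t t1\<close> and \<open>b t t1\<close> are
  the momenta at its start and at its end. That they are strictly monotone in the other end of the
  chord replaces the usual condition on the mixed derivative of \<open>L\<close>, which may fail where the
  curvature vanishes.
\<close>
locale twist =
  fixes l :: real and L a b :: "real \<Rightarrow> real \<Rightarrow> real"
  assumes l_pos: "0 < l"
    and L_deriv1: "\<And>t t1. t < t1 \<Longrightarrow> t1 < t + l \<Longrightarrow> ((\<lambda>\<tau>. L \<tau> t1) has_real_derivative - a t t1) (at t)"
    and L_deriv2: "\<And>t t1. t < t1 \<Longrightarrow> t1 < t + l \<Longrightarrow> ((\<lambda>\<tau>. L t \<tau>) has_real_derivative b t t1) (at t1)"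
    and a_cont: "continuous_on {(t, t1). t < t1 \<and> t1 < t + l} (\<lambda>(t, t1). a t t1)"
    and b_cont: "continuous_on {(t, t1). t < t1 \<and> t1 < t + l} (\<lambda>(t, t1). b t t1)"
    and a_mono: "\<And>t t1 t1'. t < t1 \<Longrightarrow> t1 < t1' \<Longrightarrow> t1' < t + l \<Longrightarrow> a t t1' < a t t1"
    and b_mono: "\<And>t t' t1. t < t' \<Longrightarrow> t' < t1 \<Longrightarrow> t1 < t + l \<Longrightarrow> b t t1 < b t' t1"
    and a_periodic: "\<And>t t1. a (t + l) (t1 + l) = a t t1"
    and b_periodic: "\<And>t t1. b (t + l) (t1 + l) = b t t1"
begin

definition chords :: "(real \<times> real) set" where
  "chords = {(t, t1). t < t1 \<and> t1 < t + l}"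

text \<open>
  A chord determines a phase point at its start and one at its end (\<open>chord_in\<close>); the billiard map
  leads from the first to the second.
\<close>
definition chord_out :: "real \<times> real \<Rightarrow> real \<times> real" where
  "chord_out = (\<lambda>(t, t1). (t, a t t1))"

definition chord_in :: "real \<times> real \<Rightarrow> real \<times> real" where
  "chord_in = (\<lambda>(t, t1). (t1, b t t1))"

lemma open_chords: "open chords"
proof -
  have "chords = {x. fst x < snd x} \<inter> {x. snd x < fst x + l}"
    by (auto simp: chords_def)
  then show ?thesis
    by (simp add: open_Int open_Collect_less continuous_intros)
qed

lemma continuous_on_chord_out: "continuous_on chords chord_out"
  using a_cont unfolding chords_def chord_out_def
  by (auto simp: case_prod_unfold intro!: continuous_intros)

lemma continuous_on_chord_in: "continuous_on chords chord_in"
  using b_cont unfolding chords_def chord_in_def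
  by (auto simp: case_prod_unfold intro!: continuous_intros)

lemma inj_on_chord_out: "inj_on chord_out chords"
proof (rule inj_onI, clarify)
  fix t t1 t' t1' assume c: "(t, t1) \<in> chords" "(t', t1') \<in> chords"
    and eq: "chord_out (t, t1) = chord_out (t', t1')"
  then show "t = t' \<and> t1 = t1'"
    using a_mono[of t t1 t1'] a_mono[of t t1' t1]
    by (cases t1 t1' rule: linorder_cases) (auto simp: chord_out_def chords_def)
qed

lemma inj_on_chord_in: "inj_on chord_in chords"
proof (rule inj_onI, clarify)
  fix t t1 t' t1' assume c: "(t, t1) \<in> chords" "(t', t1') \<in> chords"
    and eq: "chord_in (t, t1) = chord_in (t', t1')"
  then show "t = t' \<and> t1 = t1'"
    using b_mono[of t t' t1] b_mono[of t' t t1]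
    by (cases t t' rule: linorder_cases) (auto simp: chord_in_def chords_def)
qed

lemma cbox_chords_iff:
  assumes "p \<le> q" "p' \<le> q'"
  shows "cbox (p, p') (q, q') \<subseteq> chords \<longleftrightarrow> q < p' \<and> q' < p + l"
proof
  assume sub: "cbox (p, p') (q, q') \<subseteq> chords"
  have "(q, p') \<in> cbox (p, p') (q, q')" "(p, q') \<in> cbox (p, p') (q, q')"
    using assms by (auto simp: cbox_Pair_real)
  then show "q < p' \<and> q' < p + l"
    using subsetD[OF sub] by (fastforce simp: chords_def)
next
  assume "q < p' \<and> q' < p + l"
  then show "cbox (p, p') (q, q') \<subseteq> chords"
    by (auto simp: chords_def cbox_Pair_real)
qed

lemma a_cont1: "continuous_on S (\<lambda>t. a t t1)" if "\<And>t. t \<in> S \<Longrightarrow> t < t1 \<and> t1 < t + l"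
  using that
  by (intro continuous_on_compose2[OF a_cont, of S "\<lambda>t. (t, t1)", simplified] continuous_intros) auto

lemma a_cont2: "continuous_on S (\<lambda>t1. a t t1)" if "\<And>t1. t1 \<in> S \<Longrightarrow> t < t1 \<and> t1 < t + l"
  using that
  by (intro continuous_on_compose2[OF a_cont, of S "\<lambda>t1. (t, t1)", simplified] continuous_intros) auto

lemma b_cont1: "continuous_on S (\<lambda>t. b t t1)" if "\<And>t. t \<in> S \<Longrightarrow> t < t1 \<and> t1 < t + l"
  using that
  by (intro continuous_on_compose2[OF b_cont, of S "\<lambda>t. (t, t1)", simplified] continuous_intros) auto

lemma b_cont2: "continuous_on S (\<lambda>t1. b t t1)" if "\<And>t1. t1 \<in> S \<Longrightarrow> t < t1 \<and> t1 < t + l"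
  using that
  by (intro continuous_on_compose2[OF b_cont, of S "\<lambda>t1. (t, t1)", simplified] continuous_intros) auto

text \<open>
  The image of a box is the region between two graphs, and integrating the difference of the momenta
  gives a second difference of \<open>L\<close>. As this is symmetric in the two variables, \<open>chord_in\<close> yields the
  same area.
\<close>
lemma emeasure_chord_out_box:
  assumes pq: "p < q" "p' < q'" and sub: "cbox (p, p') (q, q') \<subseteq> chords"
  shows "emeasure lborel (chord_out ` box (p, p') (q, q')) = ennreal (L q q' - L q p' - L p q' + L p p')"
proof -
  have lt: "q < p'" "q' < p + l"
    using sub pq by (auto simp: cbox_chords_iff)
  have img: "chord_out ` box (p, p') (q, q') = {(t, s). p < t \<and> t < q \<and> a t q' < s \<and> s < a t p'}"
  proof (rule set_eqI, rule iffI)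
    fix z assume "z \<in> chord_out ` box (p, p') (q, q')"
    then obtain t t1 where "z = (t, a t t1)" "p < t" "t < q" "p' < t1" "t1 < q'"
      by (auto simp: chord_out_def box_Pair_real)
    then show "z \<in> {(t, s). p < t \<and> t < q \<and> a t q' < s \<and> s < a t p'}"
      using lt a_mono[of t p' t1] a_mono[of t t1 q'] by auto
  next
    fix z assume "z \<in> {(t, s). p < t \<and> t < q \<and> a t q' < s \<and> s < a t p'}"
    then obtain t s where z: "z = (t, s)" and h: "p < t" "t < q" "a t q' < s" "s < a t p'" by blast
    have "\<exists>t1\<ge>p'. t1 \<le> q' \<and> a t t1 = s"
      by (rule IVT2') (use h lt pq in \<open>auto intro!: a_cont2\<close>)
    then obtain t1 where t1: "p' \<le> t1" "t1 \<le> q'" "a t t1 = s" by blast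
    then have "p' < t1" "t1 < q'" using h by (auto simp: less_le)
    then show "z \<in> chord_out ` box (p, p') (q, q')"
      using z h t1 by (auto simp: chord_out_def box_Pair_real image_iff)
  qed
  have "emeasure lborel {(t, s). p < t \<and> t < q \<and> a t q' < s \<and> s < a t p'}
      = ennreal ((L q q' - L q p') - (L p q' - L p p'))"
  proof (rule emeasure_region_between(1)[where G = "\<lambda>t. L t q' - L t p'"])
    fix t assume t: "t \<in> {p..q}"
    then show "a t q' \<le> a t p'" using a_mono[of t p' q'] lt pq by auto
    have "((\<lambda>t. L t q' - L t p') has_real_derivative (- a t q') - (- a t p')) (at t)"
      by (rule DERIV_diff; rule L_deriv1) (use t lt pq in auto)
    then show "((\<lambda>t. L t q' - L t p') has_real_derivative a t p' - a t q') (at t)"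
      by simp
  qed (use lt pq in \<open>auto intro!: a_cont1\<close>)
  then show ?thesis unfolding img by (simp add: algebra_simps)
qed

lemma emeasure_chord_in_box:
  assumes pq: "p < q" "p' < q'" and sub: "cbox (p, p') (q, q') \<subseteq> chords"
  shows "emeasure lborel (chord_in ` box (p, p') (q, q')) = ennreal (L q q' - L q p' - L p q' + L p p')"
proof -
  have lt: "q < p'" "q' < p + l"
    using sub pq by (auto simp: cbox_chords_iff)
  have img: "chord_in ` box (p, p') (q, q') = {(t, s). p' < t \<and> t < q' \<and> b p t < s \<and> s < b q t}"
  proof (rule set_eqI, rule iffI)
    fix z assume "z \<in> chord_in ` box (p, p') (q, q')"
    then obtain t t1 where "z = (t1, b t t1)" "p < t" "t < q" "p' < t1" "t1 < q'"
      by (auto simp: chord_in_def box_Pair_real)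
    then show "z \<in> {(t, s). p' < t \<and> t < q' \<and> b p t < s \<and> s < b q t}"
      using lt b_mono[of p t t1] b_mono[of t q t1] by auto
  next
    fix z assume "z \<in> {(t, s). p' < t \<and> t < q' \<and> b p t < s \<and> s < b q t}"
    then obtain t1 s where z: "z = (t1, s)" and h: "p' < t1" "t1 < q'" "b p t1 < s" "s < b q t1" by blast
    have "\<exists>t\<ge>p. t \<le> q \<and> b t t1 = s"
      by (rule IVT') (use h lt pq in \<open>auto intro!: b_cont1\<close>)
    then obtain t where t: "p \<le> t" "t \<le> q" "b t t1 = s" by blast
    then have "p < t" "t < q" using h by (auto simp: less_le)
    then show "z \<in> chord_in ` box (p, p') (q, q')"
      using z h t by (auto simp: chord_in_def box_Pair_real image_iff)
  qed
  have "emeasure lborel {(t, s). p' < t \<and> t < q' \<and> b p t < s \<and> s < b q t}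
      = ennreal ((L q q' - L p q') - (L q p' - L p p'))"
  proof (rule emeasure_region_between(1)[where G = "\<lambda>t. L q t - L p t"])
    fix t assume t: "t \<in> {p'..q'}"
    then show "b p t \<le> b q t" using b_mono[of p q t] lt pq by auto
    show "((\<lambda>t. L q t - L p t) has_real_derivative b q t - b p t) (at t)"
      by (rule DERIV_diff; rule L_deriv2) (use t lt pq in auto)
  qed (use lt pq in \<open>auto intro!: b_cont2\<close>)
  then show ?thesis unfolding img by (simp add: algebra_simps)
qed

end

text \<open>
  The areas of the images form a Borel measure, since the inverse of \<open>f\<close> is continuous by invariance of
  domain. Two such measures can be compared on a generating system.
\<close>
lemma pullback_measure:
  fixes f :: "real \<times> real \<Rightarrow> real \<times> real"
  assumes "open D" "continuous_on D f" "inj_on f D"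
  obtains M where "sets M = sets borel" "\<And>X. X \<in> sets borel \<Longrightarrow> emeasure M X = emeasure lborel (f ` (X \<inter> D))"
proof -
  obtain g where g: "homeomorphism D (f ` D) f g"
    using invariance_of_domain_homeomorphism[OF assms(1,2) _ assms(3)] by auto
  have op: "open (f ` D)"
    using assms by (intro invariance_of_domain)
  have "g \<in> measurable (restrict_space borel (f ` D)) borel"
    using g by (intro borel_measurable_continuous_on_restrict) (simp add: homeomorphism_def)
  moreover have "sets (restrict_space lborel (f ` D)) = sets (restrict_space borel (f ` D))"
    by (rule sets_restrict_space_cong) simp
  ultimately have gm: "g \<in> measurable (restrict_space lborel (f ` D)) borel"
    using measurable_cong_sets by blast
  define M where "M = distr (restrict_space lborel (f ` D)) borel g"
  show ?thesis
  proof
    show "sets M = sets borel" by (simp add: M_def)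
    fix X :: "(real \<times> real) set" assume X: "X \<in> sets borel"
    have "g -` X \<inter> f ` D = f ` (X \<inter> D)"
      using g by (auto simp: homeomorphism_def)
    moreover have "emeasure M X = emeasure (restrict_space lborel (f ` D)) (g -` X \<inter> f ` D)"
      unfolding M_def using X gm by (subst emeasure_distr) (auto simp: space_restrict_space)
    moreover have "\<dots> = emeasure lborel (g -` X \<inter> f ` D)"
      using op by (intro emeasure_restrict_space) auto
    ultimately show "emeasure M X = emeasure lborel (f ` (X \<inter> D))" by simp
  qed
qed


context twist
begin

text \<open>
  The two pulled back measures agree on boxes, hence on all Borel subsets of a box of chords;
  finitely many such boxes cover a compact set.
\<close>
lemma emeasure_chord_images:
  assumes S: "compact S" "S \<subseteq> chords"
  shows "emeasure lborel (chord_in ` S) = emeasure lborel (chord_out ` S)"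
proof -
  obtain M where M: "sets M = sets borel"
    "\<And>X. X \<in> sets borel \<Longrightarrow> emeasure M X = emeasure lborel (chord_out ` (X \<inter> chords))"
    using pullback_measure[OF open_chords continuous_on_chord_out inj_on_chord_out] by blast
  obtain N where N: "sets N = sets borel"
    "\<And>X. X \<in> sets borel \<Longrightarrow> emeasure N X = emeasure lborel (chord_in ` (X \<inter> chords))"
    using pullback_measure[OF open_chords continuous_on_chord_in inj_on_chord_in] by blast
  have boxes: "emeasure M (box x y) = emeasure N (box x y) \<and> emeasure M (box x y) \<noteq> \<infinity>"
    if "cbox x y \<subseteq> chords" for x y :: "real \<times> real"
  proof -
    obtain p p' q q' where xy: "x = (p, p')" "y = (q, q')" by fastforce
    show ?thesis
    proof (cases "p < q \<and> p' < q'")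
      case True
      have "box x y \<inter> chords = box x y" using that box_subset_cbox by blast
      then show ?thesis
        using that True emeasure_chord_out_box[of p q p' q'] emeasure_chord_in_box[of p q p' q']
        by (simp add: M(2) N(2) xy)
    next
      case False
      then have "box x y = {}" by (auto simp: xy box_Pair_real)
      then show ?thesis by simp
    qed
  qed
  have local: "emeasure M X = emeasure N X"
    if Q: "cbox u v \<subseteq> chords" and X: "X \<in> sets borel" "X \<subseteq> box u v" for u v X
  proof -
    let ?M = "density M (indicator (box u v))" and ?N = "density N (indicator (box u v))"
    have "?M = ?N"
    proof (rule measure_eqI_generator_eq)
      let ?E = "range (\<lambda>(a, b). box a b :: (real \<times> real) set)"
      show "Int_stable ?E"
        by (auto simp: Int_stable_def box_Int_box)
      show "?E \<subseteq> Pow UNIV" "sets ?M = sigma_sets UNIV ?E"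
        "sets ?N = sigma_sets UNIV ?E"
        by (simp_all add: borel_eq_box M N)
      let ?A = "\<lambda>n::nat. box (- (real n *\<^sub>R One)) (real n *\<^sub>R One) :: (real \<times> real) set"
      show "range ?A \<subseteq> ?E" "(\<Union>i. ?A i) = UNIV"
        unfolding UN_box_eq_UNIV by auto
      have eq: "emeasure ?M Y = emeasure ?N Y
          \<and> emeasure ?M Y \<noteq> \<infinity>" if "Y \<in> ?E" for Y
      proof -
        obtain z :: "(real \<times> real) \<times> (real \<times> real)" where "Y = (case z of (a, b) \<Rightarrow> box a b)"
          using \<open>Y \<in> ?E\<close> by blast
        then obtain x y where Y: "Y = box x y" by (simp add: case_prod_beta)
        obtain x' y' where int: "box u v \<inter> Y = box x' y'" unfolding Y box_Int_box by blast
        show ?thesis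
        proof (cases "box u v \<inter> Y = {}")
          case True
          then show ?thesis using Y M(1) N(1) by (simp add: emeasure_restricted)
        next
          case False
          then have "cbox x' y' = closure (box u v \<inter> Y)" using int by (simp add: closure_box)
          also have "\<dots> \<subseteq> cbox u v" by (meson Int_lower1 box_subset_cbox closed_cbox closure_minimal order_trans)
          finally have "cbox x' y' \<subseteq> chords" using Q by blast
          then show ?thesis using boxes[of x' y'] int[unfolded Y] Y M(1) N(1) by (auto simp: emeasure_restricted)
        qed
      qed
      show "emeasure ?M (?A i) \<noteq> \<infinity>" for i
        using eq[of "?A i"] by blast
      show "emeasure ?M X = emeasure ?N X"
        if "X \<in> ?E" for X
        using eq that by blast
    qed
    then have "emeasure ?M X = emeasure ?N X"
      by simp
    moreover have "box u v \<inter> X = X" using X by blast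
    ultimately show ?thesis using X M(1) N(1) by (simp add: emeasure_restricted)
  qed
  have fin: "emeasure M X = emeasure N X"
    if "finite \<D>" "\<forall>B\<in>\<D>. \<exists>u v. B = box u v \<and> cbox u v \<subseteq> chords" "X \<in> sets borel" "X \<subseteq> \<Union>\<D>" for \<D> X
    using that
  proof (induction \<D> arbitrary: X rule: finite_induct)
    case (insert B \<D>)
    obtain u v where B: "B = box u v" "cbox u v \<subseteq> chords" using insert.prems(1) by auto
    have sets: "X \<inter> B \<in> sets borel" "X - B \<in> sets borel"
      using insert.prems(2) B(1) by auto
    have "emeasure M (X \<inter> B) = emeasure N (X \<inter> B)"
      using B sets by (intro local[OF B(2)]) auto
    moreover have "emeasure M (X - B) = emeasure N (X - B)"
      using sets insert.prems by (intro insert.IH) auto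
    moreover have "emeasure M (X \<inter> B) + emeasure M (X - B) = emeasure M ((X \<inter> B) \<union> (X - B))"
      using sets M(1) by (intro plus_emeasure) auto
    moreover have "emeasure N (X \<inter> B) + emeasure N (X - B) = emeasure N ((X \<inter> B) \<union> (X - B))"
      using sets N(1) by (intro plus_emeasure) auto
    moreover have "(X \<inter> B) \<union> (X - B) = X" by blast
    ultimately show ?case by simp
  qed simp
  define \<C> where "\<C> = {B. \<exists>u v. B = box u v \<and> cbox u v \<subseteq> chords}"
  have "S \<subseteq> \<Union>\<C>"
  proof
    fix x assume "x \<in> S"
    then have "x \<in> chords" using S(2) by blast
    then obtain u v where "x \<in> box u v" "cbox u v \<subseteq> chords"
      using open_contains_cbox[OF open_chords] by metis
    then show "x \<in> \<Union>\<C>" unfolding \<C>_def by blast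
  qed
  moreover have "open B" if "B \<in> \<C>" for B using that by (auto simp: \<C>_def)
  ultimately obtain \<D> where "\<D> \<subseteq> \<C>" "finite \<D>" "S \<subseteq> \<Union>\<D>"
    using compactE[OF S(1)] by metis
  moreover have "\<forall>B\<in>\<D>. \<exists>u v. B = box u v \<and> cbox u v \<subseteq> chords"
    using \<open>\<D> \<subseteq> \<C>\<close> unfolding \<C>_def by blast
  moreover have "S \<in> sets borel" using S(1) by (simp add: borel_compact)
  ultimately have "emeasure M S = emeasure N S"
    by (intro fin[of \<D>])
  moreover have "S \<inter> chords = S" using S by blast
  ultimately show ?thesis using M(2)[OF \<open>S \<in> sets borel\<close>] N(2)[OF \<open>S \<in> sets borel\<close>] by simp
qed

definition twist_rel :: "((real \<times> real) \<times> (real \<times> real)) set" where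
  "twist_rel = {((t, s), (t1, s1)). t < t1 \<and> t1 < t + l \<and> s = a t t1 \<and> s1 = b t t1}"

text \<open>
  The map is \<open>chord_in\<close> after the inverse of \<open>chord_out\<close>, and both are homeomorphisms onto open sets by
  invariance of domain.
\<close>
lemma twist_homeomorphism:
  obtains T T' where "homeomorphism (chord_out ` chords) (chord_in ` chords) T T'"
    "\<And>p q. (p, q) \<in> twist_rel \<longleftrightarrow> p \<in> chord_out ` chords \<and> q = T p"
    "\<And>E. compact E \<Longrightarrow> E \<subseteq> chord_out ` chords \<Longrightarrow> emeasure lborel (T ` E) = emeasure lborel E"
proof -
  obtain g where g: "homeomorphism chords (chord_out ` chords) chord_out g"
    using invariance_of_domain_homeomorphism[OF open_chords continuous_on_chord_out _ inj_on_chord_out] by auto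
  obtain h where h: "homeomorphism chords (chord_in ` chords) chord_in h"
    using invariance_of_domain_homeomorphism[OF open_chords continuous_on_chord_in _ inj_on_chord_in] by auto
  show ?thesis
  proof
    show "homeomorphism (chord_out ` chords) (chord_in ` chords) (chord_in \<circ> g) (chord_out \<circ> h)"
      by (rule homeomorphism_compose[OF homeomorphism_symD[OF g] h])
    have g_out: "g (chord_out c) = c" if "c \<in> chords" for c
      using g that by (simp add: homeomorphism_def)
    fix p q
    have "(p, q) \<in> twist_rel \<longleftrightarrow> (\<exists>c\<in>chords. p = chord_out c \<and> q = chord_in c)"
      by (cases p; cases q) (auto simp: twist_rel_def chords_def chord_out_def chord_in_def)
    then show "(p, q) \<in> twist_rel \<longleftrightarrow> p \<in> chord_out ` chords \<and> q = (chord_in \<circ> g) p"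
      using g_out by auto
  next
    fix E assume E: "compact E" "E \<subseteq> chord_out ` chords"
    have S: "compact (g ` E)" "g ` E \<subseteq> chords"
      using E g by (auto simp: homeomorphism_def intro!: compact_continuous_image intro: continuous_on_subset)
    have "chord_out ` (g ` E) = E"
      using E g by (force simp: homeomorphism_def image_image)
    then show "emeasure lborel ((chord_in \<circ> g) ` E) = emeasure lborel E"
      using emeasure_chord_images[OF S] by (simp add: image_comp)
  qed
qed

end

section \<open>Area preserving maps that preserve the leaves of a foliation\<close>

text \<open>
  Carries area estimates for maps between coordinate vectors over to pairs.
\<close>
lemma measure_lborel_pair_to_vec:
  assumes "compact S"
  shows "measure lborel S = measure lebesgue ((\<lambda>z. vector [fst z, snd z] :: real^2) ` S)"
proof -
  define e where "e = (\<lambda>z::real \<times> real. vector [fst z, snd z] :: real^2)"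
  have e_comp: "e z $ 1 = fst z" "e z $ 2 = snd z" for z
    by (simp_all add: e_def)
  have inj: "inj e"
    by (rule injI) (metis e_comp prod_eqI)
  have "linear e"
    by (rule linearI) (simp_all add: vec_eq_iff forall_2 e_comp)
  then have cont: "continuous_on A e" for A
    by (rule linear_continuous_on[OF linear_conv_bounded_linear[THEN iffD1]])
  have em [measurable]: "e \<in> borel_measurable borel"
    by (rule borel_measurable_continuous_onI[OF cont])
  have "lborel = distr lborel borel e"
  proof (rule lborel_eqI)
    fix p q :: "real^2" assume pq: "\<And>b. b \<in> Basis \<Longrightarrow> p \<bullet> b \<le> q \<bullet> b"
    have le: "p $ 1 \<le> q $ 1" "p $ 2 \<le> q $ 2"
      using pq[of "axis 1 1"] pq[of "axis 2 1"] by (auto simp: inner_axis axis_in_Basis_iff)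
    have "e -` box p q = box (p $ 1, p $ 2) (q $ 1, q $ 2)"
      unfolding box_Pair_real by (auto simp: mem_box_cart forall_2 e_comp)
    then have "emeasure (distr lborel borel e) (box p q) = emeasure lborel (box (p $ 1, p $ 2) (q $ 1, q $ 2))"
      by (simp add: emeasure_distr)
    also have "\<dots> = (\<Prod>b\<in>Basis. ((q $ 1, q $ 2) - (p $ 1, p $ 2)) \<bullet> b)"
      by (rule emeasure_lborel_box) (use le in \<open>auto simp: Basis_prod_def\<close>)
    also have "(\<Prod>b\<in>Basis. ((q $ 1, q $ 2) - (p $ 1, p $ 2)) \<bullet> b) = (q $ 1 - p $ 1) * (q $ 2 - p $ 2)"
      by (simp add: Basis_prod_def prod.union_disjoint disjoint_iff)
    also have "\<dots> = (\<Prod>b\<in>Basis. (q - p) \<bullet> b)"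
      by (subst Basis_vec_def)
         (simp add: UNION_singleton_eq_range prod.reindex inj_on_def axis_eq_axis UNIV_2 inner_axis)
    finally show "emeasure (distr lborel borel e) (box p q) = (\<Prod>b\<in>Basis. (q - p) \<bullet> b)" .
  qed simp
  then have "emeasure lborel (e ` S) = emeasure (distr lborel borel e) (e ` S)" by simp
  also have "\<dots> = emeasure lborel (e -` (e ` S))"
    using assms cont by (subst emeasure_distr) (auto intro!: borel_compact compact_continuous_image)
  also have "e -` (e ` S) = S" by (rule inj_vimage_image_eq[OF inj])
  finally have "measure lborel (e ` S) = measure lborel S"
    by (simp add: measure_def)
  moreover have "measure lebesgue (e ` S) = measure lborel (e ` S)"
    using assms cont by (intro measure_completion) (auto intro!: borel_compact compact_continuous_image)
  ultimately show ?thesis by (simp add: e_def)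
qed

text \<open>
  On a compact set the Jacobian determinant is bounded.
\<close>
lemma C1_image_area_le:
  fixes f :: "real \<times> real \<Rightarrow> real \<times> real"
  assumes C1: "C1_on f V" and R: "compact R" "R \<subseteq> V"
  obtains C where "C > 0" "\<And>S. compact S \<Longrightarrow> S \<subseteq> R \<Longrightarrow> measure lborel (f ` S) \<le> C * measure lborel S"
proof -
  obtain f' where f': "\<And>x. x \<in> V \<Longrightarrow> (f has_derivative blinfun_apply (f' x)) (at x)" "continuous_on V f'"
    using C1 by (auto simp: C1_on_def)
  have "compact (f' ` R)"
    using R f'(2) by (meson compact_continuous_image continuous_on_subset)
  then obtain B where B: "B > 0" "\<And>x. x \<in> R \<Longrightarrow> norm (f' x) \<le> B"
    using compact_imp_bounded[of "f' ` R"] unfolding bounded_pos by auto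
  define e where "e = (\<lambda>z::real \<times> real. vector [fst z, snd z] :: real^2)"
  define d where "d = (\<lambda>v::real^2. (v $ 1, v $ 2))"
  have e_comp: "e z $ 1 = fst z" "e z $ 2 = snd z" for z
    by (simp_all add: e_def)
  have de: "d (e z) = z" for z by (simp add: d_def e_comp)
  have lin_e: "bounded_linear e"
    by (rule linear_conv_bounded_linear[THEN iffD1], rule linearI)
       (simp_all add: vec_eq_iff forall_2 e_comp)
  have lin_d: "bounded_linear d"
    by (rule linear_conv_bounded_linear[THEN iffD1], rule linearI) (simp_all add: d_def)
  define g where "g = e \<circ> f \<circ> d"
  define g' where "g' = (\<lambda>v w. e (f' (d v) (d w)))"
  have g': "(g has_derivative g' v) (at v)" if "d v \<in> V" for v
    unfolding g_def g'_def comp_def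
    by (rule bounded_linear.has_derivative[OF lin_e], rule has_derivative_compose[OF bounded_linear_imp_has_derivative[OF lin_d]])
       (rule f'(1)[OF that])
  have fst_snd_le: "\<bar>fst w\<bar> \<le> norm w" "\<bar>snd w\<bar> \<le> norm w" for w :: "real \<times> real"
    using norm_fst_le[of "fst w" "snd w"] norm_snd_le[of "snd w" "fst w"] by auto
  have entry: "\<bar>matrix (g' v) $ i $ j\<bar> \<le> B" if "d v \<in> R" for v i j
  proof -
    have "\<bar>matrix (g' v) $ i $ j\<bar> = \<bar>e (f' (d v) (d (axis j 1))) $ i\<bar>"
      by (simp add: matrix_def g'_def)
    also have "\<dots> \<le> norm (f' (d v) (d (axis j 1)))"
      using exhaust_2[of i] fst_snd_le[of "f' (d v) (d (axis j 1))"] by (elim disjE) (simp_all only: e_comp)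
    also have "\<dots> \<le> norm (f' (d v)) * norm (d (axis j 1 :: real^2))"
      by (rule norm_blinfun)
    also have "norm (d (axis j 1 :: real^2)) = 1"
      using exhaust_2[of j] by (auto simp: d_def axis_def norm_Pair)
    finally show ?thesis using B(2)[OF that] by simp
  qed
  have det: "\<bar>det (matrix (g' v))\<bar> \<le> 2 * B * B" if "d v \<in> R" for v
  proof -
    let ?m = "\<lambda>i j. matrix (g' v) $ i $ j"
    have prod: "\<bar>?m i j * ?m i' j'\<bar> \<le> B * B" for i j i' j'
      unfolding abs_mult by (rule mult_mono) (use entry[OF that] B(1) in auto)
    show ?thesis
      using prod[of 1 1 2 2] prod[of 1 2 2 1] by (simp add: det_2)
  qed
  show ?thesis
  proof
    \<comment> \<open>the two products in the determinant are each at most B * B\<close>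
    show "0 < 2 * B * B" using B by simp
    fix S assume S: "compact S" "S \<subseteq> R"
    have ceS: "compact (e ` S)"
      using S lin_e by (intro compact_continuous_image) (simp add: linear_continuous_on)
    have SV: "d v \<in> V" "d v \<in> R" if "v \<in> e ` S" for v using that S R by (auto simp: de)
    have "continuous_on (e ` S) (\<lambda>v. f' (d v))"
      by (rule continuous_on_compose2[OF f'(2)]) (use SV in \<open>auto intro: linear_continuous_on[OF lin_d]\<close>)
    then have cont: "continuous_on (e ` S) (\<lambda>v. f' (d v) w)" for w
      by (intro continuous_intros)
    have "continuous_on (e ` S) (\<lambda>v. e (f' (d v) w))" for w
      by (rule continuous_on_compose2[where t = UNIV, OF linear_continuous_on[OF lin_e] cont]) simp
    then have "continuous_on (e ` S) (\<lambda>v. matrix (g' v) $ i $ j)" for i j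
      unfolding matrix_def g'_def by simp (intro continuous_intros)
    then have "continuous_on (e ` S) (\<lambda>v. \<bar>det (matrix (g' v))\<bar>)"
      unfolding det_2 by (intro continuous_on_rabs continuous_on_diff continuous_on_mult)
    then have "set_integrable lborel (e ` S) (\<lambda>v. \<bar>det (matrix (g' v))\<bar>)"
      using ceS borel_integrable_compact unfolding set_integrable_def by blast
    then have int: "(\<lambda>v. \<bar>det (matrix (g' v))\<bar>) integrable_on (e ` S)"
      by (rule set_borel_integral_eq_integral)
    have "measure lebesgue (g ` (e ` S)) \<le> (2 * B * B) * measure lebesgue (e ` S)"
    proof (rule measure_bounded_differentiable_image)
      show "e ` S \<in> lmeasurable" using ceS by (rule lmeasurable_compact)
      show "(g has_derivative g' v) (at v within e ` S)" if "v \<in> e ` S" for v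
        using g' SV that has_derivative_at_withinI by blast
    qed (use int det SV in auto)
    also have "g ` (e ` S) = e ` (f ` S)"
      by (simp add: g_def image_comp comp_def de)
    also have "measure lebesgue (e ` S) = measure lborel S"
      using measure_lborel_pair_to_vec[OF S(1)] by (simp add: e_def)
    also have "measure lebesgue (e ` (f ` S)) = measure lborel (f ` S)"
    proof -
      have "continuous_on S f"
        using S R f'(1) by (intro continuous_at_imp_continuous_on ballI has_derivative_continuous) blast
      then show ?thesis
        using measure_lborel_pair_to_vec[of "f ` S"] S(1) by (simp add: e_def compact_continuous_image)
    qed
    finally show "measure lborel (f ` S) \<le> (2 * B * B) * measure lborel S" .
  qed
qed

text \<open>
  The points of the class \<open>R\<close> between \<open>p\<close> and \<open>y\<close> form a finite set with maximum \<open>y\<close>. If \<open>w y < y\<close>, then \<open>w\<close>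
  maps this set injectively into itself but misses \<open>y\<close>. If \<open>y < w y\<close>, then every element of the set is a
  value of \<open>w\<close> on it, by the intermediate value theorem, and counting leaves no room for \<open>w y\<close>.
\<close>
lemma increasing_map_finite_classes_id:
  fixes w :: "real \<Rightarrow> real"
  assumes cont: "continuous_on {p..y} w" and mono: "strict_mono_on {p..y} w" and fix_p: "w p = p"
    and "p \<le> y" and fin: "finite {z \<in> {p..y}. R z}" and "R y"
    and R: "\<And>z. z \<in> {p..y} \<Longrightarrow> w z \<in> {p..y} \<or> z = y \<Longrightarrow> R (w z) \<longleftrightarrow> R z"
  shows "w y = y"
proof -
  define S where "S = {z \<in> {p..y}. R z}"
  have S: "finite S" "y \<in> S" using assms by (auto simp: S_def)
  have le: "w z \<le> w z'" if "z \<in> {p..y}" "z' \<in> {p..y}" "z \<le> z'" for z z'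
    using mono that by (metis order_le_less strict_mono_onD)
  have inj: "inj_on w S"
    using strict_mono_on_imp_inj_on[OF mono] by (rule inj_on_subset) (auto simp: S_def)
  show ?thesis
  proof (rule linorder_cases)
    assume lt: "w y < y"
    have "w ` S \<subseteq> S"
    proof
      fix v assume "v \<in> w ` S"
      then obtain z where z: "z \<in> {p..y}" "R z" "v = w z" by (auto simp: S_def)
      then have "p \<le> w z" "w z \<le> w y" using le[of p z] le[of z y] fix_p \<open>p \<le> y\<close> by auto
      then show "v \<in> S" using z lt R[of z] by (auto simp: S_def)
    qed
    then have "w ` S = S" using S inj by (meson card_image card_subset_eq)
    then obtain z where "z \<in> S" "w z = y" using S by (metis imageE)
    then show ?thesis using le[of z y] lt by (auto simp: S_def)
  next
    assume gt: "y < w y"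
    have "S \<subseteq> w ` S"
    proof
      fix v assume v: "v \<in> S"
      have "\<exists>z\<ge>p. z \<le> y \<and> w z = v"
        by (rule IVT') (use v gt fix_p \<open>p \<le> y\<close> cont in \<open>auto simp: S_def\<close>)
      then obtain z where z: "z \<in> {p..y}" "w z = v" by auto
      then have "R z" using R[of z] v by (auto simp: S_def)
      then show "v \<in> w ` S" using z by (auto simp: S_def)
    qed
    then have "w ` S = S"
      using S inj by (metis card_image card_subset_eq finite_imageI)
    then have "w y \<in> S" using S by blast
    then show ?thesis using gt by (auto simp: S_def)
  qed
qed

lemma rotational_param_shift:
  assumes c: "rotational_param l \<alpha> c"
  shows "c (u + of_int n) = c u + (of_int n * l, 0)"
proof -
  have step: "c (u + 1) = c u + (l, 0)" for u
    using c by (simp add: rotational_param_def)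
  have nat: "c (u + real n) = c u + (real n * l, 0)" for u n
  proof (induction n)
    case (Suc n)
    have "c (u + real (Suc n)) = c ((u + real n) + 1)" by (simp add: algebra_simps)
    then show ?case by (simp only: step Suc) (simp add: prod_eq_iff algebra_simps)
  qed (simp add: zero_prod_def)
  show ?thesis
  proof (cases n rule: int_cases2)
    case (nonneg m)
    then show ?thesis using nat by simp
  next
    case (nonpos m)
    then show ?thesis using nat[of "u - real m" m] by (simp add: prod_eq_iff)
  qed
qed

lemma periodic_bounded:
  fixes f :: "real \<Rightarrow> real"
  assumes cont: "continuous_on UNIV f" and per: "\<And>u. f (u + 1) = f u"
  obtains B where "\<And>u. \<bar>f u\<bar> \<le> B"
proof -
  have "compact (f ` {0..1})"
    by (intro compact_continuous_image continuous_on_subset[OF cont]) auto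
  then obtain B where B: "\<And>u. u \<in> {0..1} \<Longrightarrow> \<bar>f u\<bar> \<le> B"
    using compact_imp_bounded[of "f ` {0..1}"] unfolding bounded_iff by force
  have "\<bar>f u\<bar> \<le> B" for u
    using B[of "frac u"] frac_lt_1[of u] periodic_int[where f = f and l = 1, OF per, of "frac u" "\<lfloor>u\<rfloor>"]
    by (simp add: frac_def)
  then show ?thesis by (rule that)
qed

text \<open>
  The difference is periodic. So a lifted curve is proper: it meets a bounded set only for parameters in
  a bounded set.
\<close>
lemma rotational_param_proper:
  assumes c: "rotational_param l \<alpha> c"
  obtains B where "\<And>u. \<bar>fst (c u) - l * u\<bar> \<le> B"
proof -
  have "continuous_on UNIV (\<lambda>u. fst (c u) - l * u)"
    using c by (intro continuous_intros) (simp add: rotational_param_def)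
  moreover have "c (u + 1) = c u + (l, 0)" for u using c by (simp add: rotational_param_def)
  then have "fst (c (u + 1)) - l * (u + 1) = fst (c u) - l * u" for u by (simp add: distrib_left)
  ultimately show ?thesis by (rule periodic_bounded[where f = "\<lambda>u. fst (c u) - l * u"]) (rule that)
qed

text \<open>
  The second map is the inverse of the first. Area is compared on compact sets, whose images are
  again compact and therefore measurable.
\<close>
definition leafwise :: "(real \<times> real) set \<Rightarrow> (real \<times> real) set set \<Rightarrow> (real \<times> real \<Rightarrow> real \<times> real)
    \<Rightarrow> (real \<times> real \<Rightarrow> real \<times> real) \<Rightarrow> bool" where
  "leafwise U \<F> g g' \<longleftrightarrow> homeomorphism U U g g' \<and> (\<forall>\<beta>\<in>\<F>. g ` \<beta> = \<beta>) \<and>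
     (\<forall>E. compact E \<longrightarrow> E \<subseteq> U \<longrightarrow> emeasure lborel (g ` E) = emeasure lborel E)"

lemma leafwise_compose:
  assumes "leafwise U \<F> g g'" "leafwise U \<F> h h'"
  shows "leafwise U \<F> (h \<circ> g) (g' \<circ> h')"
proof -
  have hom: "homeomorphism U U g g'" "homeomorphism U U h h'"
    using assms by (auto simp: leafwise_def)
  have "emeasure lborel ((h \<circ> g) ` E) = emeasure lborel E" if E: "compact E" "E \<subseteq> U" for E
  proof -
    have "compact (g ` E)"
      using hom E by (auto simp: homeomorphism_def intro!: compact_continuous_image intro: continuous_on_subset)
    moreover have "g ` E \<subseteq> U"
      using hom(1) E(2) by (metis homeomorphism_image1 image_mono)
    ultimately show ?thesis using assms E unfolding leafwise_def by (simp only: image_comp[symmetric])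
  qed
  then show ?thesis
    using assms homeomorphism_compose[OF hom] unfolding leafwise_def by (simp only: image_comp[symmetric]) simp
qed

lemma leafwise_inverse:
  assumes g: "leafwise U \<F> g g'" and sub: "\<And>\<beta>. \<beta> \<in> \<F> \<Longrightarrow> \<beta> \<subseteq> U"
  shows "leafwise U \<F> g' g"
proof -
  have hom: "homeomorphism U U g g'"
    using g by (auto simp: leafwise_def)
  have inv: "g' ` (g ` X) = X" "g ` (g' ` X) = X" if "X \<subseteq> U" for X
  proof -
    have "(\<lambda>x. g' (g x)) ` X = (\<lambda>x. x) ` X" "(\<lambda>x. g (g' x)) ` X = (\<lambda>x. x) ` X"
      using hom that by (intro image_cong refl; auto simp: homeomorphism_def)+
    then show "g' ` (g ` X) = X" "g ` (g' ` X) = X" by (simp_all add: image_image)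
  qed
  have "emeasure lborel (g' ` E) = emeasure lborel E" if E: "compact E" "E \<subseteq> U" for E
  proof -
    have "compact (g' ` E)"
      using hom E by (auto simp: homeomorphism_def intro!: compact_continuous_image intro: continuous_on_subset)
    moreover have "g' ` E \<subseteq> U"
      using hom(1) E(2) by (metis homeomorphism_image2 image_mono)
    ultimately show ?thesis using g E inv by (metis leafwise_def)
  qed
  moreover have "g' ` \<beta> = \<beta>" if "\<beta> \<in> \<F>" for \<beta>
    using inv(1)[OF sub[OF that]] g that by (simp add: leafwise_def)
  ultimately show ?thesis
    using homeomorphism_symD[OF hom] by (simp add: leafwise_def)
qed

lemma leafwise_id: "leafwise U \<F> (\<lambda>x. x) (\<lambda>x. x)"
  by (simp add: leafwise_def homeomorphism_def)

lemma leafwise_funpow: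
  assumes "leafwise U \<F> g g'"
  shows "leafwise U \<F> (g ^^ n) (g' ^^ n)"
proof (induction n)
  case (Suc n)
  show ?case
    using leafwise_compose[OF Suc assms] by (simp add: funpow_swap1 comp_def)
qed (simp add: leafwise_id id_def)

definition unit_square :: "(real \<times> real) set" where "unit_square = {0<..<1} \<times> {0<..<1}"

lemma open_unit_square: "open unit_square"
  by (simp add: unit_square_def open_Times)

text \<open>
  A foliated chart with its inverse \<open>\<psi>\<close>. The level of a point is its second chart coordinate; plaques
  are exactly the sets of points of one level.
\<close>
locale foliation_chart =
  fixes U V :: "(real \<times> real) set" and \<F> :: "(real \<times> real) set set" and l :: real
    and \<phi> \<psi> :: "real \<times> real \<Rightarrow> real \<times> real"
  assumes l_pos: "0 < l"
    and leaves: "partition_on U \<F>"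
    and params: "\<And>\<beta>. \<beta> \<in> \<F> \<Longrightarrow> \<exists>c. rotational_param l \<beta> c"
    and open_V: "open V" and V_sub: "V \<subseteq> U"
    and chart: "homeomorphism V unit_square \<phi> \<psi>"
    and C1: "C1_on \<phi> V" "C1_on \<psi> unit_square"
    and plaques: "\<And>\<alpha> P. \<alpha> \<in> \<F> \<Longrightarrow> P \<in> components (\<alpha> \<inter> V) \<Longrightarrow> \<exists>y\<in>{0<..<1}. P = {q \<in> V. snd (\<phi> q) = y}"
begin

lemma phi_psi [simp]: "z \<in> unit_square \<Longrightarrow> \<phi> (\<psi> z) = z" and psi_phi [simp]: "q \<in> V \<Longrightarrow> \<psi> (\<phi> q) = q"
  and psi_in: "z \<in> unit_square \<Longrightarrow> \<psi> z \<in> V" and phi_in: "q \<in> V \<Longrightarrow> \<phi> q \<in> unit_square"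
  and cont_phi: "continuous_on V \<phi>" and cont_psi: "continuous_on unit_square \<psi>"
  using chart by (auto simp: homeomorphism_def)

lemma leaf_ex: "q \<in> U \<Longrightarrow> \<exists>\<beta>\<in>\<F>. q \<in> \<beta>"
  using leaves by (auto simp: partition_on_def)

lemma leaf_sub: "\<beta> \<in> \<F> \<Longrightarrow> \<beta> \<subseteq> U"
  using leaves by (auto simp: partition_on_def)

lemma level_const:
  assumes "\<beta> \<in> \<F>" "connected X" "X \<subseteq> \<beta> \<inter> V" "p \<in> X" "q \<in> X"
  shows "snd (\<phi> p) = snd (\<phi> q)"
proof -
  obtain P where "P \<in> components (\<beta> \<inter> V)" "X \<subseteq> P"
    using exists_component_superset[of X "\<beta> \<inter> V"] assms by blast
  then show ?thesis using plaques[OF assms(1)] assms(4,5) by blast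
qed

lemma plaque_in_leaf:
  assumes "\<beta> \<in> \<F>" "p \<in> \<beta>" "p \<in> V" "q \<in> V" "snd (\<phi> q) = snd (\<phi> p)"
  shows "q \<in> \<beta>"
proof -
  obtain P where P: "P \<in> components (\<beta> \<inter> V)" "{p} \<subseteq> P"
    using exists_component_superset[of "{p}" "\<beta> \<inter> V"] assms(2,3) by auto
  then obtain y where "P = {q \<in> V. snd (\<phi> q) = y}" using plaques[OF assms(1)] by blast
  then have "q \<in> P" using P assms by auto
  then show ?thesis using P(1) in_components_subset by blast
qed

text \<open>
  A lifted leaf is a proper curve, so it meets a compact transversal only on a compact set of
  parameters; there the level is locally constant.
\<close>
lemma finite_levels:
  assumes b: "\<beta> \<in> \<F>" and x: "x \<in> {0<..<1}" and lohi: "{lo..hi} \<subseteq> {0<..<1}"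
  shows "finite {y \<in> {lo..hi}. \<psi> (x, y) \<in> \<beta>}"
proof -
  obtain c where c: "rotational_param l \<beta> c" using params[OF b] by blast
  have cont: "continuous_on UNIV c" and rng: "range c = \<beta>"
    using c by (auto simp: rotational_param_def)
  define K where "K = \<psi> ` ({x} \<times> {lo..hi})"
  have sub: "{x} \<times> {lo..hi} \<subseteq> unit_square" using x lohi by (auto simp: unit_square_def)
  have K: "compact K" "K \<subseteq> V"
    unfolding K_def using sub psi_in
    by (auto intro!: compact_continuous_image compact_Times intro: continuous_on_subset[OF cont_psi])
  have "bounded (fst ` K)"
    using K(1) by (intro compact_imp_bounded compact_continuous_image continuous_intros)
  then obtain M where M: "\<And>q. q \<in> K \<Longrightarrow> \<bar>fst q\<bar> \<le> M" unfolding bounded_iff by auto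
  obtain B where B: "\<And>u. \<bar>fst (c u) - l * u\<bar> \<le> B" using rotational_param_proper[OF c] by blast
  \<comment> \<open>parameters outside of the interval from - N to N do not reach the transversal\<close>
  define N where "N = (M + B) / l"
  define S where "S = {-N..N} \<inter> c -` K"
  have N: "u \<in> {-N..N}" if "c u \<in> K" for u
  proof -
    have "\<bar>l * u\<bar> \<le> M + B" using M[OF that] B[of u] by linarith
    then have "\<bar>u\<bar> \<le> N" using l_pos by (simp add: N_def abs_mult field_simps)
    then show ?thesis by auto
  qed
  have "closed (c -` K)"
    using K(1) cont by (simp add: closed_vimage compact_imp_closed)
  then have S: "compact S" unfolding S_def by (intro compact_Int_closed) auto
  define f where "f = (\<lambda>u. snd (\<phi> (c u)))"
  have "\<exists>e>0. \<forall>u'\<in>ball u e. f u' = f u" if "u \<in> S" for u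
  proof -
    have "open (c -` V)" using open_V cont by (rule open_vimage)
    moreover have "u \<in> c -` V" using that K by (auto simp: S_def)
    ultimately obtain e where e: "e > 0" "ball u e \<subseteq> c -` V" by (meson openE)
    have "connected (c ` ball u e)"
      by (intro connected_continuous_image continuous_on_subset[OF cont]) auto
    then have "f u' = f u" if "u' \<in> ball u e" for u'
      unfolding f_def by (rule level_const[OF b]) (use e that rng in auto)
    then show ?thesis using e by blast
  qed
  then obtain e where e: "\<And>u. u \<in> S \<Longrightarrow> e u > 0" "\<And>u u'. u \<in> S \<Longrightarrow> u' \<in> ball u (e u) \<Longrightarrow> f u' = f u"
    by metis
  have "S \<subseteq> (\<Union>u\<in>S. ball u (e u))" using e(1) by force
  then obtain S' where S': "S' \<subseteq> S" "finite S'" "S \<subseteq> (\<Union>u\<in>S'. ball u (e u))"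
    by (rule compactE_image[OF S, rotated]) auto
  have "f ` S \<subseteq> f ` S'" using S' e(2) by blast
  then have "finite (f ` S)" using S'(2) by (meson finite_imageI finite_subset)
  moreover have "{y \<in> {lo..hi}. \<psi> (x, y) \<in> \<beta>} \<subseteq> f ` S"
  proof
    fix y assume y: "y \<in> {y \<in> {lo..hi}. \<psi> (x, y) \<in> \<beta>}"
    then obtain u where u: "c u = \<psi> (x, y)" using rng by (metis (mono_tags, lifting) mem_Collect_eq imageE)
    then have "c u \<in> K" using y by (auto simp: K_def)
    then have "u \<in> S" using N by (auto simp: S_def)
    moreover have "(x, y) \<in> unit_square" using y sub by blast
    then have "f u = y" by (simp only: f_def u phi_psi snd_conv)
    ultimately show "y \<in> f ` S" by blast
  qed
  ultimately show ?thesis by (rule finite_subset[rotated])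
qed

definition cell :: "real \<times> real \<Rightarrow> real \<Rightarrow> (real \<times> real) set" where
  "cell z d = {fst z - d..fst z + d} \<times> {snd z - d..snd z + d}"

lemma cell_mono: "d \<le> d' \<Longrightarrow> cell z d \<subseteq> cell z d'"
  by (auto simp: cell_def)

lemma compact_cell: "compact (cell z d)"
  by (simp add: cell_def compact_Times)

lemma cell_in_open:
  assumes "open W" "z \<in> W"
  obtains d where "d > 0" "cell z d \<subseteq> W"
proof -
  obtain e where e: "e > 0" "ball z e \<subseteq> W" using assms by (meson openE)
  have "cell z (e / 3) \<subseteq> ball z e"
  proof
    fix w assume w: "w \<in> cell z (e / 3)"
    have "fst w \<in> {fst z - e / 3..fst z + e / 3}" "snd w \<in> {snd z - e / 3..snd z + e / 3}"
      using w unfolding cell_def mem_Times_iff by blast+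
    then have "\<bar>fst w - fst z\<bar> \<le> e / 3" "\<bar>snd w - snd z\<bar> \<le> e / 3"
      unfolding abs_le_iff atLeastAtMost_iff by linarith+
    moreover have "norm (w - z) \<le> \<bar>fst w - fst z\<bar> + \<bar>snd w - snd z\<bar>"
      using norm_Pair_le[of "fst (w - z)" "snd (w - z)"]
      by (simp only: prod.collapse) (simp only: fst_diff snd_diff real_norm_def)
    ultimately show "w \<in> ball z e" using e(1) by (simp add: dist_norm norm_minus_commute)
  qed
  then show ?thesis using that[of "e / 3"] e by auto
qed

text \<open>
  The image of a short plaque is a connected piece of one leaf, so it stays on one level. This level
  depends only on the level of the plaque.
\<close>
lemma level_map:
  assumes g: "leafwise U \<F> g g'" and p: "p \<in> V" "g p = p"
  obtains d Y where "d > 0" "cell (\<phi> p) d \<subseteq> unit_square" "continuous_on {snd (\<phi> p) - d..snd (\<phi> p) + d} Y"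
    "Y (snd (\<phi> p)) = snd (\<phi> p)"
    "\<And>z. z \<in> cell (\<phi> p) d \<Longrightarrow> g (\<psi> z) \<in> V \<and> snd (\<phi> (g (\<psi> z))) = Y (snd z)"
proof -
  have gc: "continuous_on U g" and gl: "\<And>\<beta>. \<beta> \<in> \<F> \<Longrightarrow> g ` \<beta> = \<beta>"
    using g by (auto simp: leafwise_def homeomorphism_def)
  have gpsi: "continuous_on unit_square (g \<circ> \<psi>)"
    by (intro continuous_on_compose cont_psi continuous_on_subset[OF gc]) (use psi_in V_sub in auto)
  have "open (unit_square \<inter> (g \<circ> \<psi>) -` V)"
    by (rule continuous_open_preimage[OF gpsi open_unit_square open_V])
  moreover have "\<phi> p \<in> unit_square \<inter> (g \<circ> \<psi>) -` V" using p phi_in by auto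
  ultimately obtain d where d: "d > 0" "cell (\<phi> p) d \<subseteq> unit_square \<inter> (g \<circ> \<psi>) -` V"
    by (rule cell_in_open)
  define x0 y0 where "x0 = fst (\<phi> p)" and "y0 = snd (\<phi> p)"
  define Y where "Y = (\<lambda>y. snd (\<phi> (g (\<psi> (x0, y)))))"
  have x0: "(x0, y) \<in> cell (\<phi> p) d" if "y \<in> {y0 - d..y0 + d}" for y
    using that d(1) by (auto simp: cell_def x0_def y0_def)
  show ?thesis
  proof
    show "d > 0" "cell (\<phi> p) d \<subseteq> unit_square" using d by auto
    show "Y (snd (\<phi> p)) = snd (\<phi> p)" using p by (simp add: Y_def x0_def)
    have "continuous_on {y0 - d..y0 + d} (\<lambda>y. (g \<circ> \<psi>) (x0, y))"
      by (rule continuous_on_compose2[OF gpsi]) (intro continuous_intros, use x0 d in blast)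
    then have "continuous_on {y0 - d..y0 + d} (\<lambda>y. \<phi> ((g \<circ> \<psi>) (x0, y)))"
      by (rule continuous_on_compose2[OF cont_phi]) (use x0 d in blast)
    then show "continuous_on {snd (\<phi> p) - d..snd (\<phi> p) + d} Y"
      by (auto simp: Y_def y0_def intro!: continuous_intros)
    fix z assume z: "z \<in> cell (\<phi> p) d"
    then have gV: "g (\<psi> z) \<in> V" using d by auto
    define X where "X = (g \<circ> \<psi>) ` ({x0 - d..x0 + d} \<times> {snd z})"
    have sub: "{x0 - d..x0 + d} \<times> {snd z} \<subseteq> cell (\<phi> p) d"
      using z by (auto simp: cell_def x0_def)
    obtain \<beta> where b: "\<beta> \<in> \<F>" "\<psi> z \<in> \<beta>" using leaf_ex z d psi_in V_sub by blast
    have "snd (\<phi> (g (\<psi> z))) = snd (\<phi> (g (\<psi> (x0, snd z))))"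
    proof (rule level_const[OF b(1), of X])
      show "connected X" unfolding X_def
        by (intro connected_continuous_image continuous_on_subset[OF gpsi] connected_Times) (use sub d in auto)
      show "X \<subseteq> \<beta> \<inter> V"
      proof
        fix q assume "q \<in> X"
        then obtain w where w: "w \<in> {x0 - d..x0 + d} \<times> {snd z}" "q = g (\<psi> w)" by (auto simp: X_def)
        have "\<psi> w \<in> \<beta>"
        proof (rule plaque_in_leaf[OF b(1) b(2)])
          have zw: "z \<in> unit_square" "w \<in> unit_square" using z w(1) sub d(2) by blast+
          then show "\<psi> z \<in> V" "\<psi> w \<in> V" by (auto intro: psi_in)
          show "snd (\<phi> (\<psi> w)) = snd (\<phi> (\<psi> z))" using zw w(1) by auto
        qed
        moreover have "w \<in> (g \<circ> \<psi>) -` V" using w(1) sub d(2) by blast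
        then have "g (\<psi> w) \<in> V" by simp
        ultimately show "q \<in> \<beta> \<inter> V" using w(2) gl[OF b(1)] by blast
      qed
      show "g (\<psi> z) \<in> X" using z by (auto simp: X_def cell_def x0_def mem_Times_iff intro!: image_eqI[of _ _ z])
      show "g (\<psi> (x0, snd z)) \<in> X" using d(1) by (auto simp: X_def)
    qed
    then show "g (\<psi> z) \<in> V \<and> snd (\<phi> (g (\<psi> z))) = Y (snd z)"
      using gV by (simp add: Y_def)
  qed
qed


lemma center_in_interior_cell: "0 < d \<Longrightarrow> z \<in> interior (cell z d)"
  by (cases z) (simp add: cell_def interior_Times)

lemma cell_into_cell:
  assumes g: "leafwise U \<F> g g'" and p: "p \<in> V" "g p = p" and d: "0 < d"
  obtains d' where "0 < d'" "d' \<le> d" "cell (\<phi> p) d' \<subseteq> unit_square"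
    "\<And>z. z \<in> cell (\<phi> p) d' \<Longrightarrow> g (\<psi> z) \<in> V \<and> \<phi> (g (\<psi> z)) \<in> cell (\<phi> p) d"
proof -
  have gc: "continuous_on U g"
    using g by (auto simp: leafwise_def homeomorphism_def)
  have gpsi: "continuous_on unit_square (g \<circ> \<psi>)"
    by (intro continuous_on_compose cont_psi continuous_on_subset[OF gc]) (use psi_in V_sub in auto)
  have "open (V \<inter> \<phi> -` interior (cell (\<phi> p) d))"
    by (rule continuous_open_preimage[OF cont_phi open_V]) simp
  then have "open (unit_square \<inter> (g \<circ> \<psi>) -` (V \<inter> \<phi> -` interior (cell (\<phi> p) d)))"
    by (rule continuous_open_preimage[OF gpsi open_unit_square])
  moreover have "\<phi> p \<in> unit_square \<inter> (g \<circ> \<psi>) -` (V \<inter> \<phi> -` interior (cell (\<phi> p) d))"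
    using p phi_in center_in_interior_cell[OF d] by auto
  ultimately obtain e where e: "e > 0" "cell (\<phi> p) e \<subseteq> unit_square \<inter> (g \<circ> \<psi>) -` (V \<inter> \<phi> -` interior (cell (\<phi> p) d))"
    by (rule cell_in_open)
  have sub: "cell (\<phi> p) (min d e) \<subseteq> cell (\<phi> p) e" by (rule cell_mono) simp
  show ?thesis
  proof
    show "0 < min d e" "min d e \<le> d" using d e by auto
    show "cell (\<phi> p) (min d e) \<subseteq> unit_square" using sub e by blast
    fix z assume "z \<in> cell (\<phi> p) (min d e)"
    then have "z \<in> (g \<circ> \<psi>) -` (V \<inter> \<phi> -` interior (cell (\<phi> p) d))" using sub e by blast
    then show "g (\<psi> z) \<in> V \<and> \<phi> (g (\<psi> z)) \<in> cell (\<phi> p) d"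
      using interior_subset[of "cell (\<phi> p) d"] by auto
  qed
qed

lemma leafwise_mem_iff:
  assumes "leafwise U \<F> g g'" "\<beta> \<in> \<F>" "q \<in> U"
  shows "g q \<in> \<beta> \<longleftrightarrow> q \<in> \<beta>"
proof
  assume "g q \<in> \<beta>"
  then obtain q' where q': "q' \<in> \<beta>" "g q' = g q" using assms unfolding leafwise_def by (metis imageE)
  moreover have "homeomorphism U U g g'" using assms by (simp add: leafwise_def)
  moreover have "q' \<in> U" using q'(1) leaf_sub[OF assms(2)] by blast
  ultimately have "g' (g q') = q'" "g' (g q) = q"
    using assms(3) homeomorphism_apply1 by metis+
  then show "q \<in> \<beta>" using q' by metis
qed (use assms in \<open>auto simp: leafwise_def\<close>)

text \<open>
  The level map of the inverse undoes the level map \<open>Y\<close> of \<open>g\<close>, so \<open>Y\<close> is injective near the level of \<open>p\<close>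
  and therefore monotone. It may reverse the order of the levels, but \<open>Y \<circ> Y\<close> is increasing and sends
  each level to a level of the same leaf, of which there are only finitely many.
\<close>
lemma level_square_id:
  assumes g: "leafwise U \<F> g g'" and p: "p \<in> V" "g p = p"
  obtains d where "d > 0" "cell (\<phi> p) d \<subseteq> unit_square"
    "\<And>z. z \<in> cell (\<phi> p) d \<Longrightarrow> g (g (\<psi> z)) \<in> V \<and> snd (\<phi> (g (g (\<psi> z)))) = snd z"
proof -
  have g': "leafwise U \<F> g' g" using g leaf_sub by (rule leafwise_inverse)
  have inv: "g' (g q) = q" if "q \<in> U" for q
    using g that by (auto simp: leafwise_def homeomorphism_def)
  have p': "g' p = p" using inv[of p] p V_sub by auto
  obtain d1 Y where Y: "d1 > 0" "cell (\<phi> p) d1 \<subseteq> unit_square" "continuous_on {snd (\<phi> p) - d1..snd (\<phi> p) + d1} Y"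
    "Y (snd (\<phi> p)) = snd (\<phi> p)"
    "\<And>z. z \<in> cell (\<phi> p) d1 \<Longrightarrow> g (\<psi> z) \<in> V \<and> snd (\<phi> (g (\<psi> z))) = Y (snd z)"
    using level_map[OF g p] by metis
  obtain d2 Z where Z: "d2 > 0"
    "\<And>z. z \<in> cell (\<phi> p) d2 \<Longrightarrow> g' (\<psi> z) \<in> V \<and> snd (\<phi> (g' (\<psi> z))) = Z (snd z)"
    using level_map[OF g' p(1) p'] by metis
  define x0 y0 where "x0 = fst (\<phi> p)" and "y0 = snd (\<phi> p)"
  have x0: "(x0, y) \<in> cell (\<phi> p) d" if "\<bar>y - y0\<bar> \<le> d" for y d
    using that by (auto simp: cell_def x0_def y0_def abs_le_iff)
  have near: "\<bar>snd z - y0\<bar> \<le> d" if "z \<in> cell (\<phi> p) d" for z d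
    using that by (auto simp: cell_def y0_def abs_le_iff)
  define d where "d = min d1 d2"
  obtain d3 where d3: "0 < d3" "d3 \<le> d"
    "\<And>z. z \<in> cell (\<phi> p) d3 \<Longrightarrow> g (\<psi> z) \<in> V \<and> \<phi> (g (\<psi> z)) \<in> cell (\<phi> p) d"
    using cell_into_cell[OF g p, of d] Y(1) Z(1) d_def by (metis min_less_iff_conj)
  obtain d4 where d4: "0 < d4" "d4 \<le> d3"
    "\<And>z. z \<in> cell (\<phi> p) d4 \<Longrightarrow> g (\<psi> z) \<in> V \<and> \<phi> (g (\<psi> z)) \<in> cell (\<phi> p) d3"
    using cell_into_cell[OF g p d3(1)] by metis
  have sub: "cell (\<phi> p) d4 \<subseteq> cell (\<phi> p) d3" "cell (\<phi> p) d3 \<subseteq> cell (\<phi> p) d"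
    "cell (\<phi> p) d \<subseteq> cell (\<phi> p) d1" "cell (\<phi> p) d \<subseteq> cell (\<phi> p) d2"
    using d3 d4 by (auto intro!: cell_mono simp: d_def)
  then have sub_square: "cell (\<phi> p) d \<subseteq> unit_square" using Y(2) by blast
  have Y4: "snd (\<phi> (g (\<psi> (x0, y)))) = Y y" if "\<bar>y - y0\<bar> \<le> d3" for y
    using Y(5)[of "(x0, y)"] x0[OF that] sub by auto
  \<comment> \<open>d3 is so small that g stays in the cell on which Z describes the inverse\<close>
  have ZY: "Z (Y y) = y" if y: "\<bar>y - y0\<bar> \<le> d3" for y
  proof -
    let ?z = "(x0, y)"
    have z: "?z \<in> cell (\<phi> p) d3" by (rule x0[OF y])
    let ?w = "\<phi> (g (\<psi> ?z))"
    have gV: "g (\<psi> ?z) \<in> V" and w: "?w \<in> cell (\<phi> p) d" using d3(3)[OF z] by auto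
    have zsq: "?z \<in> unit_square" using z sub sub_square by blast
    then have "\<psi> ?z \<in> U" using psi_in V_sub by blast
    then have "g' (\<psi> ?w) = \<psi> ?z" using gV inv by simp
    then have "snd (\<phi> (\<psi> ?z)) = Z (snd ?w)" using Z(2)[of ?w] w sub by auto
    moreover have "snd ?w = Y y" using Y(5)[of ?z] z sub by auto
    ultimately show ?thesis using zsq by simp
  qed
  have Yd: "\<bar>Y y - y0\<bar> \<le> d" if "\<bar>y - y0\<bar> \<le> d3" for y
    using near[of "\<phi> (g (\<psi> (x0, y)))" d] d3(3)[OF x0[OF that]] Y4[OF that] by simp
  have Yd3: "\<bar>Y y - y0\<bar> \<le> d3" if "\<bar>y - y0\<bar> \<le> d4" for y
    using near[of "\<phi> (g (\<psi> (x0, y)))" d3] d4(3)[OF x0[OF that]] Y4[of y] that d4(2) by simp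
  have I: "{y0 - e..y0 + e} = {y. \<bar>y - y0\<bar> \<le> e}" for e :: real
    by (auto simp: abs_le_iff)
  have contY: "continuous_on {y0 - d3..y0 + d3} Y"
    by (rule continuous_on_subset[OF Y(3)]) (use d3(2) in \<open>auto simp: y0_def d_def\<close>)
  have "inj_on Y {y0 - d3..y0 + d3}"
    by (rule inj_on_inverseI[of _ Z]) (use ZY in \<open>auto simp: I\<close>)
  then have "strict_mono_on {y0 - d3..y0 + d3} Y \<or> strict_antimono_on {y0 - d3..y0 + d3} Y"
    using injective_eq_monotone_map[OF _ contY] is_interval_cc by blast
  moreover define w where "w = (\<lambda>y. Y (Y y))"
  ultimately have mono: "strict_mono_on {y0 - d4..y0 + d4} w"
    unfolding monotone_on_def I w_def using Yd3 d4(2) by force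
  have contw: "continuous_on {y0 - d4..y0 + d4} w"
    unfolding w_def
    by (rule continuous_on_compose2[OF contY continuous_on_subset[OF contY]]) (use d4(2) Yd3 in \<open>auto simp: I\<close>)
  have w0: "w y0 = y0" using Y(4) by (simp add: w_def y0_def)
  have gg: "g (g (\<psi> z)) \<in> V \<and> snd (\<phi> (g (g (\<psi> z)))) = w (snd z)" if z: "z \<in> cell (\<phi> p) d4" for z
  proof -
    let ?w = "\<phi> (g (\<psi> z))"
    have w: "?w \<in> cell (\<phi> p) d3" "g (\<psi> z) \<in> V" using d4(3)[OF z] by auto
    then have "\<psi> ?w = g (\<psi> z)" by simp
    moreover have "snd ?w = Y (snd z)" using Y(5)[of z] z sub by auto
    ultimately show ?thesis using Y(5)[of ?w] w sub by (auto simp: w_def)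
  qed
  \<comment> \<open>a level and its image under w belong to the same leaf\<close>
  have leaf: "\<psi> (x0, w y) \<in> \<beta> \<longleftrightarrow> \<psi> (x0, y) \<in> \<beta>" if b: "\<beta> \<in> \<F>" and y: "\<bar>y - y0\<bar> \<le> d4" for \<beta> y
  proof -
    have z: "(x0, y) \<in> cell (\<phi> p) d4" by (rule x0[OF y])
    then have inV: "\<psi> (x0, y) \<in> V" using sub sub_square psi_in by blast
    have inV': "g (\<psi> (x0, y)) \<in> V" using d4(3)[OF z] by blast
    have wsq: "(x0, w y) \<in> unit_square" using x0[OF Yd[OF Yd3[OF y]]] sub_square by (auto simp: w_def)
    have "\<psi> (x0, y) \<in> \<beta> \<longleftrightarrow> g (g (\<psi> (x0, y))) \<in> \<beta>"
      using leafwise_mem_iff[OF g b subsetD[OF V_sub inV]] leafwise_mem_iff[OF g b subsetD[OF V_sub inV']] by simp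
    also have "\<dots> \<longleftrightarrow> \<psi> (x0, w y) \<in> \<beta>"
    proof -
      have 1: "\<psi> (x0, w y) \<in> V" "g (g (\<psi> (x0, y))) \<in> V" using psi_in[OF wsq] gg[OF z] by auto
      have 2: "snd (\<phi> (\<psi> (x0, w y))) = snd (\<phi> (g (g (\<psi> (x0, y)))))" using gg[OF z] wsq by simp
      show ?thesis
        using plaque_in_leaf[OF b _ 1(2) 1(1) 2] plaque_in_leaf[OF b _ 1(1) 1(2) 2[symmetric]] by blast
    qed
    finally show ?thesis by simp
  qed
  have x01: "x0 \<in> {0<..<1}" using phi_in[OF p(1)] by (auto simp: unit_square_def x0_def mem_Times_iff)
  have I01: "{y0 - d4..y0 + d4} \<subseteq> {0<..<1}"
  proof
    fix y assume "y \<in> {y0 - d4..y0 + d4}"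
    then have "(x0, y) \<in> unit_square" using x0[of y d4] sub sub_square by (auto simp: I)
    then show "y \<in> {0<..<1}" by (simp add: unit_square_def)
  qed
  have w_id: "w y = y" if y: "\<bar>y - y0\<bar> \<le> d4" for y
  proof -
    have "(x0, y) \<in> unit_square" using x0[OF y] sub sub_square by blast
    then obtain \<beta> where b: "\<beta> \<in> \<F>" "\<psi> (x0, y) \<in> \<beta>"
      using leaf_ex psi_in V_sub by blast
    show ?thesis
    proof (cases "y0 \<le> y")
      case True
      have sub': "{y0..y} \<subseteq> {y0 - d4..y0 + d4}" using True y d4(1) by (auto simp: abs_le_iff)
      show ?thesis
      proof (rule increasing_map_finite_classes_id[where p = y0 and R = "\<lambda>z. \<psi> (x0, z) \<in> \<beta>"])
        show "finite {z \<in> {y0..y}. \<psi> (x0, z) \<in> \<beta>}"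
          by (rule finite_levels[OF b(1) x01]) (use sub' I01 in blast)
        show "\<psi> (x0, w z) \<in> \<beta> \<longleftrightarrow> \<psi> (x0, z) \<in> \<beta>" if "z \<in> {y0..y}" for z
          by (rule leaf[OF b(1)]) (use that sub' in \<open>auto simp: I\<close>)
      qed (use True w0 b continuous_on_subset[OF contw sub'] monotone_on_subset[OF mono sub'] in auto)
    next
      case False
      have sub': "uminus ` {- y0..- y} \<subseteq> {y0 - d4..y0 + d4}" using False y d4(1) by (auto simp: abs_le_iff)
      have "- w (- (- y)) = - y"
      proof (rule increasing_map_finite_classes_id[where p = "- y0" and R = "\<lambda>z. \<psi> (x0, - z) \<in> \<beta>" and w = "\<lambda>z. - w (- z)"])
        have "finite {z \<in> {y..y0}. \<psi> (x0, z) \<in> \<beta>}"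
          by (rule finite_levels[OF b(1) x01]) (use sub' I01 in auto)
        then have "finite (uminus ` {z \<in> {y..y0}. \<psi> (x0, z) \<in> \<beta>})" by (rule finite_imageI)
        then show "finite {z \<in> {- y0..- y}. \<psi> (x0, - z) \<in> \<beta>}"
          by (rule finite_subset[rotated]) (auto intro!: image_eqI[of _ uminus "- z" for z])
        show "\<psi> (x0, - (- w (- z))) \<in> \<beta> \<longleftrightarrow> \<psi> (x0, - z) \<in> \<beta>" if "z \<in> {- y0..- y}" for z
        proof -
          have "\<bar>- z - y0\<bar> \<le> d4" using that y False by auto
          then show ?thesis using leaf[OF b(1), of "- z"] by simp
        qed
        show "continuous_on {- y0..- y} (\<lambda>z. - w (- z))"
          by (intro continuous_intros continuous_on_compose2[OF contw] sub')
        show "strict_mono_on {- y0..- y} (\<lambda>z. - w (- z))"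
        proof (rule strict_mono_onI)
          fix r s assume rs: "r \<in> {- y0..- y}" "s \<in> {- y0..- y}" "r < s"
          then have "- s \<in> {y0 - d4..y0 + d4}" "- r \<in> {y0 - d4..y0 + d4}" using sub' by blast+
          then show "- w (- r) < - w (- s)" using strict_mono_onD[OF mono, of "- s" "- r"] rs by simp
        qed
      qed (use False w0 b in auto)
      then show ?thesis by simp
    qed
  qed
  show ?thesis
  proof
    show "d4 > 0" by (rule d4)
    show "cell (\<phi> p) d4 \<subseteq> unit_square" using sub sub_square by blast
    show "g (g (\<psi> z)) \<in> V \<and> snd (\<phi> (g (g (\<psi> z)))) = snd z" if "z \<in> cell (\<phi> p) d4" for z
      using gg[OF that] w_id[OF near[OF that]] by simp
  qed
qed

end

lemma measure_rectangle:
  fixes a b c d :: real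
  assumes "a \<le> b" "c \<le> d"
  shows "measure lborel ({a..b} \<times> {c..d}) = (b - a) * (d - c)"
proof -
  have "{a..b} \<times> {c..d} = cbox (a, c) (b, d)" by (simp add: cbox_Pair_eq)
  then show ?thesis using assms by (simp add: content_Pair)
qed

context foliation_chart
begin

text \<open>
  If \<open>G\<close> moves \<open>u\<close> towards \<open>u1\<close>, then \<open>h = g \<circ> g\<close> maps the piece of the leaf between them onto a proper part.
  In the chart this piece is \<open>{a..b'}\<close> on the level \<open>y0\<close> and its image is \<open>{a1..b1}\<close>. As \<open>h\<close> keeps levels,
  it maps the box over \<open>{a..b'}\<close> of small height into the box over \<open>{a1 - \<eta>..b1 + \<eta>}\<close> of the same
  height. The chart distorts area at most by constant factors, so for small \<open>\<eta>\<close> the area of the part over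
  \<open>{s..s'}\<close>, which the image avoids, exceeds what the margins of width \<open>\<eta>\<close> can make up for.
\<close>
lemma no_contraction:
  assumes g: "leafwise U \<F> g g'" and p: "p \<in> V" "g p = p"
    and b: "\<beta> \<in> \<F>" and c: "rotational_param l \<beta> c" and u1: "c u1 = p"
    and G: "strict_mono G" "continuous_on UNIV G" "\<And>u. g (c u) = c (G u)"
  obtains e where "e > 0" "\<And>u. \<bar>u - u1\<bar> < e \<Longrightarrow> G u \<in> closed_segment u u1 \<Longrightarrow> G u = u"
proof -
  have cont_c: "continuous_on UNIV c" and inj_c: "inj c" and rng_c: "range c = \<beta>"
    using c by (auto simp: rotational_param_def)
  have G1: "G u1 = u1" using G(3)[of u1] u1 p inj_c by (simp add: inj_eq)
  have Gle: "G u \<le> G v \<longleftrightarrow> u \<le> v" "G u < G v \<longleftrightarrow> u < v" for u v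
    using G(1) by (auto simp: strict_mono_less_eq strict_mono_less)
  define h where "h = g \<circ> g"
  have h: "leafwise U \<F> h (g' \<circ> g')" unfolding h_def by (rule leafwise_compose[OF g g])
  have hc: "h (c u) = c (G (G u))" for u by (simp add: h_def G(3))
  have cont_h: "continuous_on U h" using h by (simp add: leafwise_def homeomorphism_def)
  obtain d where d: "d > 0" "cell (\<phi> p) d \<subseteq> unit_square"
    "\<And>z. z \<in> cell (\<phi> p) d \<Longrightarrow> h (\<psi> z) \<in> V \<and> snd (\<phi> (h (\<psi> z))) = snd z"
    using level_square_id[OF g p] by (auto simp: h_def)
  define x0 y0 where "x0 = fst (\<phi> p)" and "y0 = snd (\<phi> p)"
  have "open (V \<inter> \<phi> -` interior (cell (\<phi> p) (d / 2)))"
    by (rule continuous_open_preimage[OF cont_phi open_V]) simp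
  then have "open (c -` (V \<inter> \<phi> -` interior (cell (\<phi> p) (d / 2))))"
    by (rule open_vimage[OF _ cont_c])
  moreover have "u1 \<in> c -` (V \<inter> \<phi> -` interior (cell (\<phi> p) (d / 2)))"
    using u1 p center_in_interior_cell[of "d / 2"] d(1) by auto
  ultimately obtain e where e: "e > 0" "ball u1 e \<subseteq> c -` (V \<inter> \<phi> -` interior (cell (\<phi> p) (d / 2)))"
    by (meson openE)
  have near: "c v \<in> V" "\<phi> (c v) \<in> cell (\<phi> p) (d / 2)" if "v \<in> ball u1 e" for v
  proof -
    have "v \<in> c -` (V \<inter> \<phi> -` interior (cell (\<phi> p) (d / 2)))" using e(2) that by (rule subsetD)
    then have *: "c v \<in> V" "\<phi> (c v) \<in> interior (cell (\<phi> p) (d / 2))" by simp_all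
    then show "c v \<in> V" "\<phi> (c v) \<in> cell (\<phi> p) (d / 2)"
      using subsetD[OF interior_subset *(2)] by blast+
  qed
  have conn: "connected (c ` ball u1 e)"
    by (intro connected_continuous_image continuous_on_subset[OF cont_c]) auto
  have cX: "c ` ball u1 e \<subseteq> \<beta> \<inter> V" using near(1) rng_c by auto
  have level: "snd (\<phi> (c v)) = y0" if "v \<in> ball u1 e" for v
    unfolding y0_def by (rule level_const[OF b conn cX]) (use that u1 e(1) in auto)
  define x where "x = (\<lambda>v. fst (\<phi> (c v)))"
  have \<phi>c: "\<phi> (c v) = (x v, y0)" if "v \<in> ball u1 e" for v
    using level[OF that] by (simp add: x_def prod_eq_iff)
  have c\<psi>: "c v = \<psi> (x v, y0)" if "v \<in> ball u1 e" for v
    using \<phi>c[OF that] near(1)[OF that] psi_phi by metis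
  have inj_x: "inj_on x (ball u1 e)"
    by (rule inj_onI) (metis c\<psi> inj_c injD)
  have cont_x: "continuous_on (ball u1 e) x"
    unfolding x_def
    by (intro continuous_on_fst continuous_on_compose2[OF cont_phi continuous_on_subset[OF cont_c]])
       (use near(1) in auto)
  have x_near: "x v \<in> {x0 - d / 2..x0 + d / 2}" if "v \<in> ball u1 e" for v
    using near(2)[OF that] unfolding cell_def x_def x0_def mem_Times_iff by blast
  have "G u = u" if u: "\<bar>u - u1\<bar> < e" "G u \<in> closed_segment u u1" for u
  proof (rule ccontr)
    assume ne: "G u \<noteq> u"
    define J where "J = closed_segment u u1"
    have J_ball: "J \<subseteq> ball u1 e"
      unfolding J_def by (rule closed_segment_subset) (use u e(1) in \<open>auto simp: dist_real_def\<close>)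
    \<comment> \<open>G fixes u1 and is increasing, so it maps the segment J into itself and away from u\<close>
    have HJ: "G (G v) \<in> J \<and> G (G v) \<noteq> u" if v: "v \<in> J" for v
    proof (cases "u \<le> u1")
      case True
      then have "u < G u" "u \<le> v" "v \<le> u1"
        using u(2) ne v by (auto simp: J_def closed_segment_eq_real_ivl)
      then have "G u \<le> G v" "G v \<le> u1" using Gle(1)[of u v] Gle(1)[of v u1] G1 by auto
      then have "G u < G (G v)" "G (G v) \<le> u1"
        using Gle(2)[of u "G v"] Gle(1)[of "G v" u1] G1 \<open>u < G u\<close> by auto
      then show ?thesis using True \<open>u < G u\<close> by (auto simp: J_def closed_segment_eq_real_ivl)
    next
      case False
      then have "G u < u" "v \<le> u" "u1 \<le> v"
        using u(2) ne v by (auto simp: J_def closed_segment_eq_real_ivl)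
      then have "G v \<le> G u" "u1 \<le> G v" using Gle(1)[of v u] Gle(1)[of u1 v] G1 by auto
      then have "G (G v) < G u" "u1 \<le> G (G v)"
        using Gle(2)[of "G v" u] Gle(1)[of u1 "G v"] G1 \<open>G u < u\<close> by auto
      then show ?thesis using False \<open>G u < u\<close> by (auto simp: J_def closed_segment_eq_real_ivl)
    qed
    have contH: "continuous_on J (\<lambda>v. G (G v))"
      by (intro continuous_on_compose2[OF G(2)] continuous_on_subset[OF G(2)]) auto
    define H where "H = (\<lambda>v. G (G v)) ` J"
    have H_J: "H \<subseteq> J" using HJ by (auto simp: H_def)
    have J: "connected J" "compact J" by (simp_all add: J_def)
    have "connected (x ` J)" "compact (x ` J)"
      using J continuous_on_subset[OF cont_x J_ball]
      by (blast intro: connected_continuous_image compact_continuous_image)+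
    then obtain a b' where ab: "x ` J = {a..b'}" using connected_compact_interval_1 by metis
    have H: "connected H" "compact H"
      unfolding H_def using J contH by (blast intro: connected_continuous_image compact_continuous_image)+
    have "connected (x ` H)" "compact (x ` H)"
      using H continuous_on_subset[OF cont_x order_trans[OF H_J J_ball]]
      by (blast intro: connected_continuous_image compact_continuous_image)+
    then obtain a1 b1 where ab1: "x ` H = {a1..b1}" using connected_compact_interval_1 by metis
    have uJ: "u \<in> J" by (simp add: J_def)
    have "x ` H \<noteq> {}" using uJ by (auto simp: H_def)
    then have a1b1: "a1 \<le> b1" using ab1 by auto
    have sub1: "{a1..b1} \<subseteq> {a..b'}" using ab ab1 H_J by blast
    then have le: "a \<le> a1" "b1 \<le> b'" using a1b1 by auto
    have "x u \<notin> x ` H"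
    proof
      assume "x u \<in> x ` H"
      then obtain v where v: "v \<in> J" "x u = x (G (G v))" by (auto simp: H_def)
      then have "u = G (G v)" using inj_x HJ[OF v(1)] uJ J_ball by (meson inj_onD subsetD)
      then show False using HJ[OF v(1)] by simp
    qed
    moreover have xu: "x u \<in> {a..b'}" using ab uJ by blast
    ultimately have "x u < a1 \<or> b1 < x u" using ab1 by auto
    then obtain s s' where s: "s < s'" "{s..s'} \<subseteq> {a..b'}" "{s..s'} \<inter> {a1..b1} = {}"
    proof
      assume "x u < a1"
      then show ?thesis using that[of "x u" "(x u + a1) / 2"] xu le a1b1 by (auto simp: field_simps)
    next
      assume "b1 < x u"
      then show ?thesis using that[of "(x u + b1) / 2" "x u"] xu le a1b1 by (auto simp: field_simps)
    qed
    have "x ` J \<subseteq> {x0 - d / 2..x0 + d / 2}"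
      by (rule image_subsetI, rule x_near, rule subsetD[OF J_ball])
    then have ab_near': "x0 - d / 2 \<le> a" "b' \<le> x0 + d / 2"
      using le a1b1 unfolding ab by simp_all
    define R where "R = cell (\<phi> p) d"
    have R: "compact R" "R \<subseteq> unit_square" using d(2) compact_cell by (simp_all add: R_def)
    have cont_psiR: "continuous_on S \<psi>" if "S \<subseteq> R" for S
      by (rule continuous_on_subset[OF cont_psi order_trans[OF that R(2)]])
    have psiR_V: "\<psi> ` S \<subseteq> V" if "S \<subseteq> R" for S using that R psi_in by blast
    have comp_psi: "compact (\<psi> ` S)" if "compact S" "S \<subseteq> R" for S
      using that by (intro compact_continuous_image cont_psiR)
    obtain A where A: "A > 0" "\<And>S. compact S \<Longrightarrow> S \<subseteq> R \<Longrightarrow> measure lborel (\<psi> ` S) \<le> A * measure lborel S"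
      using C1_image_area_le[OF C1(2) R] by metis
    obtain B where B: "B > 0"
      "\<And>S. compact S \<Longrightarrow> S \<subseteq> \<psi> ` R \<Longrightarrow> measure lborel (\<phi> ` S) \<le> B * measure lborel S"
      using C1_image_area_le[OF C1(1) comp_psi[OF R(1) order_refl] psiR_V[OF order_refl]] by metis
    have B': "measure lborel S \<le> B * measure lborel (\<psi> ` S)" if "compact S" "S \<subseteq> R" for S
    proof -
      have "\<phi> ` (\<psi> ` S) = (\<lambda>z. z) ` S" unfolding image_image
        by (rule image_cong) (use that R in auto)
      then show ?thesis using B(2)[OF comp_psi[OF that]] that by auto
    qed
    \<comment> \<open>at the end, the area estimates would give s' - s \<le> 2 * A * B * \<eta>\<close>
    define \<eta> where "\<eta> = min (d / 2) ((s' - s) / (4 * A * B))"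
    have \<eta>: "0 < \<eta>" "\<eta> \<le> d / 2" "2 * A * B * \<eta> < s' - s"
    proof -
      show "0 < \<eta>" "\<eta> \<le> d / 2" using d(1) s(1) A(1) B(1) by (auto simp: \<eta>_def)
      have "\<eta> \<le> (s' - s) / (4 * A * B)" by (simp add: \<eta>_def)
      then have "4 * A * B * \<eta> \<le> s' - s" using A(1) B(1) by (simp add: field_simps)
      moreover have "0 < A * B * \<eta>" using A(1) B(1) \<open>0 < \<eta>\<close> by simp
      ultimately show "2 * A * B * \<eta> < s' - s" by linarith
    qed
    define k where "k = (\<lambda>z. fst (\<phi> (h (\<psi> z))))"
    have "continuous_on R (\<lambda>z. h (\<psi> z))"
      by (rule continuous_on_compose2[OF cont_h cont_psiR[OF order_refl]]) (use psiR_V[of R] V_sub in blast)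
    then have "continuous_on R (\<lambda>z. \<phi> (h (\<psi> z)))"
      by (rule continuous_on_compose2[OF cont_phi]) (use d(3) in \<open>auto simp: R_def\<close>)
    then have "continuous_on R k" unfolding k_def by (rule continuous_on_fst)
    then have "uniformly_continuous_on R k" using R(1) by (rule compact_uniformly_continuous)
    then obtain \<delta> where \<delta>: "\<delta> > 0" "\<And>z z'. z \<in> R \<Longrightarrow> z' \<in> R \<Longrightarrow> dist z' z < \<delta> \<Longrightarrow> dist (k z') (k z) < \<eta>"
      using uniformly_continuous_onE \<eta>(1) by metis
    define \<epsilon> where "\<epsilon> = min d (\<delta> / 2)"
    have \<epsilon>: "0 < \<epsilon>" "\<epsilon> \<le> d" "\<epsilon> < \<delta>" using d(1) \<delta>(1) by (auto simp: \<epsilon>_def)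
    define I where "I = {y0 - \<epsilon>..y0 + \<epsilon>}"
    have R_eq: "R = {x0 - d..x0 + d} \<times> {y0 - d..y0 + d}" by (simp add: R_def cell_def x0_def y0_def)
    have strip_R: "{q..r} \<times> I \<subseteq> R" if "x0 - d \<le> q" "r \<le> x0 + d" for q r
      using that \<epsilon> by (auto simp: R_eq I_def)
    have strip_compact: "compact ({q..r} \<times> I)" for q r :: real
      by (simp add: I_def compact_Times)
    have strip_area: "measure lborel ({q..r} \<times> I) = (r - q) * (2 * \<epsilon>)" if "q \<le> r" for q r :: real
      using that \<epsilon> by (simp add: I_def measure_rectangle)
    let ?E = "\<lambda>q r. \<psi> ` ({q..r} \<times> I)"
    let ?\<mu> = "\<lambda>q r. measure lborel (?E q r)"
    have fm: "?E q r \<in> fmeasurable lborel" if "x0 - d \<le> q" "r \<le> x0 + d" for q r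
      by (intro fmeasurable_compact comp_psi strip_compact strip_R that)
    \<comment> \<open>uniform continuity controls the first coordinate, and the level is kept exactly\<close>
    have img: "h ` ?E a b' \<subseteq> ?E (a1 - \<eta>) (b1 + \<eta>)"
    proof
      fix q assume "q \<in> h ` ?E a b'"
      then obtain z where z: "z \<in> {a..b'} \<times> I" "q = h (\<psi> z)" by blast
      obtain xx y where zz: "z = (xx, y)" "xx \<in> {a..b'}" "y \<in> I" using z(1) by blast
      have zR: "z \<in> R" using strip_R[of a b'] ab_near' d(1) z(1) by auto
      have zR0: "(xx, y0) \<in> R" using zz(2) ab_near' d(1) by (auto simp: R_eq)
      have qV: "q \<in> V" "snd (\<phi> q) = y" using d(3)[of z] zR z(2) zz by (auto simp: R_def)
      obtain v where v: "v \<in> J" "xx = x v" using ab zz(2) by blast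
      have "k (xx, y0) = x (G (G v))"
        using c\<psi>[of v] v J_ball hc[of v] by (auto simp: k_def x_def)
      then have "k (xx, y0) \<in> {a1..b1}" using ab1 v by (auto simp: H_def)
      moreover have "dist z (xx, y0) < \<delta>"
        using zz \<epsilon> by (auto simp: dist_Pair_Pair dist_real_def I_def)
      then have "\<bar>k z - k (xx, y0)\<bar> < \<eta>" using \<delta>(2)[OF zR0 zR] by (simp add: dist_real_def)
      ultimately have "k z \<in> {a1 - \<eta>..b1 + \<eta>}" by auto
      moreover have "\<phi> q = (k z, y)"
        unfolding k_def z(2)[symmetric] qV(2)[symmetric] by simp
      ultimately have "\<phi> q \<in> {a1 - \<eta>..b1 + \<eta>} \<times> I" using zz(3) by simp
      then show "q \<in> ?E (a1 - \<eta>) (b1 + \<eta>)" using psi_phi[OF qV(1)] by (metis imageI)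
    qed
    have bounds: "x0 - d \<le> a" "b' \<le> x0 + d" "x0 - d \<le> a1 - \<eta>" "b1 + \<eta> \<le> x0 + d" "x0 - d \<le> a1" "b1 \<le> x0 + d"
      "x0 - d \<le> s" "s' \<le> x0 + d" "a1 \<le> x0 + d" "x0 - d \<le> b1"
      using ab_near' le a1b1 \<eta> d(1) s by auto
    have E: "compact (?E a b')" "?E a b' \<subseteq> U"
      using comp_psi[OF strip_compact strip_R[OF bounds(1,2)]] psiR_V[OF strip_R[OF bounds(1,2)]] V_sub by simp_all
    have "?\<mu> s s' + ?\<mu> a1 b1 = measure lborel (?E s s' \<union> ?E a1 b1)"
    proof (rule measure_Union[symmetric])
      show "?E s s' \<inter> ?E a1 b1 = {}"
      proof (rule ccontr)
        assume "?E s s' \<inter> ?E a1 b1 \<noteq> {}"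
        then obtain z z' where z: "z \<in> {s..s'} \<times> I" "z' \<in> {a1..b1} \<times> I" "\<psi> z = \<psi> z'" by blast
        then have "z \<in> unit_square" "z' \<in> unit_square"
          using strip_R[OF bounds(7,8)] strip_R[OF bounds(5,6)] R(2) by blast+
        then have "z = z'" using z(3) phi_psi by metis
        then show False using z(1,2) s(3) by auto
      qed
    qed (use fm[of s s'] fm[of a1 b1] bounds in \<open>auto simp: fmeasurable_def\<close>)
    also have "\<dots> \<le> ?\<mu> a b'"
    proof (rule measure_mono_fmeasurable)
      show "?E s s' \<union> ?E a1 b1 \<subseteq> ?E a b'"
        using s(2) sub1 by blast
      show "?E s s' \<union> ?E a1 b1 \<in> sets lborel"
        using fm[of s s'] fm[of a1 b1] bounds by (auto simp: fmeasurable_def)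
    qed (use fm bounds in blast)
    also have "\<dots> = measure lborel (h ` ?E a b')"
      using h E by (simp add: leafwise_def measure_def)
    also have "\<dots> \<le> ?\<mu> (a1 - \<eta>) (b1 + \<eta>)"
    proof (rule measure_mono_fmeasurable[OF img])
      have "compact (h ` ?E a b')"
        by (rule compact_continuous_image[OF continuous_on_subset[OF cont_h E(2)] E(1)])
      then show "h ` ?E a b' \<in> sets lborel" by (simp add: borel_compact)
    qed (use fm bounds in blast)
    also have "\<dots> \<le> measure lborel (?E (a1 - \<eta>) a1 \<union> ?E a1 b1 \<union> ?E b1 (b1 + \<eta>))"
    proof (rule measure_mono_fmeasurable)
      have "{a1 - \<eta>..b1 + \<eta>} \<subseteq> {a1 - \<eta>..a1} \<union> {a1..b1} \<union> {b1..b1 + \<eta>}" by auto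
      then show "?E (a1 - \<eta>) (b1 + \<eta>)
        \<subseteq> ?E (a1 - \<eta>) a1 \<union> ?E a1 b1 \<union> ?E b1 (b1 + \<eta>)" by blast
      show "?E (a1 - \<eta>) (b1 + \<eta>) \<in> sets lborel"
        using fm[of "a1 - \<eta>" "b1 + \<eta>"] bounds by (auto simp: fmeasurable_def)
      show "?E (a1 - \<eta>) a1 \<union> ?E a1 b1 \<union> ?E b1 (b1 + \<eta>) \<in> fmeasurable lborel"
        using fm[of "a1 - \<eta>" a1] fm[of a1 b1] fm[of b1 "b1 + \<eta>"] bounds
        by (intro fmeasurable.Un) auto
    qed
    also have "\<dots> \<le> ?\<mu> (a1 - \<eta>) a1 + ?\<mu> a1 b1 + ?\<mu> b1 (b1 + \<eta>)"
    proof -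
      have m: "?E (a1 - \<eta>) a1 \<in> sets lborel" "?E a1 b1 \<in> sets lborel"
        "?E b1 (b1 + \<eta>) \<in> sets lborel"
        using fm[of "a1 - \<eta>" a1] fm[of a1 b1] fm[of b1 "b1 + \<eta>"] bounds by (auto simp: fmeasurable_def)
      show ?thesis
        using measure_Un_le[of "?E (a1 - \<eta>) a1 \<union> ?E a1 b1" lborel "?E b1 (b1 + \<eta>)"]
          measure_Un_le[of "?E (a1 - \<eta>) a1" lborel "?E a1 b1"] m by auto
    qed
    finally have *: "?\<mu> s s' \<le> ?\<mu> (a1 - \<eta>) a1 + ?\<mu> b1 (b1 + \<eta>)" by simp
    have m1: "?\<mu> (a1 - \<eta>) a1 \<le> A * (\<eta> * (2 * \<epsilon>))"
      using A(2)[OF strip_compact[of "a1 - \<eta>" a1] strip_R] strip_area[of "a1 - \<eta>" a1] bounds \<eta> by simp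
    have m2: "?\<mu> b1 (b1 + \<eta>) \<le> A * (\<eta> * (2 * \<epsilon>))"
      using A(2)[OF strip_compact[of b1 "b1 + \<eta>"] strip_R] strip_area[of b1 "b1 + \<eta>"] bounds \<eta> by simp
    have "(s' - s) * (2 * \<epsilon>) \<le> B * ?\<mu> s s'"
      using B'[OF strip_compact[of s s'] strip_R] strip_area[of s s'] bounds s(1) by simp
    also have "\<dots> \<le> B * (A * (\<eta> * (2 * \<epsilon>)) + A * (\<eta> * (2 * \<epsilon>)))"
      by (rule mult_left_mono) (use * m1 m2 B(1) in linarith)+
    finally have "(s' - s) * (2 * \<epsilon>) \<le> (2 * A * B * \<eta>) * (2 * \<epsilon>)"
      by (simp add: algebra_simps)
    then have "s' - s \<le> 2 * A * B * \<eta>" using \<epsilon>(1) by (simp add: mult_le_cancel_right)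
    then show False using \<eta>(3) by simp
  qed
  then show ?thesis using that e(1) by blast
qed

text \<open>
  Near \<open>u1\<close> either \<open>G\<close> or its inverse moves a given point towards \<open>u1\<close>, and neither can contract.
\<close>
lemma fixed_points_open:
  assumes g: "leafwise U \<F> g g'" and p: "p \<in> V" "g p = p"
    and b: "\<beta> \<in> \<F>" and c: "rotational_param l \<beta> c" and u1: "c u1 = p"
    and G: "strict_mono G" "continuous_on UNIV G" "\<And>u. g (c u) = c (G u)"
    and G': "strict_mono G'" "continuous_on UNIV G'" "\<And>u. G (G' u) = u" "\<And>u. G' (G u) = u"
  obtains e where "e > 0" "\<And>u. \<bar>u - u1\<bar> < e \<Longrightarrow> G u = u"
proof -
  have cU: "c u \<in> U" for u using c leaf_sub[OF b] by (auto simp: rotational_param_def)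
  have inv: "g' (g q) = q" if "q \<in> U" for q
    using g that by (auto simp: leafwise_def homeomorphism_def)
  have g'c: "g' (c u) = c (G' u)" for u
    using inv[OF cU, of "G' u"] by (simp add: G(3) G'(3))
  have g'p: "g' p = p" using inv[OF cU, of u1] u1 p by simp
  have fix1: "G u1 = u1" using G(3)[of u1] u1 p c by (simp add: rotational_param_def inj_eq)
  obtain e where e: "e > 0" "\<And>u. \<bar>u - u1\<bar> < e \<Longrightarrow> G u \<in> closed_segment u u1 \<Longrightarrow> G u = u"
    using no_contraction[OF g p b c u1 G] by metis
  obtain e' where e': "e' > 0" "\<And>u. \<bar>u - u1\<bar> < e' \<Longrightarrow> G' u \<in> closed_segment u u1 \<Longrightarrow> G' u = u"
    using no_contraction[OF leafwise_inverse[OF g leaf_sub] p(1) g'p b c u1 G'(1,2) g'c] by metis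
  have "isCont G u1" using G(2) by (simp add: continuous_on_eq_continuous_at)
  then obtain e2 where e2: "e2 > 0" "\<And>u. \<bar>u - u1\<bar> < e2 \<Longrightarrow> \<bar>G u - u1\<bar> < e'"
    unfolding continuous_at_eps_delta using e'(1) fix1 by (metis dist_real_def)
  show ?thesis
  proof
    show "min e e2 > 0" using e(1) e2(1) by simp
    fix u assume u: "\<bar>u - u1\<bar> < min e e2"
    have "G u \<le> u1 \<longleftrightarrow> u \<le> u1" using G(1) fix1 by (metis strict_mono_less_eq)
    then have "G u \<in> closed_segment u u1 \<or> u \<in> closed_segment (G u) u1"
      by (auto simp: closed_segment_eq_real_ivl)
    then show "G u = u"
    proof
      assume "u \<in> closed_segment (G u) u1"
      then have "G' (G u) \<in> closed_segment (G u) u1" by (simp only: G'(4))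
      moreover have "\<bar>G u - u1\<bar> < e'" using e2(2)[of u] u by simp
      ultimately have "G' (G u) = G u" using e'(2) by blast
      then show "G u = u" by (simp only: G'(4))
    qed (use e(2) u in auto)
  qed
qed

end

text \<open>
  The fixed points of the circle map form a closed set, which is open by \<open>fixed_points_open\<close>.
\<close>
lemma leaf_map_id:
  assumes l: "0 < l" and fol: "C1_foliation U \<F>"
    and params: "\<And>\<beta>. \<beta> \<in> \<F> \<Longrightarrow> \<exists>c. rotational_param l \<beta> c"
    and g: "leafwise U \<F> g g'" and b: "\<beta> \<in> \<F>" and c: "rotational_param l \<beta> c"
    and G: "strict_mono G" "continuous_on UNIV G" "\<And>u. g (c u) = c (G u)"
    and G': "strict_mono G'" "continuous_on UNIV G'" "\<And>u. G (G' u) = u" "\<And>u. G' (G u) = u"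
    and fix1: "G u1 = u1"
  shows "G u = u"
proof -
  have part: "partition_on U \<F>" using fol by (simp add: C1_foliation_def)
  have cU: "c u \<in> U" for u
    using c b part by (auto simp: rotational_param_def partition_on_def)
  have "open {u. G u = u}"
    unfolding open_dist
  proof
    fix v assume v: "v \<in> {u. G u = u}"
    have "\<exists>V \<phi>. open V \<and> c v \<in> V \<and> V \<subseteq> U \<and> C1_diffeomorphism V ({0<..<1::real} \<times> {0<..<1::real}) \<phi> \<and>
        (\<forall>\<alpha>\<in>\<F>. \<forall>P\<in>components (\<alpha> \<inter> V). \<exists>y\<in>{0<..<1}. P = {q \<in> V. snd (\<phi> q) = y})"
      using fol[unfolded C1_foliation_def, THEN conjunct2] cU[of v] by (rule bspec)
    then obtain V \<phi> where V: "open V" "c v \<in> V" "V \<subseteq> U"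
      "C1_diffeomorphism V ({0<..<1::real} \<times> {0<..<1::real}) \<phi>"
      and plaques: "\<forall>\<alpha>\<in>\<F>. \<forall>P\<in>components (\<alpha> \<inter> V). \<exists>y\<in>{0<..<1}. P = {q \<in> V. snd (\<phi> q) = y}"
      by (elim exE conjE)
    obtain \<psi> where \<psi>: "homeomorphism V unit_square \<phi> \<psi>" "C1_on \<phi> V" "C1_on \<psi> unit_square"
      using V(4) by (auto simp: C1_diffeomorphism_def unit_square_def)
    interpret foliation_chart U V \<F> l \<phi> \<psi>
      by (rule foliation_chart.intro) (fact l part params V \<psi> plaques[rule_format])+
    have "g (c v) = c v" using G(3)[of v] v by simp
    then obtain e where "e > 0" "\<And>u. \<bar>u - v\<bar> < e \<Longrightarrow> G u = u"
      using fixed_points_open[OF g V(2) _ b c refl G G'] by metis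
    then show "\<exists>e>0. \<forall>u. dist u v < e \<longrightarrow> u \<in> {u. G u = u}"
      by (auto simp: dist_real_def)
  qed
  moreover have "closed {u. G u = u}"
    using G(2) by (intro closed_Collect_eq) auto
  ultimately have "{u. G u = u} = UNIV"
    using clopen[of "{u. G u = u}"] fix1 by blast
  then show ?thesis by blast
qed

section \<open>Circle maps and families of periodic orbits\<close>

text \<open>
  A proper continuous injection is a closed embedding.
\<close>
lemma rotational_param_inverse_continuous:
  assumes l: "0 < l" and c: "rotational_param l \<alpha> c"
  shows "continuous_on \<alpha> (inv c)" "closed \<alpha>"
proof -
  have cont: "continuous_on UNIV c" and inj: "inj c" and rng: "range c = \<alpha>"
    using c by (auto simp: rotational_param_def)
  obtain B where B: "\<And>u. \<bar>fst (c u) - l * u\<bar> \<le> B" using rotational_param_proper[OF c] by blast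
  have cl: "closed (c ` X)" if X: "closed X" for X
    unfolding closed_sequential_limits
  proof (intro allI impI)
    fix p q assume "(\<forall>n. p n \<in> c ` X) \<and> p \<longlonglongrightarrow> q"
    then have p: "\<And>n. p n \<in> c ` X" "p \<longlonglongrightarrow> q" by auto
    have "(\<lambda>n. fst (p n)) \<longlonglongrightarrow> fst q" using p(2) by (rule tendsto_fst)
    then have "Bseq (\<lambda>n. fst (p n))" by (intro convergent_imp_Bseq convergentI)
    then obtain M where M: "\<And>n. \<bar>fst (p n)\<bar> \<le> M" unfolding Bseq_def by auto
    define R where "R = (M + B) / l"
    have "p n \<in> c ` (X \<inter> {-R..R})" for n
    proof -
      obtain u where u: "u \<in> X" "p n = c u" using p(1) by blast
      have "\<bar>l * u\<bar> \<le> M + B" using M[of n] B[of u] u(2) by auto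
      then have "\<bar>u\<bar> \<le> R" using l by (simp add: R_def abs_mult field_simps)
      then have "u \<in> X \<inter> {-R..R}" using u(1) by (simp add: abs_le_iff)
      then show ?thesis using u(2) by blast
    qed
    moreover have "closed (c ` (X \<inter> {-R..R}))"
      by (intro compact_imp_closed compact_continuous_image continuous_on_subset[OF cont] closed_Int_compact X) auto
    ultimately have "q \<in> c ` (X \<inter> {-R..R})" using closed_sequentially p(2) by metis
    then show "q \<in> c ` X" by blast
  qed
  show cl_\<alpha>: "closed \<alpha>" using cl[of UNIV] rng by simp
  show "continuous_on \<alpha> (inv c)"
    unfolding continuous_on_closed_vimage[OF cl_\<alpha>]
  proof (intro allI impI)
    fix X :: "real set" assume "closed X"
    moreover have "inv c -` X \<inter> \<alpha> = c ` X" using inj rng by (auto simp: image_iff)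
    ultimately show "closed (inv c -` X \<inter> \<alpha>)" using cl by simp
  qed
qed

lemma continuous_lift:
  assumes "0 < l" and c: "rotational_param l \<alpha> c" and f: "continuous_on UNIV f" "\<And>u. f u = c (F u)"
  shows "continuous_on UNIV F"
proof -
  have "continuous_on UNIV (\<lambda>u. inv c (f u))"
    by (rule continuous_on_compose2[OF rotational_param_inverse_continuous(1)[OF assms(1) c] f(1)])
       (use f(2) c in \<open>auto simp: rotational_param_def\<close>)
  moreover have "inv c (f u) = F u" for u using c f(2) by (simp add: rotational_param_def)
  ultimately show ?thesis by simp
qed

lemma continuous_on_funpow: "continuous_on UNIV F \<Longrightarrow> continuous_on UNIV (F ^^ n)" for F :: "real \<Rightarrow> real"
  by (induction n) (simp_all add: id_def comp_def continuous_on_compose2)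

lemma strict_mono_lift:
  fixes F :: "real \<Rightarrow> real"
  assumes "continuous_on UNIV F" "inj F" "\<And>u. F (u + 1) = F u + 1"
  shows "strict_mono F"
proof -
  have "strict_mono_on UNIV F \<or> strict_antimono_on UNIV F"
    using injective_eq_monotone_map[OF _ assms(1)] assms(2) by (simp add: is_interval_univ)
  moreover have "\<not> strict_antimono_on UNIV F"
  proof
    assume "strict_antimono_on UNIV F"
    then have "F 1 < F 0" by (rule monotone_onD) auto
    then show False using assms(3)[of 0] by simp
  qed
  ultimately show ?thesis by blast
qed

text \<open>
  Otherwise the continuous periodic function \<open>D u = (F ^^ k) u - u - r\<close> has constant sign and is
  bounded away from 0, which makes the mean displacement of \<open>F ^^ k\<close> different from \<open>r\<close>.
\<close>
lemma periodic_point_of_rational_rotation: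
  fixes F :: "real \<Rightarrow> real" and r :: int
  assumes cont: "continuous_on UNIV F" and per: "\<And>u. F (u + 1) = F u + 1"
    and lim: "(\<lambda>n. ((F ^^ n) u0 - u0) / real n) \<longlonglongrightarrow> of_int r / of_nat k" and k: "0 < k"
  obtains u where "(F ^^ k) u = u + of_int r"
proof (rule ccontr)
  assume none: "\<not> thesis"
  define D where "D = (\<lambda>u. (F ^^ k) u - u - of_int r)"
  note contn = continuous_on_funpow[OF cont]
  have pern: "(F ^^ n) (u + 1) = (F ^^ n) u + 1" for n u
    by (induction n) (auto simp: per)
  have contD: "continuous_on A D" for A
    unfolding D_def by (intro continuous_intros continuous_on_subset[OF contn]) auto
  have nz: "D u \<noteq> 0" for u
  proof
    assume "D u = 0"
    then have "(F ^^ k) u = u + of_int r" by (simp add: D_def)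
    then show False using none that by blast
  qed
  have D1: "D (u + 1) = D u" for u by (simp add: D_def pern)
  have Dfrac: "D u = D (frac u)" for u
    using periodic_int[where f = D and l = 1, OF D1, of "frac u" "\<lfloor>u\<rfloor>"] by (simp add: frac_def)
  obtain m where m: "m \<in> {0..1}" "\<And>u. u \<in> {0..1} \<Longrightarrow> \<bar>D m\<bar> \<le> \<bar>D u\<bar>"
    using continuous_attains_inf[of "{0..1}" "\<lambda>u. \<bar>D u\<bar>"] continuous_on_rabs[OF contD] by fastforce
  define \<delta> where "\<delta> = \<bar>D m\<bar>"
  have \<delta>: "0 < \<delta>" using nz by (simp add: \<delta>_def)
  have D\<delta>: "\<delta> \<le> \<bar>D u\<bar>" for u
    using m(2)[of "frac u"] Dfrac[of u] frac_lt_1[of u] by (simp add: \<delta>_def)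
  have same_sign: "(\<forall>u. 0 < D u) \<or> (\<forall>u. D u < 0)"
  proof (rule ccontr)
    assume "\<not> ?thesis"
    then obtain u v where uv: "D u \<le> 0" "0 \<le> D v" by (meson not_less)
    have "connected (range D)" using contD by (rule connected_continuous_image) simp
    then have "0 \<in> range D" 
      using uv connectedD_interval by (metis rangeI)
    then show False using nz by auto
  qed
  define y where "y = (\<lambda>n. (F ^^ (k * n)) u0)"
  have yD: "y n - u0 - of_nat n * of_int r = (\<Sum>i<n. D (y i))" for n
  proof (induction n)
    case (Suc n)
    have "y (Suc n) = (F ^^ k) (y n)" by (simp add: y_def funpow_add)
    then show ?case using Suc by (simp add: D_def algebra_simps)
  qed (simp add: y_def)
  \<comment> \<open>all terms of the sum have the same sign and absolute value at least \<delta>\<close>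
  have far: "of_nat n * \<delta> \<le> \<bar>y n - u0 - of_nat n * of_int r\<bar>" for n
    using same_sign
  proof
    assume pos: "\<forall>u. 0 < D u"
    have "(\<Sum>i<n. \<delta>) \<le> (\<Sum>i<n. D (y i))"
    proof (rule sum_mono)
      show "\<delta> \<le> D (y i)" for i using D\<delta>[of "y i"] pos[rule_format, of "y i"] by linarith
    qed
    then show ?thesis unfolding yD by simp
  next
    assume neg: "\<forall>u. D u < 0"
    have "(\<Sum>i<n. \<delta>) \<le> (\<Sum>i<n. - D (y i))"
    proof (rule sum_mono)
      show "\<delta> \<le> - D (y i)" for i using D\<delta>[of "y i"] neg[rule_format, of "y i"] by linarith
    qed
    then show ?thesis unfolding yD by (simp add: sum_negf)
  qed
  have "strict_mono (\<lambda>n. k * n)" using k by (simp add: strict_mono_def)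
  from LIMSEQ_subseq_LIMSEQ[OF lim this]
  have "(\<lambda>n. (y n - u0) / real (k * n)) \<longlonglongrightarrow> of_int r / of_nat k"
    by (simp add: comp_def y_def)
  then have "(\<lambda>n. real k * ((y n - u0) / real (k * n)) - of_int r) \<longlonglongrightarrow> real k * (of_int r / of_nat k) - of_int r"
    by (intro tendsto_diff tendsto_mult tendsto_const)
  then have "(\<lambda>n. real k * ((y n - u0) / real (k * n)) - of_int r) \<longlonglongrightarrow> 0" using k by simp
  from tendstoD[OF this \<delta>]
  have "\<forall>\<^sub>F n in sequentially. \<bar>real k * ((y n - u0) / real (k * n)) - of_int r\<bar> < \<delta>"
    by (simp only: dist_real_def diff_0_right)
  then have "\<forall>\<^sub>F n in sequentially. \<bar>real k * ((y n - u0) / real (k * n)) - of_int r\<bar> < \<delta> \<and> 0 < n"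
    using eventually_gt_at_top[of 0] by eventually_elim auto
  then obtain n where n: "\<bar>real k * ((y n - u0) / real (k * n)) - of_int r\<bar> < \<delta>" "0 < n"
    using eventually_happens trivial_limit_sequentially by blast
  have "real k * ((y n - u0) / real (k * n)) - of_int r = (y n - u0 - of_nat n * of_int r) / of_nat n"
    using k n(2) by (simp add: field_simps)
  then have "\<bar>y n - u0 - of_nat n * of_int r\<bar> / of_nat n < \<delta>" using n by (simp add: abs_divide)
  then show False using far[of n] n(2) by (simp add: field_simps)
qed

context twist
begin

text \<open>
  Suppose an orbit lies below another one and meets it at \<open>y1\<close>. By monotonicity its incoming momentum
  at \<open>y1\<close> is at most, and its outgoing momentum at least, that of the other orbit. Both orbits
  balance these momenta, so equality holds, and strict monotonicity forces the next points to agree.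
\<close>
lemma contact_propagates:
  assumes y: "y0 < y1" "y1 < y0 + l" "y1 < y2" "y2 < y1 + l" "b y0 y1 = a y1 y2"
    and x: "x0 < y1" "y1 < x0 + l" "y1 < x2" "x2 < y1 + l" "b x0 y1 = a y1 x2"
    and le: "y0 \<le> x0" "y2 \<le> x2"
  shows "y2 = x2"
proof (rule ccontr)
  assume "y2 \<noteq> x2"
  then have "y2 < x2" using le by simp
  then have "a y1 x2 < a y1 y2" using a_mono y x by auto
  moreover have "b y0 y1 \<le> b x0 y1" using b_mono[of y0 x0 y1] le y x by (cases "y0 = x0") auto
  ultimately show False using y x by simp
qed

text \<open>
  The positions of a lifted orbit of the billiard map that makes \<open>r\<close> turns in \<open>k\<close> steps.
\<close>
definition periodic_orbit :: "nat \<Rightarrow> int \<Rightarrow> (nat \<Rightarrow> real) \<Rightarrow> bool" where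
  "periodic_orbit k r x \<longleftrightarrow> (\<forall>j. x j < x (Suc j) \<and> x (Suc j) < x j + l \<and>
     b (x j) (x (Suc j)) = a (x (Suc j)) (x (Suc (Suc j))) \<and> x (j + k) = x j + of_int r * l)"

text \<open>
  Raise the family until it first meets \<open>x\<close>. By periodicity only \<open>k\<close> positions have to be compared, so
  there is a first contact; it spreads over the whole orbit by \<open>contact_propagates\<close>.
\<close>
lemma touching_family:
  fixes y :: "real \<Rightarrow> nat \<Rightarrow> real"
  assumes k: "0 < k" and y: "\<And>u. periodic_orbit k r (y u)" and x: "periodic_orbit k r x"
    and cont: "\<And>j. continuous_on UNIV (\<lambda>u. y u j)" and shift: "\<And>u j. y (u + 1) j = y u j + l"
  obtains u0 where "y u0 = x" "\<And>u j. u < u0 \<Longrightarrow> y u j < x j"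
proof -
  have "\<exists>B. \<forall>u. \<bar>y u j - l * u\<bar> \<le> B" for j
  proof -
    have "continuous_on UNIV (\<lambda>u. y u j - l * u)" by (intro continuous_intros cont)
    moreover have "y (u + 1) j - l * (u + 1) = y u j - l * u" for u using shift[of u j] by (simp add: distrib_left)
    ultimately show ?thesis by (rule periodic_bounded[where f = "\<lambda>u. y u j - l * u"]) blast
  qed
  then obtain B where B: "\<And>u j. \<bar>y u j - l * u\<bar> \<le> B j" by metis
  define X where "X = (\<Union>j<k. {u. x j \<le> y u j})"
  have "closed X" unfolding X_def
    by (intro closed_UN ballI closed_Collect_le cont continuous_on_const) simp
  moreover have "X \<noteq> {}"
  proof -
    have "x 0 \<le> y ((x 0 + B 0) / l) 0"
      using B[of "(x 0 + B 0) / l" 0] l_pos by (simp add: abs_le_iff)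
    then show ?thesis using k by (auto simp: X_def)
  qed
  moreover have "bdd_below X"
  proof -
    have "Min ((\<lambda>j. (x j - B j) / l) ` {..<k}) \<le> u" if u: "u \<in> X" for u
    proof -
      obtain j where j: "j < k" "x j \<le> y u j" using u by (auto simp: X_def)
      have "x j - B j \<le> l * u" using B[of u j] j by (simp add: abs_le_iff)
      then have "(x j - B j) / l \<le> u" using l_pos by (simp add: field_simps)
      moreover have "Min ((\<lambda>j. (x j - B j) / l) ` {..<k}) \<le> (x j - B j) / l" using j by (intro Min_le) auto
      ultimately show ?thesis by simp
    qed
    then show ?thesis unfolding bdd_below_def by blast
  qed
  ultimately have InfX: "Inf X \<in> X" "\<And>u. u \<in> X \<Longrightarrow> Inf X \<le> u"
    using closed_contains_Inf cInf_lower by blast+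
  define u0 where "u0 = Inf X"
  have reduce: "\<exists>i<k. \<exists>q::nat. j = i + q * k" for j
    using k by (intro exI[of _ "j mod k"]) (auto intro: exI[of _ "j div k"])
  have per: "z (i + q * k) = z i + of_nat q * (of_int r * l)" if "periodic_orbit k r z" for z i q
  proof (induction q)
    case (Suc q)
    have "z (i + Suc q * k) = z ((i + q * k) + k)" by (simp add: algebra_simps)
    also have "\<dots> = z (i + q * k) + of_int r * l" using that by (simp add: periodic_orbit_def)
    finally show ?case using Suc by (simp add: algebra_simps)
  qed simp
  have below: "y u j < x j" if "u < u0" for u j
  proof -
    obtain i q where i: "i < k" "j = i + q * k" using reduce by blast
    have "u \<notin> X"
    proof
      assume "u \<in> X"
      then show False using InfX(2)[of u] that by (simp add: u0_def)
    qed
    then have "y u i < x i" using i(1) by (auto simp: X_def not_le)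
    then show ?thesis unfolding i(2) per[OF y] per[OF x] by simp
  qed
  have le: "y u0 j \<le> x j" for j
  proof (rule tendsto_upperbound)
    have "isCont (\<lambda>u. y u j) u0" using cont by (simp add: continuous_on_eq_continuous_at)
    then show "((\<lambda>u. y u j) \<longlongrightarrow> y u0 j) (at_left u0)"
      unfolding isCont_def by (rule tendsto_within_subset) simp
    show "\<forall>\<^sub>F u in at_left u0. y u j \<le> x j"
      using below by (auto simp: eventually_at_filter intro!: always_eventually less_imp_le)
  qed simp
  obtain i where i: "i < k" "x i \<le> y u0 i" using InfX(1) by (auto simp: X_def u0_def)
  then have eq0: "y u0 (i + 1 * k) = x (i + 1 * k)"
    using le[of i] unfolding per[OF y] per[OF x] by simp
  have eq: "y u0 (i + k + n) = x (i + k + n)" for n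
  proof (induction n)
    case 0
    then show ?case using eq0 by simp
  next
    case (Suc n)
    \<comment> \<open>the contact at i is moved to i + k, so that the orbit has a point before it\<close>
    define m where "m = i + k + n - 1"
    have m: "Suc m = i + k + n" using k by (simp add: m_def)
    have "y u0 (Suc (Suc m)) = x (Suc (Suc m))"
    proof -
      have e: "x (Suc m) = y u0 (Suc m)" using Suc.IH by (simp add: m)
      have y': "y u0 j < y u0 (Suc j)" "y u0 (Suc j) < y u0 j + l"
        "b (y u0 j) (y u0 (Suc j)) = a (y u0 (Suc j)) (y u0 (Suc (Suc j)))" for j
        using y[of u0] by (auto simp: periodic_orbit_def)
      have x': "x j < x (Suc j)" "x (Suc j) < x j + l" "b (x j) (x (Suc j)) = a (x (Suc j)) (x (Suc (Suc j)))" for j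
        using x by (auto simp: periodic_orbit_def)
      show ?thesis
        by (rule contact_propagates[OF y'(1)[of m] y'(2)[of m] y'(1)[of "Suc m"] y'(2)[of "Suc m"] y'(3)[of m]
              x'(1)[of m, unfolded e] x'(2)[of m, unfolded e] x'(1)[of "Suc m", unfolded e]
              x'(2)[of "Suc m", unfolded e] x'(3)[of m, unfolded e] le le])
    qed
    then show ?case using m by simp
  qed
  have "y u0 j = x j" for j
  proof -
    have "y u0 (j + (i + 1) * k) = x (j + (i + 1) * k)"
    proof -
      define z where "z = i * k"
      have "i * 1 \<le> z" unfolding z_def using k by (intro mult_le_mono2) simp
      moreover have "(i + 1) * k = k + z" by (simp add: z_def)
      ultimately have "i + k + (j + (i + 1) * k - (i + k)) = j + (i + 1) * k" by simp
      then show ?thesis using eq[of "j + (i + 1) * k - (i + k)"] by (simp only:)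
    qed
    then show ?thesis unfolding per[OF y] per[OF x] by simp
  qed
  then have "y u0 = x" by blast
  then show ?thesis using below that by blast
qed


text \<open>
  By \<open>touching_family\<close>, the family is totally ordered and contains all periodic orbits of its type, in
  particular the time shift of \<open>y u\<close> and the translate of \<open>y u\<close> by \<open>r l / k\<close>. Both gain \<open>r l\<close> in \<open>k\<close> steps, so
  neither can lie strictly above the other.
\<close>
lemma symmetric_family:
  fixes y :: "real \<Rightarrow> nat \<Rightarrow> real"
  assumes k: "0 < k" and y: "\<And>u. periodic_orbit k r (y u)"
    and cont: "\<And>j. continuous_on UNIV (\<lambda>u. y u j)" and shift: "\<And>u j. y (u + 1) j = y u j + l"
    and sep: "\<And>u v. y u = y v \<Longrightarrow> u = v"
    and sym: "\<And>t t1. t < t1 \<Longrightarrow> t1 < t + l \<Longrightarrow> a (t + of_int r * l / k) (t1 + of_int r * l / k) = a t t1"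
      "\<And>t t1. t < t1 \<Longrightarrow> t1 < t + l \<Longrightarrow> b (t + of_int r * l / k) (t1 + of_int r * l / k) = b t t1"
  shows "y u (Suc j) = y u j + of_int r * l / k"
proof -
  define c where "c = of_int r * l / k"
  have ordered: "y u j < y v j" if "u < v" for u v j
  proof -
    obtain v' where v': "y v' = y v" "\<And>u j. u < v' \<Longrightarrow> y u j < y v j"
      using touching_family[OF k y y cont shift, of v] by metis
    then show ?thesis using sep that by blast
  qed
  have "periodic_orbit k r (\<lambda>j. y u (Suc j))" for u
    using y[of u] unfolding periodic_orbit_def by (metis add_Suc)
  then obtain s where s: "y s = (\<lambda>j. y u (Suc j))"
    using touching_family[OF k y _ cont shift] by metis
  have "periodic_orbit k r (\<lambda>j. y u j + c)"
    using y[of u] sym by (simp add: periodic_orbit_def c_def)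
  then obtain t where t: "y t = (\<lambda>j. y u j + c)"
    using touching_family[OF k y _ cont shift] by metis
  have "y s j = y t j" for j
  proof (rule ccontr)
    assume "y s j \<noteq> y t j"
    then have "s < t \<or> t < s" by (metis linorder_less_linear)
    moreover have total: "(\<Sum>j<k. y u (Suc j) - y u j) = (\<Sum>j<k. c)"
    proof -
      have "(\<Sum>j<k. y u (Suc j) - y u j) = y u k - y u 0" by (rule sum_lessThan_telescope)
      also have "\<dots> = of_int r * l" using y[of u] by (simp add: periodic_orbit_def) (metis add_0 add_diff_cancel_left')
      finally show ?thesis using k by (simp add: c_def)
    qed
    moreover have "(\<Sum>j<k. y u (Suc j) - y u j) < (\<Sum>j<k. c)" if "s < t"
    proof (rule sum_strict_mono)
      show "y u (Suc j) - y u j < c" for j using ordered[OF that, of j] by (simp add: s t)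
    qed (use k in auto)
    moreover have "(\<Sum>j<k. c) < (\<Sum>j<k. y u (Suc j) - y u j)" if "t < s"
    proof (rule sum_strict_mono)
      show "c < y u (Suc j) - y u j" for j using ordered[OF that, of j] by (simp add: s t)
    qed (use k in auto)
    ultimately show False by auto
  qed
  then show ?thesis using s t by (simp add: c_def)
qed

end

lemma leafwise_translation:
  assumes params: "\<And>\<beta>. \<beta> \<in> \<F> \<Longrightarrow> \<exists>c. rotational_param l \<beta> c"
    and U: "\<And>p. p \<in> U \<longleftrightarrow> p + (of_int m * l, 0) \<in> U"
  shows "leafwise U \<F> (\<lambda>p. p + (of_int m * l, 0)) (\<lambda>p. p - (of_int m * l, 0))"
proof -
  let ?v = "(of_int m * l, 0) :: real \<times> real"
  have "homeomorphism U U (\<lambda>p. p + ?v) (\<lambda>p. p - ?v)"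
  proof (rule homeomorphismI)
    show "(\<lambda>p. p + ?v) ` U \<subseteq> U" using U by blast
    show "(\<lambda>p. p - ?v) ` U \<subseteq> U"
    proof (rule image_subsetI)
      fix p assume "p \<in> U"
      then show "p - ?v \<in> U" using U[of "p - ?v"] by simp
    qed
  qed (auto intro!: continuous_intros)
  moreover have "(\<lambda>p. p + ?v) ` \<beta> = \<beta>" if b: "\<beta> \<in> \<F>" for \<beta>
  proof -
    obtain c where c: "rotational_param l \<beta> c" using params[OF b] by blast
    then have rng: "\<beta> = range c" by (simp add: rotational_param_def)
    have shift: "c u + ?v = c (u + of_int m)" for u using rotational_param_shift[OF c] by simp
    show ?thesis
    proof
      show "(\<lambda>p. p + ?v) ` \<beta> \<subseteq> \<beta>" unfolding rng using shift by auto
      show "\<beta> \<subseteq> (\<lambda>p. p + ?v) ` \<beta>"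
      proof
        fix q assume "q \<in> \<beta>"
        then obtain u where "q = c u" using rng by blast
        then have "q = c (u - of_int m) + ?v" using shift[of "u - of_int m"] by simp
        then show "q \<in> (\<lambda>p. p + ?v) ` \<beta>" unfolding rng by blast
      qed
    qed
  qed
  moreover have "emeasure lborel ((\<lambda>p. p + ?v) ` E) = emeasure lborel E" if "compact E" for E
  proof -
    have "emeasure lborel ((\<lambda>p. p + ?v) ` E) = emeasure (distr lborel borel ((+) ?v)) ((\<lambda>p. p + ?v) ` E)"
      by (simp add: lborel_distr_plus)
    also have "\<dots> = emeasure lborel ((+) ?v -` ((\<lambda>p. p + ?v) ` E))"
      using that by (subst emeasure_distr)
        (auto intro!: borel_compact compact_continuous_image continuous_intros)
    also have "(+) ?v -` ((\<lambda>p. p + ?v) ` E) = E"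
      by (intro set_eqI) (simp add: image_iff add.commute[of _ ?v])
    finally show ?thesis .
  qed
  ultimately show ?thesis by (simp add: leafwise_def)
qed

lemma leafwise_lift:
  assumes l: "0 < l" and g: "leafwise U \<F> g g'" and b: "\<beta> \<in> \<F>" "\<beta> \<subseteq> U" and c: "rotational_param l \<beta> c"
    and deck: "\<And>p. p \<in> U \<Longrightarrow> g (p + (l, 0)) = g p + (l, 0)"
  obtains F where "continuous_on UNIV F" "\<And>u. g (c u) = c (F u)" "\<And>u. F (u + 1) = F u + 1" "strict_mono F"
proof -
  have rng: "range c = \<beta>" and inj: "inj c" and cont: "continuous_on UNIV c"
    and step: "\<And>u. c (u + 1) = c u + (l, 0)"
    using c by (auto simp: rotational_param_def)
  have gb: "g ` \<beta> = \<beta>" using g b by (simp add: leafwise_def)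
  have hom: "homeomorphism U U g g'" using g by (simp add: leafwise_def)
  have cU: "c u \<in> U" for u using rng b by blast
  have "g (c u) \<in> range c" for u using gb rng by blast
  then have "\<forall>u. \<exists>v. g (c u) = c v" by blast
  then obtain F where F: "\<And>u. g (c u) = c (F u)" by metis
  have "continuous_on UNIV (\<lambda>u. g (c u))"
    by (rule continuous_on_compose2[OF _ cont]) (use hom cU in \<open>auto simp: homeomorphism_def\<close>)
  then have contF: "continuous_on UNIV F" using F by (rule continuous_lift[OF l c])
  have perF: "F (u + 1) = F u + 1" for u
  proof -
    have "c (F (u + 1)) = c (F u + 1)" unfolding F[symmetric] step deck[OF cU] by simp
    then show ?thesis by (rule injD[OF inj])
  qed
  have "inj F"
  proof (rule injI)
    fix u v assume "F u = F v"
    then have "g (c u) = g (c v)" using F by simp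
    then have "c u = c v" using hom cU by (metis homeomorphism_apply1)
    then show "u = v" by (rule injD[OF inj])
  qed
  then show ?thesis using that contF F perF strict_mono_lift by blast
qed

context twist
begin

lemma twist_rel_deck: "(p, q) \<in> twist_rel \<Longrightarrow> (p + (l, 0), q + (l, 0)) \<in> twist_rel"
  by (cases p; cases q) (simp add: twist_rel_def a_periodic b_periodic)

text \<open>
  A periodic point of \<open>C\<close> lies on some leaf. The map \<open>g\<close>, which is the \<open>k\<close>-th iterate followed by the
  translation by \<open>- r\<close> turns, fixes this point, so \<open>leaf_map_id\<close> applies to that leaf.
\<close>
theorem rational_curve_gives_periodic_leaf:
  assumes fol: "C1_foliation U \<F>" and U_sub: "U \<subseteq> chord_out ` chords"
    and U_deck: "\<And>t s. (t + l, s) \<in> U \<longleftrightarrow> (t, s) \<in> U"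
    and params: "\<And>\<beta>. \<beta> \<in> \<F> \<Longrightarrow> \<exists>c. rotational_param l \<beta> c"
    and inv: "\<And>\<beta>. \<beta> \<in> \<F> \<Longrightarrow> twist_rel `` \<beta> = \<beta>"
    and C: "rotational_param l C c0" "C \<subseteq> U" "\<And>u. (c0 u, c0 (F0 u)) \<in> twist_rel"
    and rot: "(\<lambda>n. ((F0 ^^ n) 0 - 0) / real n) \<longlonglongrightarrow> of_int r / of_nat k" and k: "0 < k"
  shows "\<exists>c F. rotational_param l (range c) c \<and> continuous_on UNIV F \<and> (\<forall>u. (c u, c (F u)) \<in> twist_rel) \<and>
    (\<forall>u. F (u + 1) = F u + 1) \<and> (\<forall>u. (F ^^ k) u = u + of_int r)"
proof -
  have "\<exists>T T'. homeomorphism (chord_out ` chords) (chord_in ` chords) T T' \<and>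
      (\<forall>p q. (p, q) \<in> twist_rel \<longleftrightarrow> p \<in> chord_out ` chords \<and> q = T p) \<and>
      (\<forall>E. compact E \<longrightarrow> E \<subseteq> chord_out ` chords \<longrightarrow> emeasure lborel (T ` E) = emeasure lborel E)"
    by (rule twist_homeomorphism) blast
  then obtain T T' where T: "homeomorphism (chord_out ` chords) (chord_in ` chords) T T'"
    and T_rel_iff: "\<forall>p q. (p, q) \<in> twist_rel \<longleftrightarrow> p \<in> chord_out ` chords \<and> q = T p"
    and T_area: "\<forall>E. compact E \<longrightarrow> E \<subseteq> chord_out ` chords \<longrightarrow> emeasure lborel (T ` E) = emeasure lborel E"
    by (elim exE conjE)
  have part: "partition_on U \<F>" using fol by (simp add: C1_foliation_def)
  have leaf_sub: "\<beta> \<subseteq> U" if "\<beta> \<in> \<F>" for \<beta> using part that by (auto simp: partition_on_def)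
  have mem: "(p, q) \<in> twist_rel \<longleftrightarrow> q = T p" if "p \<in> U" for p q
    using T_rel_iff subsetD[OF U_sub that] by blast
  have Tleaf: "T ` \<beta> = \<beta>" if b: "\<beta> \<in> \<F>" for \<beta>
  proof -
    have "twist_rel `` \<beta> = T ` \<beta>" 
      using mem subsetD[OF leaf_sub[OF b]] by (intro set_eqI) (simp add: Image_iff image_iff Bex_def cong: conj_cong)
    then show ?thesis using inv[OF b] by simp
  qed
  have TU: "T ` U = U"
  proof -
    have "U = \<Union>\<F>" using part by (simp add: partition_on_def)
    then show ?thesis using Tleaf by (simp add: image_Union)
  qed
  have homT: "homeomorphism U U T T'"
  proof (rule homeomorphism_of_subsets[OF T])
    show "U \<subseteq> chord_in ` chords" using TU U_sub T by (metis homeomorphism_image1 image_mono)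
  qed (use U_sub TU in auto)
  have lwT: "leafwise U \<F> T T'"
    using homT Tleaf T_area U_sub by (auto simp: leafwise_def)
  have T_rel: "(p, T p) \<in> twist_rel" if "p \<in> U" for p using mem[OF that] by simp
  have T_deck: "T (p + (l, 0)) = T p + (l, 0)" if "p \<in> U" for p
    using twist_rel_deck[OF T_rel[OF that]] T_rel_iff[rule_format, of "p + (l, 0)" "T p + (l, 0)"] by simp
  have U_deck': "p \<in> U \<longleftrightarrow> p + (of_int m * l, 0) \<in> U" for p m
  proof -
    have "((fst p + of_int m * l, snd p) \<in> U) = ((fst p, snd p) \<in> U)"
      by (rule periodic_int[where f = "\<lambda>t. (t, snd p) \<in> U"]) (rule U_deck)
    then show ?thesis by (cases p) simp
  qed
  have TkU: "(T ^^ j) p \<in> U" if "p \<in> U" for p j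
    by (induction j) (use that TU in auto)
  have Tk_deck: "(T ^^ j) (p + (l, 0)) = (T ^^ j) p + (l, 0)" if "p \<in> U" for p j
    by (induction j) (use T_deck TkU[OF that] in auto)

  have cont0: "continuous_on UNIV c0" and inj0: "inj c0" and step0: "\<And>u. c0 (u + 1) = c0 u + (l, 0)"
    and rng0: "range c0 = C"
    using C(1) by (auto simp: rotational_param_def)
  have c0U: "c0 u \<in> U" for u using C(2) rng0 by blast
  have Tc0: "T (c0 u) = c0 (F0 u)" for u using C(3)[of u] mem[OF c0U] by simp
  have "continuous_on UNIV (\<lambda>u. T (c0 u))"
    by (rule continuous_on_compose2[OF _ cont0]) (use homT c0U in \<open>auto simp: homeomorphism_def\<close>)
  then have contF0: "continuous_on UNIV F0" using Tc0 by (rule continuous_lift[OF l_pos C(1)])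
  have perF0: "F0 (u + 1) = F0 u + 1" for u
  proof -
    have "c0 (F0 (u + 1)) = c0 (F0 u + 1)" unfolding Tc0[symmetric] step0 T_deck[OF c0U] by simp
    then show ?thesis by (rule injD[OF inj0])
  qed
  obtain v where v: "(F0 ^^ k) v = v + of_int r"
    using periodic_point_of_rational_rotation[OF contF0 perF0 rot k] by blast
  have "(T ^^ j) (c0 u) = c0 ((F0 ^^ j) u)" for j u by (induction j) (simp_all add: Tc0)
  then have Tkv: "(T ^^ k) (c0 v) = c0 v + (of_int r * l, 0)"
    using v rotational_param_shift[OF C(1)] by simp

  obtain \<alpha> where \<alpha>: "\<alpha> \<in> \<F>" "c0 v \<in> \<alpha>" using part c0U[of v] by (auto simp: partition_on_def)
  obtain c where c: "rotational_param l \<alpha> c" using params[OF \<alpha>(1)] by blast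
  have rng: "range c = \<alpha>" and inj: "inj c" using c by (auto simp: rotational_param_def)
  have cU: "c u \<in> U" for u using rng leaf_sub[OF \<alpha>(1)] by blast
  obtain F where F: "continuous_on UNIV F" "\<And>u. T (c u) = c (F u)" "\<And>u. F (u + 1) = F u + 1"
    using leafwise_lift[OF l_pos lwT \<alpha>(1) leaf_sub[OF \<alpha>(1)] c T_deck] by metis
  have TkF: "(T ^^ j) (c u) = c ((F ^^ j) u)" for j u by (induction j) (simp_all add: F(2))
  let ?s = "\<lambda>p. p + (of_int (- r) * l, 0) :: real \<times> real"
  define g where "g = ?s \<circ> (T ^^ k)"
  define g' where "g' = (T' ^^ k) \<circ> (\<lambda>p. p - (of_int (- r) * l, 0))"
  have lwg: "leafwise U \<F> g g'"
    unfolding g_def g'_def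
    by (rule leafwise_compose[OF leafwise_funpow[OF lwT] leafwise_translation[OF params U_deck']])
  have lwg': "leafwise U \<F> g' g" using lwg leaf_sub by (rule leafwise_inverse)
  have homg: "homeomorphism U U g g'" using lwg by (simp add: leafwise_def)
  have g_deck: "g (p + (l, 0)) = g p + (l, 0)" if "p \<in> U" for p
    using Tk_deck[OF that] by (simp add: g_def)
  have deckU: "p + (l, 0) \<in> U" if "p \<in> U" for p using U_deck'[of p 1] that by simp
  have g'_deck: "g' (p + (l, 0)) = g' p + (l, 0)" if "p \<in> U" for p
  proof -
    have q: "g' p \<in> U" "g (g' p) = p" using homg that by (auto simp: homeomorphism_def)
    have "g' (p + (l, 0)) = g' (g (g' p + (l, 0)))" using g_deck[OF q(1)] q(2) by simp
    also have "\<dots> = g' p + (l, 0)" using homeomorphism_apply1[OF homg deckU[OF q(1)]] .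
    finally show ?thesis .
  qed
  obtain G where G: "continuous_on UNIV G" "\<And>u. g (c u) = c (G u)" "strict_mono G"
    using leafwise_lift[OF l_pos lwg \<alpha>(1) leaf_sub[OF \<alpha>(1)] c g_deck] by metis
  obtain G' where G': "continuous_on UNIV G'" "\<And>u. g' (c u) = c (G' u)" "strict_mono G'"
    using leafwise_lift[OF l_pos lwg' \<alpha>(1) leaf_sub[OF \<alpha>(1)] c g'_deck] by metis
  have GG': "G (G' u) = u" for u
    using homeomorphism_apply2[OF homg cU[of u]] G(2) G'(2) injD[OF inj] by metis
  have G'G: "G' (G u) = u" for u
    using homeomorphism_apply1[OF homg cU[of u]] G(2) G'(2) injD[OF inj] by metis
  obtain u1 where u1: "c0 v = c u1" using \<alpha>(2) rng by blast
  have "g (c u1) = c u1" using Tkv by (simp add: g_def u1[symmetric] prod_eq_iff)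
  then have fix1: "G u1 = u1" using G(2) injD[OF inj] by metis
  have "G u = u" for u
    by (rule leaf_map_id[OF l_pos fol params lwg \<alpha>(1) c G(3,1,2) G'(3,1) GG' G'G fix1])
  then have gc: "g (c u) = c u" for u using G(2) by simp
  have "(T ^^ k) (c u) = c u + (of_int r * l, 0)" for u
    using gc[of u] by (auto simp: g_def prod_eq_iff)
  then have "c ((F ^^ k) u) = c (u + of_int r)" for u
    using TkF rotational_param_shift[OF c] by simp
  then have "(F ^^ k) u = u + of_int r" for u using injD[OF inj] by blast
  moreover have "(c u, c (F u)) \<in> twist_rel" for u using T_rel[OF cU[of u]] F(2) by simp
  ultimately show ?thesis using c rng F(1,3) by blast
qed

text \<open>
  By \<open>symmetric_family\<close> all orbits on the curve advance by \<open>r l / k\<close> in each step. The balance of momenta at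
  the second vertex, moved back by the symmetry, is the equation for the first side; every \<open>t\<close> occurs,
  because the curve winds around the cylinder.
\<close>
theorem symmetric_rational_curve_regular:
  assumes c: "rotational_param l (range c) c" and F: "continuous_on UNIV F" "\<And>u. (c u, c (F u)) \<in> twist_rel"
    "\<And>u. F (u + 1) = F u + 1" "\<And>u. (F ^^ k) u = u + of_int r" and k: "0 < k"
    and sym: "\<And>t t1. t < t1 \<Longrightarrow> t1 < t + l \<Longrightarrow> a (t + of_int r * l / k) (t1 + of_int r * l / k) = a t t1"
      "\<And>t t1. t < t1 \<Longrightarrow> t1 < t + l \<Longrightarrow> b (t + of_int r * l / k) (t1 + of_int r * l / k) = b t t1"
  shows "0 < of_int r * l / k" "of_int r * l / k < l" "b t (t + of_int r * l / k) = a t (t + of_int r * l / k)"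
proof -
  define w where "w = of_int r * l / k"
  have cont: "continuous_on UNIV c" and inj: "inj c" and step: "\<And>u. c (u + 1) = c u + (l, 0)"
    using c by (auto simp: rotational_param_def)
  define y where "y = (\<lambda>u j. fst (c ((F ^^ j) u)))"
  have rel: "fst (c u) < fst (c (F u))" "fst (c (F u)) < fst (c u) + l"
    "snd (c u) = a (fst (c u)) (fst (c (F u)))" "snd (c (F u)) = b (fst (c u)) (fst (c (F u)))" for u
    using F(2)[of u] by (auto simp: twist_rel_def case_prod_unfold)
  have orbit: "periodic_orbit k r (y u)" for u
    unfolding periodic_orbit_def
  proof (intro allI conjI)
    fix j
    show "y u j < y u (Suc j)" "y u (Suc j) < y u j + l" using rel(1,2) by (simp_all add: y_def)
    show "b (y u j) (y u (Suc j)) = a (y u (Suc j)) (y u (Suc (Suc j)))"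
      using rel(4)[of "(F ^^ j) u"] rel(3)[of "F ((F ^^ j) u)"] by (simp add: y_def)
    have "c ((F ^^ (j + k)) u) = c ((F ^^ (k + j)) u)" by (simp only: add.commute)
    also have "\<dots> = c ((F ^^ j) u + of_int r)" by (simp only: funpow_add comp_apply F(4))
    finally show "y u (j + k) = y u j + of_int r * l"
      using rotational_param_shift[OF c] by (simp add: y_def)
  qed
  have conty: "continuous_on UNIV (\<lambda>u. y u j)" for j
    unfolding y_def by (intro continuous_on_fst continuous_on_compose2[OF cont continuous_on_funpow[OF F(1)]]) simp
  have Fj1: "(F ^^ j) (u + 1) = (F ^^ j) u + 1" for j u by (induction j) (simp_all add: F(3))
  have shifty: "y (u + 1) j = y u j + l" for u j by (simp add: y_def Fj1 step)
  have sep: "u = v" if "y u = y v" for u v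
  proof -
    have "fst (c u) = fst (c v)" "fst (c (F u)) = fst (c (F v))"
      using fun_cong[OF that, of 0] fun_cong[OF that, of 1] by (simp_all add: y_def)
    then have "c u = c v" using rel(3)[of u] rel(3)[of v] by (simp add: prod_eq_iff)
    then show ?thesis by (rule injD[OF inj])
  qed
  have y_step: "y u (Suc j) = y u j + w" for u j
    unfolding w_def by (rule symmetric_family[OF k orbit conty shifty sep sym])
  show w_bounds: "0 < of_int r * l / k" "of_int r * l / k < l"
    using orbit[of 0] y_step[of 0 0] by (auto simp: periodic_orbit_def w_def dest!: spec[of _ 0])
  have "\<exists>u. fst (c u) = t" for t
  proof -
    obtain B where B: "\<And>u. \<bar>fst (c u) - l * u\<bar> \<le> B" using rotational_param_proper[OF c] by blast
    have le: "fst (c ((t - B) / l)) \<le> t" "t \<le> fst (c ((t + B) / l))"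
      using B[of "(t - B) / l"] B[of "(t + B) / l"] l_pos by (simp_all add: abs_le_iff)
    have conn: "connected (range (\<lambda>u. fst (c u)))"
      by (intro connected_continuous_image continuous_on_fst cont) simp
    have "t \<in> range (\<lambda>u. fst (c u))" by (rule connectedD_interval[OF conn _ _ le]) auto
    then show ?thesis by auto
  qed
  then obtain u where u: "fst (c u) = t" by blast
  have y0: "y u 0 = t" by (simp add: y_def u)
  have y1: "y u (Suc 0) = t + w" "y u (Suc (Suc 0)) = t + w + w" by (simp_all only: y_step y0)
  have "b (y u 0) (y u (Suc 0)) = a (y u (Suc 0)) (y u (Suc (Suc 0)))"
    using orbit[of u] by (auto simp: periodic_orbit_def)
  then have "b t (t + w) = a (t + w) (t + w + w)" by (simp only: y0 y1)
  also have "\<dots> = a t (t + w)" unfolding w_def by (rule sym) (use w_bounds in auto)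
  finally show "b t (t + of_int r * l / k) = a t (t + of_int r * l / k)" by (simp add: w_def)
qed

end

section \<open>The gauge of a strictly convex curve\<close>

lemma cross2_inner: "cross2 x y = x \<bullet> vector [y $ 2, - y $ 1]"
  by (simp add: cross2_def inner_vec_def sum_2)

lemma cross2_minus_perp: "cross2 v (vector [v $ 2, - v $ 1]) = - (v \<bullet> v)"
  by (simp add: cross2_def inner_vec_def sum_2)

lemma continuous_on_cross2 [continuous_intros]:
  assumes "continuous_on S f" "continuous_on S g"
  shows "continuous_on S (\<lambda>x. cross2 (f x) (g x))"
  unfolding cross2_def using assms by (intro continuous_intros)

lemma cross2_eq_0_parallel:
  assumes "cross2 x y = 0" "y \<noteq> 0"
  obtains c where "x = c *\<^sub>R y"
proof -
  have eq: "x $ 1 * y $ 2 = x $ 2 * y $ 1" using assms(1) by (simp add: cross2_def)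
  have "y $ 1 \<noteq> 0 \<or> y $ 2 \<noteq> 0" using assms(2) by (auto simp: vec_eq_iff forall_2)
  then show ?thesis
  proof
    assume "y $ 1 \<noteq> 0"
    then show ?thesis using eq by (intro that[of "x $ 1 / y $ 1"]) (auto simp: vec_eq_iff forall_2 field_simps)
  next
    assume "y $ 2 \<noteq> 0"
    then show ?thesis using eq by (intro that[of "x $ 2 / y $ 2"]) (auto simp: vec_eq_iff forall_2 field_simps)
  qed
qed

text \<open>
  In Caratheodory's form, the difference quotient of \<open>\<sigma>\<close> is the quotient of two continuous functions.
\<close>
lemma has_real_derivative_inverse_comp:
  fixes F \<sigma> :: "real \<Rightarrow> real"
  assumes "(F has_real_derivative D) (at (\<sigma> t))" "((\<lambda>s. F (\<sigma> s)) has_real_derivative E) (at t)"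
    "D \<noteq> 0" "isCont \<sigma> t"
  shows "(\<sigma> has_real_derivative E / D) (at t)"
proof -
  obtain G where G: "\<And>z. F z - F (\<sigma> t) = G z * (z - \<sigma> t)" "isCont G (\<sigma> t)" "G (\<sigma> t) = D"
    using assms(1) by (auto simp: CARAT_DERIV)
  obtain H where H: "\<And>z. F (\<sigma> z) - F (\<sigma> t) = H z * (z - t)" "isCont H t" "H t = E"
    using assms(2) by (auto simp: CARAT_DERIV)
  have GH: "G (\<sigma> z) * (\<sigma> z - \<sigma> t) = H z * (z - t)" for z
    using G(1)[of "\<sigma> z"] H(1)[of z] by simp
  have cG: "isCont (\<lambda>z. G (\<sigma> z)) t" using assms(4) G(2) by (rule isCont_o2)
  have "\<forall>\<^sub>F z in at t. G (\<sigma> z) \<noteq> 0"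
    using cG assms(3) G(3) by (intro tendsto_imp_eventually_ne) (auto simp: isCont_def)
  moreover have lim: "((\<lambda>z. H z / G (\<sigma> z)) \<longlongrightarrow> E / D) (at t)"
    using cG H(2,3) G(3) assms(3) by (intro tendsto_divide) (auto simp: isCont_def)
  moreover have ev: "\<forall>\<^sub>F z in at t. H z / G (\<sigma> z) = (\<sigma> z - \<sigma> t) / (z - t)"
    using calculation(1) eventually_neq_at_within[of t]
  proof eventually_elim
    case (elim z)
    then show ?case using GH[of z] by (simp add: frac_eq_eq mult.commute)
  qed
  have "((\<lambda>z. (\<sigma> z - \<sigma> t) / (z - t)) \<longlongrightarrow> E / D) (at t)"
    using lim ev by (rule Lim_transform_eventually)
  then show ?thesis by (simp add: has_field_derivative_iff)
qed

text \<open>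
  The function \<open>\<gamma>1\<close> is the velocity of \<open>\<gamma>\<close>.
\<close>
locale gauge_curve =
  fixes \<Gamma> :: "(real^2) set" and \<gamma> \<gamma>1 :: "real \<Rightarrow> real^2" and l :: real
  assumes sc: "strictly_convex_curve \<Gamma>"
    and l_pos: "0 < l" and periodic: "\<And>t. \<gamma> (t + l) = \<gamma> t" and inj: "inj_on \<gamma> {0..<l}"
    and range: "range \<gamma> = \<Gamma>"
    and deriv: "\<And>t. (\<gamma> has_vector_derivative \<gamma>1 t) (at t)"
    and cont_\<gamma>1: "continuous_on UNIV \<gamma>1" and \<gamma>1_nz: "\<And>t. \<gamma>1 t \<noteq> 0"
    and unit: "\<And>t. gauge_function (inside \<Gamma>) (\<gamma>1 t) = 1"
    and ccw: "\<And>t p. p \<in> inside \<Gamma> \<Longrightarrow> 0 < cross2 (\<gamma>1 t) (p - \<gamma> t)"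

lemma gauge_curveI:
  assumes "strictly_convex_curve \<Gamma>" "gauge_arclength_param \<Gamma> \<gamma> l"
  obtains \<gamma>1 where "gauge_curve \<Gamma> \<gamma> \<gamma>1 l"
proof -
  have param: "C2_closed_param \<gamma> l" "range \<gamma> = \<Gamma>"
    "\<And>t. gauge_function (inside \<Gamma>) (vector_derivative \<gamma> (at t)) = 1"
    "\<And>t p. p \<in> inside \<Gamma> \<Longrightarrow> 0 < cross2 (vector_derivative \<gamma> (at t)) (p - \<gamma> t)"
    using assms(2) by (auto simp: gauge_arclength_param_def)
  obtain \<gamma>1 \<gamma>2 where d: "\<And>t. (\<gamma> has_vector_derivative \<gamma>1 t) (at t)"
    "\<And>t. (\<gamma>1 has_vector_derivative \<gamma>2 t) (at t)" "\<And>t. \<gamma>1 t \<noteq> 0"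
    using param(1) by (auto simp: C2_closed_param_def)
  have vd: "vector_derivative \<gamma> (at t) = \<gamma>1 t" for t
    by (rule vector_derivative_at[OF d(1)])
  have "continuous_on UNIV \<gamma>1"
    using d(2) by (intro continuous_at_imp_continuous_on) (auto intro: has_vector_derivative_continuous)
  then have "gauge_curve \<Gamma> \<gamma> \<gamma>1 l"
    using assms(1) param d unfolding vd by unfold_locales (auto simp: C2_closed_param_def)
  then show ?thesis by (rule that)
qed

context gauge_curve
begin

abbreviation "K \<equiv> inside \<Gamma>"
abbreviation "S \<equiv> \<Gamma> \<union> inside \<Gamma>"

lemma cont_\<gamma>: "continuous_on A \<gamma>"
  using deriv by (intro continuous_at_imp_continuous_on) (auto intro: has_vector_derivative_continuous)

lemma \<gamma>_int: "\<gamma> (t + of_int n * l) = \<gamma> t"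
  using periodic by (rule periodic_int[where f = \<gamma>])

lemma \<gamma>_eq_iff: "\<gamma> s = \<gamma> t \<longleftrightarrow> (\<exists>n::int. s = t + of_int n * l)"
proof
  assume eq: "\<gamma> s = \<gamma> t"
  have red: "\<gamma> t = \<gamma> (t - of_int \<lfloor>t / l\<rfloor> * l)" "t - of_int \<lfloor>t / l\<rfloor> * l \<in> {0..<l}" for t
  proof -
    show "\<gamma> t = \<gamma> (t - of_int \<lfloor>t / l\<rfloor> * l)"
      using \<gamma>_int[of "t - of_int \<lfloor>t / l\<rfloor> * l" "\<lfloor>t / l\<rfloor>"] by simp
    show "t - of_int \<lfloor>t / l\<rfloor> * l \<in> {0..<l}"
      using floor_divide_lower[OF l_pos, of t] floor_divide_upper[OF l_pos, of t] by (simp add: algebra_simps)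
  qed
  have "s - of_int \<lfloor>s / l\<rfloor> * l = t - of_int \<lfloor>t / l\<rfloor> * l"
    using inj red[of s] red[of t] eq by (metis inj_onD)
  then have "s = t + of_int (\<lfloor>s / l\<rfloor> - \<lfloor>t / l\<rfloor>) * l" by (simp add: algebra_simps)
  then show "\<exists>n::int. s = t + of_int n * l" by blast
qed (use \<gamma>_int in auto)

lemma \<gamma>_neq: "\<gamma> s \<noteq> \<gamma> t" if "t < s" "s < t + l"
proof
  assume "\<gamma> s = \<gamma> t"
  then obtain n :: int where n: "s = t + of_int n * l" using \<gamma>_eq_iff by blast
  then have "0 < of_int n * l" "of_int n * l < 1 * l" using that by auto
  then have "0 < real_of_int n" "real_of_int n < 1"
    using l_pos zero_less_mult_pos2 mult_less_cancel_right_pos by blast+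
  then show False by simp
qed

lemma \<Gamma>_eq: "\<Gamma> = \<gamma> ` {0..l}"
proof -
  have "\<gamma> t \<in> \<gamma> ` {0..l}" for t
  proof -
    have "t - of_int \<lfloor>t / l\<rfloor> * l \<in> {0..l}"
      using floor_divide_lower[OF l_pos, of t] floor_divide_upper[OF l_pos, of t] by (simp add: algebra_simps)
    moreover have "\<gamma> t = \<gamma> (t - of_int \<lfloor>t / l\<rfloor> * l)"
      using \<gamma>_int[of "t - of_int \<lfloor>t / l\<rfloor> * l" "\<lfloor>t / l\<rfloor>"] by simp
    ultimately show ?thesis by blast
  qed
  then show ?thesis using range by auto
qed

lemma compact_\<Gamma>: "compact \<Gamma>"
  unfolding \<Gamma>_eq by (intro compact_continuous_image cont_\<gamma>) simp

lemma \<gamma>_in [simp]: "\<gamma> t \<in> \<Gamma>"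
  using range by auto

lemma open_segment_interior:
  assumes "x \<in> S" "y \<in> S" "x \<noteq> y"
  shows "open_segment x y \<subseteq> interior S"
  using sc assms unfolding strictly_convex_curve_def strictly_convex_def by blast

lemma compact_S: "compact S"
proof -
  have "closed S"
    using open_outside[OF compact_imp_closed[OF compact_\<Gamma>]] by (simp add: union_with_inside closed_def)
  moreover have "bounded S"
    using compact_\<Gamma> by (simp add: bounded_inside compact_imp_bounded)
  ultimately show ?thesis by (simp add: compact_eq_bounded_closed)
qed

lemma convex_S: "convex S"
  unfolding convex_contains_open_segment
proof (intro ballI)
  fix x y assume "x \<in> S" "y \<in> S"
  then show "open_segment x y \<subseteq> S"
    using open_segment_interior[of x y] interior_subset[of S] by (cases "x = y") auto
qed

lemma open_K: "open K"
  using compact_\<Gamma> by (simp add: compact_imp_closed open_inside)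

text \<open>
  Near a point of the curve that is interior to \<open>S\<close>, the part of \<open>S\<close> to the right of the tangent
  would have interior points. It is disjoint from \<open>K\<close>, hence contained in the curve, which is negligible
  as a differentiable image of a line.
\<close>
lemma interior_S: "interior S = K"
proof
  show "K \<subseteq> interior S" using open_K by (simp add: interior_maximal)
  have "\<gamma> t \<notin> interior S" for t
  proof
    assume t: "\<gamma> t \<in> interior S"
    define H where "H = {x. cross2 (\<gamma>1 t) (x - \<gamma> t) < 0}"
    have "open H" unfolding H_def
      by (intro open_Collect_less continuous_intros)
    then have op: "open (interior S \<inter> H)" by (intro open_Int) auto
    have "interior S \<inter> H \<subseteq> \<Gamma>"
    proof
      fix x assume x: "x \<in> interior S \<inter> H"
      then have "x \<notin> K" using ccw[of x t] by (auto simp: H_def)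
      moreover have "x \<in> S" using x interior_subset by blast
      ultimately show "x \<in> \<Gamma>" by blast
    qed
    moreover have "negligible \<Gamma>"
      unfolding range[symmetric]
    proof (rule negligible_differentiable_image_lowdim)
      show "\<gamma> differentiable_on UNIV"
        using deriv unfolding differentiable_on_def
        by (meson differentiableI_vector)
    qed simp
    ultimately have "negligible (interior S \<inter> H)" by (rule negligible_subset[rotated])
    then have empty: "interior S \<inter> H = {}" using op open_not_negligible by blast
    \<comment> \<open>w points to the right of the tangent\<close>
    define w :: "real^2" where "w = vector [\<gamma>1 t $ 2, - \<gamma>1 t $ 1]"
    have "((\<lambda>e. \<gamma> t + e *\<^sub>R w) \<longlongrightarrow> \<gamma> t + 0 *\<^sub>R w) (at_right 0)"
      by (intro tendsto_intros)
    then have "\<forall>\<^sub>F e in at_right 0. \<gamma> t + e *\<^sub>R w \<in> interior S"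
      using t by (intro topological_tendstoD) auto
    then have "\<forall>\<^sub>F e in at_right 0. \<gamma> t + e *\<^sub>R w \<in> interior S \<and> 0 < e"
      using eventually_at_right_less[of 0] by eventually_elim auto
    then obtain e where e: "\<gamma> t + e *\<^sub>R w \<in> interior S" "0 < e"
      using eventually_happens trivial_limit_at_right_real by blast
    have "\<gamma> t + e *\<^sub>R w \<in> H"
      using e(2) \<gamma>1_nz by (simp add: H_def cross2_simps w_def cross2_minus_perp)
    then show False using e empty by blast
  qed
  then show "interior S \<subseteq> K" using interior_subset[of S] range by blast
qed

lemma frontier_S: "frontier S = \<Gamma>"
  using inside_no_overlap[of \<Gamma>]
  unfolding frontier_def interior_S closure_closed[OF compact_imp_closed[OF compact_S]] by blast

lemma convex_K: "convex K"
  using convex_interior[OF convex_S] by (simp add: interior_S)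

lemma K_nonempty: "K \<noteq> {}"
proof -
  have "\<gamma> (l / 2) \<noteq> \<gamma> 0" using \<gamma>_neq[of 0 "l / 2"] l_pos by simp
  then have "open_segment (\<gamma> (l / 2)) (\<gamma> 0) \<subseteq> K" "open_segment (\<gamma> (l / 2)) (\<gamma> 0) \<noteq> {}"
    using open_segment_interior[of "\<gamma> (l / 2)" "\<gamma> 0"] interior_S by auto
  then show ?thesis by blast
qed

lemma K_\<Gamma>_disjoint: "x \<in> K \<Longrightarrow> x \<notin> \<Gamma>"
  using inside_no_overlap[of \<Gamma>] by blast

text \<open>
  The closed region is the convex hull of its frontier.
\<close>
lemma linear_image_K:
  assumes "linear A" "inj A" "A ` \<Gamma> = \<Gamma>"
  shows "A ` K = K"
proof -
  have hull: "S = convex hull \<Gamma>"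
    using Krein_Milman_frontier[OF convex_S compact_S] by (simp add: frontier_S)
  have "A ` S = S"
    using hull convex_hull_linear_image[OF assms(1), of \<Gamma>] assms(3) by simp
  then show ?thesis
    using interior_injective_linear_image[OF assms(1,2), of S] interior_S by simp
qed

text \<open>
  The average over an orbit of \<open>A\<close> in \<open>K\<close> is fixed by \<open>A\<close>, and \<open>A\<close> fixes only 0.
\<close>
lemma origin_in_K:
  assumes "linear A" "has_order A k" "k \<ge> 3" "A ` \<Gamma> = \<Gamma>"
  shows "0 \<in> K"
proof -
  have k: "A ^^ k = id" "0 < k" using assms(2) by (auto simp: has_order_def)
  have "inj A" by (rule has_order_inj[OF assms(2)])
  then have AK: "A ` K = K" using linear_image_K assms by blast
  obtain p where p: "p \<in> K" using K_nonempty by blast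
  have orbit: "(A ^^ j) p \<in> K" for j
    by (induction j) (use p AK in auto)
  define q where "q = (\<Sum>j<k. (1 / real k) *\<^sub>R (A ^^ j) p)"
  have "q \<in> K" unfolding q_def
    by (rule convex_sum[OF _ convex_K]) (use orbit k in auto)
  have "A q = (\<Sum>j<k. (1 / real k) *\<^sub>R (A ^^ Suc j) p)"
    by (simp add: q_def linear_sum[OF assms(1)] linear_scale[OF assms(1)])
  also have "\<dots> = (1 / real k) *\<^sub>R (\<Sum>j<k. (A ^^ Suc j) p)" by (simp add: scaleR_sum_right)
  also have "(\<Sum>j<k. (A ^^ Suc j) p) = (\<Sum>j<k. (A ^^ j) p)"
    using sum.lessThan_Suc_shift[of "\<lambda>j. (A ^^ j) p" k] k by (simp add: sum.lessThan_Suc)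
  also have "(1 / real k) *\<^sub>R (\<Sum>j<k. (A ^^ j) p) = q" by (simp add: q_def scaleR_sum_right)
  finally have "A q = q" .
  then have "q = 0" using finite_order_plane[OF assms(1-3)] by metis
  then show ?thesis using \<open>q \<in> K\<close> by simp
qed

end

locale centred_gauge_curve = gauge_curve +
  assumes origin: "0 \<in> K"
begin

abbreviation g :: "real^2 \<Rightarrow> real" where "g \<equiv> gauge_function K"

text \<open>
  By strict convexity, the midpoint of \<open>p\<close> and \<open>\<gamma> t\<close> lies in \<open>K\<close>.
\<close>
lemma ccw_curve: "0 < cross2 (\<gamma>1 t) (p - \<gamma> t)" if "p \<in> \<Gamma>" "p \<noteq> \<gamma> t"
proof -
  have "midpoint p (\<gamma> t) \<in> open_segment p (\<gamma> t)" using that by simp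
  then have "midpoint p (\<gamma> t) \<in> K"
    using open_segment_interior[of p "\<gamma> t"] that interior_S by auto
  then have "0 < cross2 (\<gamma>1 t) (midpoint p (\<gamma> t) - \<gamma> t)" by (rule ccw)
  also have "midpoint p (\<gamma> t) - \<gamma> t = (1 / 2) *\<^sub>R (p - \<gamma> t)"
    by (simp add: midpoint_def vec_eq_iff field_simps)
  finally show ?thesis by (simp add: cross2_simps)
qed

text \<open>
  The curve is a quotient of a compact interval: the preimage of a closed set under \<open>F\<close> is the image
  of a compact set of parameters.
\<close>
lemma descends_to_curve:
  fixes f :: "real \<Rightarrow> 'b::topological_space"
  assumes cont: "continuous_on UNIV f" and per: "\<And>t. f (t + l) = f t"
  obtains F where "continuous_on \<Gamma> F" "\<And>t. F (\<gamma> t) = f t"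
proof -
  define F where "F = (\<lambda>z. f (SOME t. \<gamma> t = z))"
  have F: "F (\<gamma> t) = f t" for t
  proof -
    have "\<gamma> (SOME s. \<gamma> s = \<gamma> t) = \<gamma> t" by (rule someI[where x = t]) simp
    then obtain n :: int where "(SOME s. \<gamma> s = \<gamma> t) = t + of_int n * l"
      using \<gamma>_eq_iff by blast
    moreover have "f (t + of_int n * l) = f t" using per by (rule periodic_int[where f = f])
    ultimately show ?thesis by (simp add: F_def)
  qed
  have "continuous_on \<Gamma> F"
    unfolding continuous_on_closed_vimage[OF compact_imp_closed[OF compact_\<Gamma>]]
  proof (intro allI impI)
    fix B :: "'b set" assume B: "closed B"
    have "F -` B \<inter> \<Gamma> = \<gamma> ` ({0..l} \<inter> f -` B)"
      using F by (auto simp: \<Gamma>_eq)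
    moreover have "compact ({0..l} \<inter> f -` B)"
      using closed_vimage[OF B cont] by (intro compact_Int_closed) auto
    ultimately show "closed (F -` B \<inter> \<Gamma>)"
      by (metis compact_continuous_image cont_\<gamma> compact_imp_closed)
  qed
  then show ?thesis using F that by blast
qed

lemma \<gamma>1_periodic: "\<gamma>1 (t + l) = \<gamma>1 t"
proof -
  have "((\<lambda>s. \<gamma> (s + l)) has_vector_derivative 1 *\<^sub>R \<gamma>1 (t + l)) (at t)"
    using vector_diff_chain_at[of "\<lambda>s. s + l" 1 t \<gamma> "\<gamma>1 (t + l)"] deriv[of "t + l"]
    by (simp add: comp_def has_vector_derivative_add_const has_vector_derivative_id)
  then show ?thesis using vector_derivative_unique_at[OF _ deriv[of t]] by (simp add: periodic)
qed

text \<open>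
  The covector that vanishes on the tangent vector at \<open>\<gamma> t\<close> and is 1 at \<open>\<gamma> t\<close> itself. The region lies in
  the half plane where it is at most 1, so the gauge is the maximum of these covectors.
\<close>
definition conormal :: "real \<Rightarrow> real^2" where
  "conormal t = (1 / cross2 (\<gamma> t) (\<gamma>1 t)) *\<^sub>R vector [\<gamma>1 t $ 2, - \<gamma>1 t $ 1]"

lemma cross_\<gamma>_\<gamma>1: "0 < cross2 (\<gamma> t) (\<gamma>1 t)"
  using ccw[OF origin, of t] cross2_commute[of "\<gamma>1 t" "\<gamma> t"] by (simp add: cross2_simps)

lemma conormal_inner: "conormal t \<bullet> x = cross2 x (\<gamma>1 t) / cross2 (\<gamma> t) (\<gamma>1 t)"
  by (simp add: conormal_def cross2_inner inner_commute)

lemma conormal_self: "conormal t \<bullet> \<gamma> t = 1"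
  using cross_\<gamma>_\<gamma>1[of t] by (simp add: conormal_inner)

lemma conormal_less: "conormal t \<bullet> p < 1" if "p \<in> \<Gamma>" "p \<noteq> \<gamma> t"
proof -
  have "cross2 p (\<gamma>1 t) < cross2 (\<gamma> t) (\<gamma>1 t)"
    using ccw_curve[OF that] cross2_commute[of "\<gamma>1 t" p] cross2_commute[of "\<gamma>1 t" "\<gamma> t"]
    by (simp add: cross2_simps)
  then show ?thesis using cross_\<gamma>_\<gamma>1[of t] by (simp add: conormal_inner)
qed

lemma ex_normal: "\<exists>\<nu>. continuous_on \<Gamma> \<nu> \<and> (\<forall>t. \<nu> (\<gamma> t) = conormal t)"
proof -
  have "linear (\<lambda>v :: real^2. vector [v $ 2, - v $ 1] :: real^2)"
    by (rule linearI) (simp_all add: vec_eq_iff forall_2)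
  then have "continuous_on UNIV (\<lambda>v :: real^2. vector [v $ 2, - v $ 1] :: real^2)"
    by (intro linear_continuous_on) (simp add: linear_conv_bounded_linear)
  then have "continuous_on UNIV (\<lambda>t. vector [\<gamma>1 t $ 2, - \<gamma>1 t $ 1] :: real^2)"
    using cont_\<gamma>1 by (rule continuous_on_compose2) simp
  then have "continuous_on UNIV conormal"
    unfolding conormal_def using cross_\<gamma>_\<gamma>1
    by (intro continuous_intros cont_\<gamma>1 cont_\<gamma>) (simp add: less_imp_neq[THEN not_sym])
  moreover have "conormal (t + l) = conormal t" for t by (simp add: conormal_def periodic \<gamma>1_periodic)
  ultimately show ?thesis using descends_to_curve[of conormal] by metis
qed

text \<open>
  The conormal as a function of the point of the curve.
\<close>
definition \<nu> :: "real^2 \<Rightarrow> real^2" where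
  "\<nu> = (SOME \<nu>. continuous_on \<Gamma> \<nu> \<and> (\<forall>t. \<nu> (\<gamma> t) = conormal t))"

lemma cont_\<nu>: "continuous_on \<Gamma> \<nu>" and \<nu>_\<gamma>: "\<nu> (\<gamma> t) = conormal t"
  using someI_ex[OF ex_normal] by (auto simp: \<nu>_def)

lemma \<nu>_self: "z \<in> \<Gamma> \<Longrightarrow> \<nu> z \<bullet> z = 1"
  using range conormal_self \<nu>_\<gamma> by (metis rangeE)

lemma \<nu>_less: "z \<in> \<Gamma> \<Longrightarrow> p \<in> \<Gamma> \<Longrightarrow> p \<noteq> z \<Longrightarrow> \<nu> z \<bullet> p < 1"
  using range conormal_less \<nu>_\<gamma> by (metis rangeE)

lemma scaled_in_K_iff:
  assumes z: "z \<in> \<Gamma>" and s: "0 \<le> s"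
  shows "s *\<^sub>R z \<in> K \<longleftrightarrow> s < 1"
proof -
  have z0: "z \<noteq> 0" using z origin K_\<Gamma>_disjoint by blast
  have in_K: "r *\<^sub>R w \<in> K" if "0 \<le> r" "r < 1" "w \<in> S" "w \<noteq> 0" for r w
  proof (cases "r = 0")
    case False
    then have "r *\<^sub>R w \<in> open_segment 0 w" using that by (auto simp: in_segment)
    then show ?thesis using open_segment_interior[of 0 w] that origin interior_S by auto
  qed (use origin in simp)
  show ?thesis
  proof
    show "s *\<^sub>R z \<in> K" if "s < 1" using in_K[of s z] z z0 s that by simp
    show "s < 1" if sz: "s *\<^sub>R z \<in> K"
    proof (rule ccontr)
      assume "\<not> s < 1"
      then consider "s = 1" | "s > 1" by linarith
      then show False
      proof cases
        case 1
        then show False using sz z K_\<Gamma>_disjoint by simp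
      next
        case 2
        then have "(1 / s) *\<^sub>R (s *\<^sub>R z) \<in> K" using in_K[of "1 / s" "s *\<^sub>R z"] sz z0 by simp
        then show False using 2 z K_\<Gamma>_disjoint by simp
      qed
    qed
  qed
qed

lemma gauge_scaled: "g (r *\<^sub>R z) = r" if z: "z \<in> \<Gamma>" and r: "0 < r"
proof -
  have "{q. 0 < q \<and> r *\<^sub>R z \<in> (\<lambda>y. q *\<^sub>R y) ` K} = {r<..}"
  proof (intro set_eqI iffI)
    fix q assume "q \<in> {q. 0 < q \<and> r *\<^sub>R z \<in> (\<lambda>y. q *\<^sub>R y) ` K}"
    then obtain y where q: "0 < q" "r *\<^sub>R z = q *\<^sub>R y" "y \<in> K" by auto
    have "(1 / q) *\<^sub>R (r *\<^sub>R z) = (1 / q) *\<^sub>R (q *\<^sub>R y)" by (simp only: q(2))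
    then have "(r / q) *\<^sub>R z = y" using q(1) by simp
    then have "(r / q) *\<^sub>R z \<in> K" using q(3) by simp
    then have "r / q < 1" using scaled_in_K_iff[OF z, of "r / q"] q r by simp
    then show "q \<in> {r<..}" using q by (simp add: field_simps)
  next
    fix q assume "q \<in> {r<..}"
    then have q: "r < q" by simp
    then have "(r / q) *\<^sub>R z \<in> K" using scaled_in_K_iff[OF z, of "r / q"] r by simp
    moreover have "r *\<^sub>R z = q *\<^sub>R ((r / q) *\<^sub>R z)" using q r by simp
    ultimately have "r *\<^sub>R z \<in> (\<lambda>y. q *\<^sub>R y) ` K" by (rule rev_image_eqI)
    then show "q \<in> {q. 0 < q \<and> r *\<^sub>R z \<in> (\<lambda>y. q *\<^sub>R y) ` K}" using q r by simp
  qed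
  then show ?thesis by (simp add: gauge_function_def)
qed

lemma polar:
  assumes "x \<noteq> 0"
  obtains z where "z \<in> \<Gamma>" "0 < g x" "x = g x *\<^sub>R z"
proof -
  obtain d where d: "0 < d" "0 + d *\<^sub>R x \<in> frontier S"
    using ray_to_frontier[of S 0 x] compact_S origin interior_S assms by (metis compact_imp_bounded)
  then have z: "d *\<^sub>R x \<in> \<Gamma>" by (simp add: frontier_S)
  have "x = (1 / d) *\<^sub>R (d *\<^sub>R x)" using d by simp
  then show ?thesis using gauge_scaled[OF z, of "1 / d"] that[OF z] d by simp
qed

lemma gauge_pos: "x \<noteq> 0 \<Longrightarrow> 0 < g x"
  using polar[of x] by blast

lemma gauge_zero: "g 0 = 0"
proof -
  have "{q. 0 < q \<and> (0::real^2) \<in> (\<lambda>y. q *\<^sub>R y) ` K} = {0<..}"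
    using origin by (auto intro!: image_eqI[of _ _ 0])
  then show ?thesis by (simp add: gauge_function_def)
qed

lemma gauge_homogeneous: "g (r *\<^sub>R x) = r * g x" if "0 \<le> r"
proof (cases "x = 0 \<or> r = 0")
  case False
  then obtain z where z: "z \<in> \<Gamma>" "0 < g x" "x = g x *\<^sub>R z" using polar by metis
  have "g (r *\<^sub>R x) = g ((r * g x) *\<^sub>R z)" using z(3) by (metis scaleR_scaleR)
  then show ?thesis using gauge_scaled[OF z(1), of "r * g x"] z(2) False that by simp
qed (auto simp: gauge_zero)

lemma in_K_iff: "x \<in> K \<longleftrightarrow> g x < 1"
proof (cases "x = 0")
  case False
  then obtain z where z: "z \<in> \<Gamma>" "0 < g x" "x = g x *\<^sub>R z" using False polar[of x] by blast
  then show ?thesis using scaled_in_K_iff[OF z(1), of "g x"] by simp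
qed (simp add: origin gauge_zero)

lemma in_\<Gamma>_iff: "x \<in> \<Gamma> \<longleftrightarrow> g x = 1"
proof (cases "x = 0")
  case False
  then obtain z where z: "z \<in> \<Gamma>" "0 < g x" "x = g x *\<^sub>R z" using False polar[of x] by blast
  then show ?thesis using gauge_scaled[of x 1] by auto
qed (use origin K_\<Gamma>_disjoint in \<open>auto simp: gauge_zero\<close>)

lemma gauge_invariant: "g (A x) = g x" if "linear A" "inj A" "A ` \<Gamma> = \<Gamma>"
proof (cases "x = 0")
  case False
  then obtain z where z: "z \<in> \<Gamma>" "0 < g x" "x = g x *\<^sub>R z" using False polar[of x] by blast
  then have "A x = g x *\<^sub>R A z" using linear_scale[OF that(1)] by metis
  moreover have "A z \<in> \<Gamma>" using that z by blast
  ultimately show ?thesis using gauge_scaled z(2) by metis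
qed (simp add: linear_0[OF that(1)])

text \<open>
  The point where the ray through \<open>x\<close> meets the curve, and the conormal at this point, which is the
  gradient of the gauge at \<open>x\<close> by \<open>gauge_has_gradient\<close>.
\<close>
definition dir :: "real^2 \<Rightarrow> real^2" where "dir x = (1 / g x) *\<^sub>R x"
definition grad :: "real^2 \<Rightarrow> real^2" where "grad x = \<nu> (dir x)"

lemma dir_in: "x \<noteq> 0 \<Longrightarrow> dir x \<in> \<Gamma>"
proof -
  assume "x \<noteq> 0"
  then obtain z where z: "z \<in> \<Gamma>" "0 < g x" "x = g x *\<^sub>R z" using polar[of x] by blast
  have "dir x = (1 / g x) *\<^sub>R (g x *\<^sub>R z)" unfolding dir_def using z(3) by (rule arg_cong)
  also have "\<dots> = z" using z(2) by simp
  finally show ?thesis using z(1) by simp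
qed

lemma dir_scale: "x \<noteq> 0 \<Longrightarrow> x = g x *\<^sub>R dir x"
  using gauge_pos[of x] by (simp add: dir_def)

lemma grad_self: "x \<noteq> 0 \<Longrightarrow> grad x \<bullet> x = g x"
  using \<nu>_self[OF dir_in, of x] dir_scale[of x] by (metis grad_def inner_scaleR_right mult.right_neutral)

lemma grad_less: "grad x \<bullet> y < g y" if "x \<noteq> 0" "y \<noteq> 0" "dir x \<noteq> dir y"
proof -
  have "grad x \<bullet> dir y < 1" unfolding grad_def using that by (intro \<nu>_less dir_in) auto
  moreover have "grad x \<bullet> y = g y * (grad x \<bullet> dir y)" using dir_scale[OF that(2)] by (metis inner_scaleR_right)
  ultimately show ?thesis using gauge_pos[OF that(2)] by simp
qed

lemma grad_le: "grad x \<bullet> y \<le> g y" if "x \<noteq> 0"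
proof (cases "y = 0")
  case False
  show ?thesis
  proof (cases "dir x = dir y")
    case True
    then have "grad x \<bullet> y = g y" using grad_self[OF False] by (simp add: grad_def)
    then show ?thesis by simp
  qed (use grad_less that False in force)
qed (simp add: gauge_zero)

lemma grad_le_diff: "grad x \<bullet> (y - x) \<le> g y - g x" if "x \<noteq> 0"
  using grad_le[OF that, of y] grad_self[OF that] by (simp add: inner_diff_right)

text \<open>
  The gauge is Lipschitz, because its subgradients are bounded.
\<close>
lemma cont_gauge: "continuous_on (- {0}) g"
proof -
  have "bounded (\<nu> ` \<Gamma>)"
    using compact_\<Gamma> cont_\<nu> by (intro compact_imp_bounded compact_continuous_image)
  then obtain B where B: "\<And>z. z \<in> \<Gamma> \<Longrightarrow> norm (\<nu> z) \<le> B" by (auto simp: bounded_iff)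
  have MB: "norm (grad x) \<le> B" if "x \<noteq> 0" for x using B[OF dir_in[OF that]] by (simp add: grad_def)
  have "g y - g x \<le> B * norm (y - x)" if "x \<noteq> 0" "y \<noteq> 0" for x y
  proof -
    have "g y - g x \<le> grad y \<bullet> (y - x)"
      using grad_le_diff[OF that(2), of x] by (simp add: inner_diff_right)
    also have "\<dots> \<le> norm (grad y) * norm (y - x)" by (rule norm_cauchy_schwarz)
    also have "\<dots> \<le> B * norm (y - x)" using MB[OF that(2)] by (rule mult_right_mono) simp
    finally show ?thesis .
  qed
  from this have lip: "\<bar>g y - g x\<bar> \<le> B * norm (y - x)" if "x \<noteq> 0" "y \<noteq> 0" for x y
    using that by (metis abs_le_iff minus_diff_eq norm_minus_commute)
  show ?thesis
    unfolding continuous_on_eq_continuous_within continuous_within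
  proof
    fix x :: "real^2" assume x: "x \<in> - {0}"
    show "(g \<longlongrightarrow> g x) (at x within - {0})"
    proof (rule Lim_null[THEN iffD2], rule Lim_null_comparison)
      show "\<forall>\<^sub>F y in at x within - {0}. norm (g y - g x) \<le> B * norm (y - x)"
        using lip x by (auto simp: eventually_at_filter)
      have "((\<lambda>y. B * norm (y - x)) \<longlongrightarrow> B * norm (x - x)) (at x within - {0})" by (intro tendsto_intros)
      then show "((\<lambda>y. B * norm (y - x)) \<longlongrightarrow> 0) (at x within - {0})" by simp
    qed
  qed
qed

lemma cont_grad: "continuous_on (- {0}) grad"
proof -
  have "continuous_on (- {0}) dir"
    unfolding dir_def using gauge_pos by (intro continuous_intros cont_gauge) force
  then show ?thesis
    unfolding grad_def using dir_in by (intro continuous_on_compose2[OF cont_\<nu>]) auto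
qed

text \<open>
  Both \<open>grad x\<close> and \<open>grad y\<close> are subgradients, so the error of the linear approximation lies between 0
  and \<open>(grad y - grad x) \<bullet> (y - x)\<close>.
\<close>
lemma gauge_has_gradient: "(g has_derivative (\<lambda>h. grad x \<bullet> h)) (at x)" if x: "x \<noteq> 0"
  unfolding has_derivative_iff_norm
proof (intro conjI bounded_linear_inner_right)
  have "isCont grad x" using cont_grad x by (simp add: continuous_on_eq_continuous_at open_Compl)
  then have "((\<lambda>y. norm (grad y - grad x)) \<longlongrightarrow> norm (grad x - grad x)) (at x)"
    by (intro tendsto_intros) (simp add: isCont_def)
  then have lim: "((\<lambda>y. norm (grad y - grad x)) \<longlongrightarrow> 0) (at x)" by simp
  show "((\<lambda>y. norm (g y - g x - grad x \<bullet> (y - x)) / norm (y - x)) \<longlongrightarrow> 0) (at x)"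
  proof (rule Lim_null_comparison[OF _ lim])
    have "\<forall>\<^sub>F y in at x. y \<noteq> 0 \<and> y \<noteq> x"
      by (intro eventually_conj eventually_neq_at_within)
    then show "\<forall>\<^sub>F y in at x. norm (norm (g y - g x - grad x \<bullet> (y - x)) / norm (y - x)) \<le> norm (grad y - grad x)"
    proof eventually_elim
      case (elim y)
      have lower: "0 \<le> g y - g x - grad x \<bullet> (y - x)" using grad_le_diff[OF x, of y] by simp
      have "g y - g x \<le> grad y \<bullet> (y - x)"
        using grad_le_diff[of y x] elim by (simp add: inner_diff_right)
      then have "g y - g x - grad x \<bullet> (y - x) \<le> (grad y - grad x) \<bullet> (y - x)" by (simp add: inner_diff_left)
      also have "\<dots> \<le> norm (grad y - grad x) * norm (y - x)" by (rule norm_cauchy_schwarz)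
      finally show ?case using lower elim by (simp add: field_simps)
    qed
  qed
qed

text \<open>
  Write \<open>w = a *\<^sub>R e - b *\<^sub>R e'\<close> with \<open>a\<close> and \<open>b\<close> positive, and use that \<open>grad e\<close> is a subgradient which
  attains the gauge only in the direction of \<open>e\<close>.
\<close>
lemma grad_decreasing:
  assumes "0 < cross2 w e" "0 < cross2 w e'" "0 < cross2 e e'"
  shows "grad e' \<bullet> w < grad e \<bullet> w"
proof -
  define D a b where "D = cross2 e e'" and "a = cross2 w e' / D" and "b = cross2 w e / D"
  have ab: "0 < a" "0 < b" using assms by (auto simp: D_def a_def b_def)
  have e0: "e \<noteq> 0" "e' \<noteq> 0" using assms by (auto simp: cross2_simps)
  have "D *\<^sub>R w = cross2 w e' *\<^sub>R e - cross2 w e *\<^sub>R e'"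
    by (simp add: D_def cross2_def vec_eq_iff forall_2 algebra_simps)
  then have "(1 / D) *\<^sub>R (D *\<^sub>R w) = (1 / D) *\<^sub>R (cross2 w e' *\<^sub>R e - cross2 w e *\<^sub>R e')" by simp
  then have w: "w = a *\<^sub>R e - b *\<^sub>R e'"
    using assms(3) by (simp add: a_def b_def D_def scaleR_diff_right)
  have "dir e \<noteq> dir e'"
  proof
    assume "dir e = dir e'"
    then have "cross2 e e' = cross2 (g e *\<^sub>R dir e) (g e' *\<^sub>R dir e)" using dir_scale e0 by metis
    then show False using assms(3) by (simp add: cross2_simps)
  qed
  then have "grad e' \<bullet> e < g e" using grad_less[of e' e] e0 by auto
  then have "a * (grad e' \<bullet> e) < a * g e" using ab by simp
  moreover have "b * (grad e \<bullet> e') \<le> b * g e'" using grad_le[of e e'] e0 ab by simp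
  ultimately show ?thesis
    using grad_self e0 by (simp add: w inner_diff_right)
qed


lemma inner_deriv: "((\<lambda>s. (\<gamma> s - a) \<bullet> w) has_real_derivative \<gamma>1 t \<bullet> w) (at t)"
proof -
  have "((\<lambda>s. \<gamma> s - a) has_vector_derivative \<gamma>1 t) (at t)"
    using deriv[of t] by (auto intro!: derivative_eq_intros)
  then show ?thesis
    unfolding has_real_derivative_iff_has_vector_derivative
    by (rule bounded_linear.has_vector_derivative[OF bounded_linear_inner_left])
qed

text \<open>
  One of three collinear points lies between the two others, hence in \<open>K\<close>.
\<close>
lemma not_collinear:
  assumes "x \<in> \<Gamma>" "y \<in> \<Gamma>" "z \<in> \<Gamma>" "x \<noteq> y" "x \<noteq> z" "y \<noteq> z"
  shows "cross2 (y - x) (z - x) \<noteq> 0"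
proof
  have not_between: "w \<notin> open_segment u v" if "u \<in> \<Gamma>" "v \<in> \<Gamma>" "w \<in> \<Gamma>" for u v w
  proof
    assume w: "w \<in> open_segment u v"
    then have "u \<noteq> v" by auto
    then have "w \<in> K" using w open_segment_interior[of u v] that interior_S by blast
    then show False using that K_\<Gamma>_disjoint by blast
  qed
  assume "cross2 (y - x) (z - x) = 0"
  then obtain c where c: "y - x = c *\<^sub>R (z - x)"
    using assms by (auto elim: cross2_eq_0_parallel)
  have y: "y = (1 - c) *\<^sub>R x + c *\<^sub>R z" using c by (simp add: algebra_simps)
  have "c \<noteq> 0" "c \<noteq> 1" using c assms by auto
  then consider "c < 0" | "0 < c" "c < 1" | "1 < c" by linarith
  then show False
  proof cases
    case 1
    have "(1 - c) *\<^sub>R x = y - c *\<^sub>R z" by (simp add: y)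
    then have "(1 / (1 - c)) *\<^sub>R ((1 - c) *\<^sub>R x) = (1 / (1 - c)) *\<^sub>R (y - c *\<^sub>R z)" by simp
    then have "x = (1 / (1 - c)) *\<^sub>R y + (- c / (1 - c)) *\<^sub>R z"
      using 1 by (simp add: scaleR_diff_right)
    moreover have "1 / (1 - c) = 1 - (- c / (1 - c))" using 1 by (simp add: field_simps)
    moreover have "0 < - c / (1 - c)" "- c / (1 - c) < 1" using 1 by (simp_all add: divide_simps)
    ultimately have "x \<in> open_segment y z" unfolding in_segment using assms(6) by metis
    then show False using not_between assms by blast
  next
    case 2
    then have "y \<in> open_segment x z" unfolding in_segment using assms y by blast
    then show False using not_between assms by blast
  next
    case 3
    have "c *\<^sub>R z = y - (1 - c) *\<^sub>R x" by (simp add: y)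
    then have "(1 / c) *\<^sub>R (c *\<^sub>R z) = (1 / c) *\<^sub>R (y - (1 - c) *\<^sub>R x)" by simp
    then have "z = (1 / c) *\<^sub>R y - ((1 - c) / c) *\<^sub>R x"
      using 3 by (simp add: scaleR_diff_right)
    moreover have "- ((1 - c) / c) = 1 - 1 / c" using 3 by (simp add: field_simps)
    ultimately have "z = (1 - 1 / c) *\<^sub>R x + (1 / c) *\<^sub>R y"
      by (metis add.commute diff_conv_add_uminus scaleR_minus_left)
    moreover have "0 < 1 / c" "1 / c < 1" using 3 by simp_all
    ultimately have "z \<in> open_segment x y" unfolding in_segment using assms(4) by metis
    then show False using not_between assms by blast
  qed
qed

text \<open>
  As a function of \<open>s\<close>, the determinant has no zero, and just after \<open>t\<close> it is positive by \<open>ccw_curve\<close>.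
\<close>
lemma ccw_triple:
  assumes "t < s" "s < s'" "s' < t + l"
  shows "0 < cross2 (\<gamma> s - \<gamma> t) (\<gamma> s' - \<gamma> t)"
proof -
  define f where "f = (\<lambda>s. cross2 (\<gamma> s - \<gamma> t) (\<gamma> s' - \<gamma> t))"
  have nz: "f r \<noteq> 0" if "t < r" "r < s'" for r
    unfolding f_def
  proof (rule not_collinear)
    show "\<gamma> t \<noteq> \<gamma> r" "\<gamma> t \<noteq> \<gamma> s'" "\<gamma> r \<noteq> \<gamma> s'"
      using \<gamma>_neq[of t r] \<gamma>_neq[of t s'] \<gamma>_neq[of r s'] that assms by auto
  qed auto
  have cont: "continuous_on A f" for A unfolding f_def by (intro continuous_intros cont_\<gamma>)
  have "(f has_real_derivative cross2 (\<gamma>1 t) (\<gamma> s' - \<gamma> t)) (at t)"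
    unfolding f_def cross2_inner by (rule inner_deriv)
  moreover have "0 < cross2 (\<gamma>1 t) (\<gamma> s' - \<gamma> t)"
    by (rule ccw_curve) (use \<gamma>_neq[of t s'] assms in auto)
  ultimately obtain d where d: "d > 0" "\<And>h. 0 < h \<Longrightarrow> h < d \<Longrightarrow> f t < f (t + h)"
    using DERIV_pos_inc_right by blast
  \<comment> \<open>a parameter just after t, where f is positive\<close>
  define r where "r = t + min (d / 2) ((s' - t) / 2)"
  have r: "t < r" "r < s'" "r - t < d" using d(1) assms by (auto simp: r_def min_def field_simps)
  have "f t = 0" by (simp add: f_def cross2_simps)
  then have fr: "0 < f r" using d(2)[of "r - t"] r by simp
  have "0 < f s"
  proof (rule ccontr)
    assume "\<not> 0 < f s"
    then have fs: "f s \<le> 0" by simp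
    show False
    proof (cases "r \<le> s")
      case True
      then have "\<exists>x\<ge>r. x \<le> s \<and> f x = 0" using fr fs by (intro IVT2' cont) auto
      then show False using nz r assms by auto
    next
      case False
      then have "\<exists>x\<ge>s. x \<le> r \<and> f x = 0" using fr fs by (intro IVT' cont) auto
      then show False using nz r assms by auto
    qed
  qed
  then show ?thesis by (simp add: f_def)
qed

definition out_mom :: "real \<Rightarrow> real \<Rightarrow> real" where
  "out_mom t t1 = grad (\<gamma> t1 - \<gamma> t) \<bullet> \<gamma>1 t"

definition in_mom :: "real \<Rightarrow> real \<Rightarrow> real" where
  "in_mom t t1 = grad (\<gamma> t1 - \<gamma> t) \<bullet> \<gamma>1 t1"

abbreviation L :: "real \<Rightarrow> real \<Rightarrow> real" where "L \<equiv> generating_function K \<gamma>"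

lemma chord_nz: "t < t1 \<Longrightarrow> t1 < t + l \<Longrightarrow> \<gamma> t1 - \<gamma> t \<noteq> 0"
  using \<gamma>_neq[of t t1] by simp

lemma L_deriv1:
  assumes "t < t1" "t1 < t + l"
  shows "((\<lambda>\<tau>. L \<tau> t1) has_real_derivative - out_mom t t1) (at t)"
proof -
  have "((\<lambda>\<tau>. \<gamma> t1 - \<gamma> \<tau>) has_derivative (\<lambda>h. h *\<^sub>R (- \<gamma>1 t))) (at t)"
    using deriv[of t] unfolding has_vector_derivative_def[symmetric] by (auto intro!: derivative_eq_intros)
  then have "((\<lambda>\<tau>. g (\<gamma> t1 - \<gamma> \<tau>)) has_derivative (\<lambda>h. grad (\<gamma> t1 - \<gamma> t) \<bullet> (h *\<^sub>R (- \<gamma>1 t)))) (at t)"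
    by (rule has_derivative_compose[where f = "\<lambda>\<tau>. \<gamma> t1 - \<gamma> \<tau>" and g = g, OF _ gauge_has_gradient[OF chord_nz[OF assms]]])
  moreover have "(\<lambda>h. grad (\<gamma> t1 - \<gamma> t) \<bullet> (h *\<^sub>R (- \<gamma>1 t))) = (*) (- out_mom t t1)"
    by (auto simp: out_mom_def)
  ultimately show ?thesis by (simp add: has_field_derivative_def generating_function_def)
qed

lemma L_deriv2:
  assumes "t < t1" "t1 < t + l"
  shows "((\<lambda>\<tau>. L t \<tau>) has_real_derivative in_mom t t1) (at t1)"
proof -
  have "((\<lambda>\<tau>. \<gamma> \<tau> - \<gamma> t) has_derivative (\<lambda>h. h *\<^sub>R (\<gamma>1 t1))) (at t1)"
    using deriv[of t1] unfolding has_vector_derivative_def[symmetric] by (auto intro!: derivative_eq_intros)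
  then have "((\<lambda>\<tau>. g (\<gamma> \<tau> - \<gamma> t)) has_derivative (\<lambda>h. grad (\<gamma> t1 - \<gamma> t) \<bullet> (h *\<^sub>R (\<gamma>1 t1)))) (at t1)"
    by (rule has_derivative_compose[where f = "\<lambda>\<tau>. \<gamma> \<tau> - \<gamma> t" and g = g, OF _ gauge_has_gradient[OF chord_nz[OF assms]]])
  moreover have "(\<lambda>h. grad (\<gamma> t1 - \<gamma> t) \<bullet> (h *\<^sub>R (\<gamma>1 t1))) = (*) (in_mom t t1)"
    by (auto simp: in_mom_def)
  ultimately show ?thesis by (simp add: has_field_derivative_def generating_function_def)
qed

text \<open>
  Turning a chord about one of its ends makes \<open>grad\<close> of the chord, paired with the velocity at this
  end, monotone by \<open>grad_decreasing\<close>.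
\<close>
sublocale twist l L out_mom in_mom
proof
  have contgrad: "continuous_on {(t, t1). t < t1 \<and> t1 < t + l} (\<lambda>z. grad (\<gamma> (snd z) - \<gamma> (fst z)))"
    by (intro continuous_on_compose2[OF cont_grad] continuous_intros
        continuous_on_compose2[OF cont_\<gamma>, where t = UNIV]) (use chord_nz in auto)
  show "continuous_on {(t, t1). t < t1 \<and> t1 < t + l} (\<lambda>(t, t1). out_mom t t1)"
    unfolding out_mom_def case_prod_unfold
    by (intro continuous_on_inner contgrad[unfolded case_prod_unfold] continuous_on_compose2[OF cont_\<gamma>1] continuous_intros) auto
  show "continuous_on {(t, t1). t < t1 \<and> t1 < t + l} (\<lambda>(t, t1). in_mom t t1)"
    unfolding in_mom_def case_prod_unfold
    by (intro continuous_on_inner contgrad[unfolded case_prod_unfold] continuous_on_compose2[OF cont_\<gamma>1] continuous_intros) auto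
  show "out_mom t t1' < out_mom t t1" if "t < t1" "t1 < t1'" "t1' < t + l" for t t1 t1'
    unfolding out_mom_def
    using that \<gamma>_neq[of t t1] \<gamma>_neq[of t t1']
    by (intro grad_decreasing ccw_curve ccw_triple) auto
  show "in_mom t t1 < in_mom t' t1" if "t < t'" "t' < t1" "t1 < t + l" for t t' t1
  proof -
    \<comment> \<open>seen from t1, the points t and t' follow in the next turn\<close>
    have "0 < cross2 (\<gamma> (t + l) - \<gamma> t1) (\<gamma> (t' + l) - \<gamma> t1)"
      by (rule ccw_triple) (use that in auto)
    then have "0 < cross2 (\<gamma> t1 - \<gamma> t) (\<gamma> t1 - \<gamma> t')"
      by (simp add: periodic cross2_simps)
    moreover have "0 < cross2 (\<gamma>1 t1) (\<gamma> t - \<gamma> t1)" "0 < cross2 (\<gamma>1 t1) (\<gamma> t' - \<gamma> t1)"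
      using that \<gamma>_neq[of t t1] \<gamma>_neq[of t' t1] by (auto intro!: ccw_curve)
    then have "0 < cross2 (- \<gamma>1 t1) (\<gamma> t1 - \<gamma> t)" "0 < cross2 (- \<gamma>1 t1) (\<gamma> t1 - \<gamma> t')"
      by (simp_all add: cross2_simps)
    ultimately have "grad (\<gamma> t1 - \<gamma> t') \<bullet> (- \<gamma>1 t1) < grad (\<gamma> t1 - \<gamma> t) \<bullet> (- \<gamma>1 t1)"
      by (intro grad_decreasing) auto
    then show ?thesis by (simp add: in_mom_def)
  qed
qed (use l_pos L_deriv1 L_deriv2 in \<open>auto simp: out_mom_def in_mom_def periodic \<gamma>1_periodic\<close>)

lemma billiard_map_eq: "billiard_map K \<gamma> l = twist_rel"
proof -
  have "((\<lambda>\<tau>. L \<tau> t1) has_real_derivative - s) (at t) \<longleftrightarrow> s = out_mom t t1"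
    if "t < t1" "t1 < t + l" for t t1 s
    using L_deriv1[OF that] DERIV_unique[of "\<lambda>\<tau>. L \<tau> t1" "- s" t "- out_mom t t1"] by auto
  moreover have "((\<lambda>\<tau>. L t \<tau>) has_real_derivative s1) (at t1) \<longleftrightarrow> s1 = in_mom t t1"
    if "t < t1" "t1 < t + l" for t t1 s1
    using L_deriv2[OF that] DERIV_unique[of "\<lambda>\<tau>. L t \<tau>" s1 t1 "in_mom t t1"] by auto
  ultimately show ?thesis unfolding billiard_map_def twist_rel_def by auto
qed

lemma phase_cylinder_eq: "phase_cylinder K \<gamma> l = chord_out ` chords"
proof -
  have "((\<lambda>\<tau>. L \<tau> t1) has_real_derivative - s) (at t) \<longleftrightarrow> s = out_mom t t1"
    if "t < t1" "t1 < t + l" for t t1 s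
    using L_deriv1[OF that] DERIV_unique[of "\<lambda>\<tau>. L \<tau> t1" "- s" t "- out_mom t t1"] by auto
  then show ?thesis
    unfolding phase_cylinder_def chord_out_def chords_def by (auto simp: image_iff)
qed

text \<open>
  The map \<open>A \<circ> \<gamma>\<close> lifts to \<open>\<gamma> \<circ> \<sigma>\<close>, because the circle-valued parameter \<open>E\<close> on the curve has a continuous
  logarithm along it. Two curves in \<open>\<Gamma>\<close> have parallel velocities at a common point, as \<open>\<Gamma>\<close> lies on one
  side of its tangents; both velocities have gauge 1 and the same orientation, so \<open>\<sigma>\<close> has derivative 1.
\<close>
lemma symmetry_translates:
  assumes A: "linear A" "inj A" "A ` \<Gamma> = \<Gamma>" and cr: "\<And>x y. cross2 (A x) (A y) = cross2 x y"
  obtains \<delta> where "\<And>t. A (\<gamma> t) = \<gamma> (t + \<delta>)"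
proof -
  have "continuous_on UNIV (\<lambda>t. cis (2 * pi * t / l))" by (intro continuous_intros) (use l_pos in auto)
  moreover have "cis (2 * pi * (t + l) / l) = cis (2 * pi * t / l)" for t
  proof -
    have "2 * pi * (t + l) / l = 2 * pi * t / l + 2 * pi" using l_pos by (simp add: field_simps)
    then show ?thesis by (simp add: complex_eq_iff)
  qed
  ultimately obtain E where E: "continuous_on \<Gamma> E" "\<And>t. E (\<gamma> t) = cis (2 * pi * t / l)"
    using descends_to_curve[of "\<lambda>t. cis (2 * pi * t / l)"] by metis
  have A\<gamma>: "A (\<gamma> t) \<in> \<Gamma>" for t using A(3) by (metis \<gamma>_in imageI)
  have "continuous_on UNIV (\<lambda>t. A (\<gamma> t))"
    by (rule continuous_on_compose2[OF linear_continuous_on cont_\<gamma>, where t = UNIV])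
       (use A(1) in \<open>auto simp: linear_conv_bounded_linear\<close>)
  then have "continuous_on UNIV (\<lambda>t. E (A (\<gamma> t)))"
    by (rule continuous_on_compose2[OF E(1)]) (use A\<gamma> in auto)
  moreover have norm1: "norm (E (A (\<gamma> t))) = 1" for t
    using A\<gamma>[of t] E(2) range by (metis norm_cis rangeE)
  then have "E (A (\<gamma> t)) \<noteq> 0" for t by (metis norm_zero zero_neq_one)
  moreover have "contractible (UNIV :: real set)" by (simp add: convex_imp_contractible)
  ultimately obtain G where G: "continuous_on UNIV G" "\<And>t. E (A (\<gamma> t)) = exp (G t)"
    using continuous_logarithm_on_contractible[of UNIV "\<lambda>t. E (A (\<gamma> t))"] by (metis UNIV_I)
  define \<sigma> where "\<sigma> = (\<lambda>t. Im (G t) * l / (2 * pi))"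
  have cont_\<sigma>: "isCont \<sigma> t" for t
  proof -
    have "continuous_on UNIV \<sigma>" unfolding \<sigma>_def by (intro continuous_intros G) auto
    then show ?thesis by (simp add: continuous_on_eq_continuous_at)
  qed
  have lift: "A (\<gamma> t) = \<gamma> (\<sigma> t)" for t
  proof -
    obtain s where s: "A (\<gamma> t) = \<gamma> s" using A\<gamma>[of t] range by blast
    have "norm (exp (G t)) = 1" using norm1[of t] G(2) by simp
    then have "Re (G t) = 0" by simp
    then have "exp (G t) = cis (Im (G t))" by (simp add: exp_eq_polar)
    then have "cis (2 * pi * s / l) = cis (Im (G t))" using G(2)[of t] E(2)[of s] s by simp
    then have "exp (\<i> * complex_of_real (2 * pi * s / l)) = exp (\<i> * complex_of_real (Im (G t)))"
      by (simp only: cis_conv_exp)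
    then obtain n :: int where n: "\<i> * complex_of_real (2 * pi * s / l) = \<i> * complex_of_real (Im (G t)) + complex_of_real (real_of_int (2 * n) * pi) * \<i>"
      unfolding exp_eq by blast
    have "Im (\<i> * complex_of_real (2 * pi * s / l)) = Im (\<i> * complex_of_real (Im (G t)) + complex_of_real (real_of_int (2 * n) * pi) * \<i>)"
      using n by (rule arg_cong)
    then have "2 * pi * s / l = Im (G t) + 2 * of_int n * pi" by simp
    then have "s = \<sigma> t + of_int n * l" using l_pos by (simp add: \<sigma>_def field_simps)
    then show ?thesis using s \<gamma>_int by simp
  qed
  have tangent: "A (\<gamma>1 t) = \<gamma>1 (\<sigma> t)" for t
  proof -
    define f where "f = (\<lambda>s. cross2 (A (\<gamma>1 t)) (\<gamma> s - \<gamma> (\<sigma> t)))"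
    have "0 \<le> f s" for s
    proof -
      obtain s' where s': "\<gamma> s = A (\<gamma> s')" using A(3) range by (metis \<gamma>_in imageE rangeE)
      have "f s = cross2 (A (\<gamma>1 t)) (A (\<gamma> s' - \<gamma> t))"
        by (simp add: f_def s' lift[symmetric] linear_diff[OF A(1)])
      also have "\<dots> = cross2 (\<gamma>1 t) (\<gamma> s' - \<gamma> t)" by (rule cr)
      also have "\<dots> \<ge> 0"
        using ccw_curve[of "\<gamma> s'" t] by (cases "\<gamma> s' = \<gamma> t") (auto simp: cross2_simps)
      finally show ?thesis .
    qed
    moreover have "f (\<sigma> t) = 0" by (simp add: f_def cross2_simps)
    moreover have "(f has_real_derivative cross2 (A (\<gamma>1 t)) (\<gamma>1 (\<sigma> t))) (at (\<sigma> t))"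
    proof -
      have f_eq: "f = (\<lambda>s. (\<gamma> s - \<gamma> (\<sigma> t)) \<bullet> (- vector [A (\<gamma>1 t) $ 2, - A (\<gamma>1 t) $ 1]))"
        unfolding f_def by (subst cross2_commute) (simp add: cross2_inner)
      have "cross2 (A (\<gamma>1 t)) (\<gamma>1 (\<sigma> t)) = \<gamma>1 (\<sigma> t) \<bullet> (- vector [A (\<gamma>1 t) $ 2, - A (\<gamma>1 t) $ 1])"
        by (subst cross2_commute) (simp add: cross2_inner)
      then show ?thesis
        unfolding f_eq by (simp only: inner_deriv)
    qed
    ultimately have "cross2 (A (\<gamma>1 t)) (\<gamma>1 (\<sigma> t)) = 0"
      using DERIV_local_min[of f _ "\<sigma> t" 1] by auto
    then obtain c where c: "A (\<gamma>1 t) = c *\<^sub>R \<gamma>1 (\<sigma> t)"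
      using \<gamma>1_nz by (auto elim: cross2_eq_0_parallel)
    have "0 < cross2 (\<gamma>1 t) (0 - \<gamma> t)" by (rule ccw[OF origin])
    also have "\<dots> = cross2 (A (\<gamma>1 t)) (A (0 - \<gamma> t))" by (simp add: cr)
    also have "\<dots> = c * cross2 (\<gamma>1 (\<sigma> t)) (0 - \<gamma> (\<sigma> t))"
      by (simp add: linear_neg[OF A(1)] lift c cross2_simps)
    finally have "0 < c" using ccw[OF origin, of "\<sigma> t"] by (simp add: zero_less_mult_iff)
    moreover have "g (A (\<gamma>1 t)) = 1" using gauge_invariant[OF A] unit by simp
    ultimately have "c = 1" using gauge_homogeneous[of c "\<gamma>1 (\<sigma> t)"] unit c by simp
    then show ?thesis using c by simp
  qed
  have "(\<sigma> has_real_derivative 1) (at t)" for t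
  proof -
    define q where "q = \<gamma>1 (\<sigma> t)"
    have "((\<lambda>s. \<gamma> s \<bullet> q) has_real_derivative q \<bullet> q) (at (\<sigma> t))"
      using inner_deriv[of 0 q "\<sigma> t"] by (simp add: q_def)
    moreover have "((\<lambda>s. A (\<gamma> s)) has_vector_derivative A (\<gamma>1 t)) (at t)"
      by (rule bounded_linear.has_vector_derivative[OF _ deriv]) (use A(1) in \<open>simp add: linear_conv_bounded_linear\<close>)
    then have "((\<lambda>s. \<gamma> (\<sigma> s) \<bullet> q) has_real_derivative q \<bullet> q) (at t)"
      unfolding has_real_derivative_iff_has_vector_derivative lift tangent q_def[symmetric]
      by (rule bounded_linear.has_vector_derivative[OF bounded_linear_inner_left])
    ultimately have "(\<sigma> has_real_derivative (q \<bullet> q) / (q \<bullet> q)) (at t)"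
      using cont_\<sigma> \<gamma>1_nz by (intro has_real_derivative_inverse_comp[where F = "\<lambda>s. \<gamma> s \<bullet> q"]) (auto simp: q_def)
    then show ?thesis using \<gamma>1_nz by (simp add: q_def)
  qed
  then have "((\<lambda>t. \<sigma> t - t) has_real_derivative 0) (at t)" for t
    using DERIV_diff[OF _ DERIV_ident, of \<sigma> 1 t UNIV] by simp
  then have iso: "\<sigma> t - t = \<sigma> 0 - 0" for t
    using DERIV_isconst_all[of "\<lambda>t. \<sigma> t - t"] by blast
  have "\<sigma> t = t + \<sigma> 0" for t using iso[of t] by linarith
  then show ?thesis using lift that by metis
qed

end

section \<open>Regular polygons and the extra symmetry\<close>

context centred_gauge_curve
begin

text \<open>
  By \<open>symmetry_translates\<close>, \<open>A\<close> moves the parameter by \<open>m l / k\<close> for some integer \<open>m\<close>. This \<open>m\<close> is coprime to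
  \<open>k\<close>, since a power of \<open>A\<close> that fixes the curve pointwise is the identity. So some power of \<open>A\<close> moves the
  parameter by \<open>r l / k\<close> up to full turns, and its exponent is coprime to \<open>k\<close> as well.
\<close>
lemma ex_rotation_power:
  assumes A: "linear A" "has_order A k" "k \<ge> 3" "A ` \<Gamma> = \<Gamma>" and r: "coprime r (int k)"
  obtains Q where "linear Q" "has_order Q k" "Q ` \<Gamma> = \<Gamma>" "\<And>t. Q (\<gamma> t) = \<gamma> (t + of_int r * l / k)"
proof -
  have k: "A ^^ k = id" "0 < k" using A(2) by (auto simp: has_order_def)
  have inj_A: "inj A" by (rule has_order_inj[OF A(2)])
  have cr: "cross2 (A x) (A y) = cross2 x y" for x y using finite_order_plane[OF A(1-3)] by metis
  obtain \<delta> where \<delta>: "\<And>t. A (\<gamma> t) = \<gamma> (t + \<delta>)"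
    using symmetry_translates[OF A(1) inj_A A(4) cr] by metis
  have pw: "(A ^^ j) (\<gamma> t) = \<gamma> (t + real j * \<delta>)" for j t
    by (induction j) (simp_all add: \<delta> algebra_simps)
  have "\<gamma> (0 + real k * \<delta>) = \<gamma> 0" using pw[of k 0] k by simp
  then obtain m :: int where m: "real k * \<delta> = of_int m * l" using \<gamma>_eq_iff by auto
  have \<delta>_eq: "\<delta> = of_int m * l / k" using m k by (simp add: field_simps)
  have span: "A ^^ j = id" if "\<And>t. (A ^^ j) (\<gamma> t) = \<gamma> t" for j
  proof
    fix x :: "real^2"
    show "(A ^^ j) x = id x"
    proof (cases "x = 0")
      case True
      then show ?thesis using linear_0[OF linear_funpow[OF A(1)]] by simp
    next
      case False
      then obtain z where z: "z \<in> \<Gamma>" "x = g x *\<^sub>R z" using polar[of x] by blast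
      then obtain t where t: "z = \<gamma> t" using range by blast
      have "(A ^^ j) x = g x *\<^sub>R (A ^^ j) z" using z(2) linear_scale[OF linear_funpow[OF A(1)]] by metis
      then show ?thesis using that t z(2) by simp
    qed
  qed
  have "coprime m (int k)"
  proof (rule coprimeI)
    fix d assume d: "d dvd m" "d dvd int k"
    define e where "e = nat \<bar>d\<bar>"
    have e: "e dvd k" using d(2) by (simp add: e_def nat_dvd_iff)
    have e0: "0 < e" using e k by (metis dvd_0_left gr0I)
    obtain j where j: "k = e * j" using e by blast
    obtain m' where m': "m = int e * m'" using d(1) by (metis abs_dvd_iff dvdE e_def int_nat_eq abs_ge_zero)
    have "real j * \<delta> = of_int m' * l"
      using e0 k by (simp add: \<delta>_eq j m' field_simps)
    then have "A ^^ j = id" by (intro span) (simp add: pw \<gamma>_int)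
    then have "k dvd j" using has_order_dvd[OF A(2)] by blast
    then have "e * j dvd 1 * j" using j by simp
    then have "e dvd 1" using j k by (simp only: dvd_mult_cancel_right) auto
    then show "is_unit d" by (simp add: e_def)
  qed
  then have "gcd m (int k) = 1" by (simp add: coprime_iff_gcd_eq_1)
  then obtain u v where uv: "u * m + v * int k = 1" using bezout_int[of m "int k"] by metis
  define i where "i = nat ((u * r) mod int k)"
  define q where "q = - (v * r) - m * ((u * r) div int k)"
  have i: "int i = u * r - int k * ((u * r) div int k)"
    using k by (simp add: i_def minus_mult_div_eq_mod)
  have "m * int i = (u * m) * r - int k * (m * ((u * r) div int k))"
    unfolding i by (simp add: algebra_simps)
  also have "u * m = 1 - v * int k" using uv by simp
  finally have q: "m * int i = r + int k * q" by (simp add: q_def algebra_simps)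
  have shift: "real i * \<delta> = of_int r * l / k + of_int q * l"
  proof -
    have "real i * \<delta> = of_int (m * int i) * l / k" by (simp add: \<delta>_eq)
    also have "\<dots> = of_int r * l / k + of_int q * l" unfolding q using k by (simp add: field_simps)
    finally show ?thesis .
  qed
  have "coprime (int i) (int k)"
  proof (rule coprimeI)
    fix d assume d: "d dvd int i" "d dvd int k"
    have "r = m * int i - int k * q" using q by simp
    then have "d dvd r" using d by simp
    then show "is_unit d" using r d(2) coprime_common_divisor by blast
  qed
  then have cop: "coprime k i" by (simp add: coprime_commute)
  show ?thesis
  proof
    show "linear (A ^^ i)" by (rule linear_funpow[OF A(1)])
    show "has_order (A ^^ i) k"
    proof (rule has_orderI_dvd[OF k(2)])
      fix j
      have "(A ^^ i) ^^ j = A ^^ (i * j)" by (simp add: funpow_mult)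
      then show "(A ^^ i) ^^ j = id \<longleftrightarrow> k dvd j"
        using has_order_dvd[OF A(2), of "i * j"] cop by (simp add: coprime_dvd_mult_right_iff)
    qed
    show "(A ^^ i) ` \<Gamma> = \<Gamma>"
    proof (induction i)
      case (Suc i)
      have "(A ^^ Suc i) ` \<Gamma> = A ` ((A ^^ i) ` \<Gamma>)" by (simp add: image_image)
      then show ?case using Suc A(4) by simp
    qed simp
    show "(A ^^ i) (\<gamma> t) = \<gamma> (t + of_int r * l / k)" for t
    proof -
      have "t + real i * \<delta> = (t + of_int r * l / k) + of_int q * l" by (simp add: shift)
      then show ?thesis by (simp only: pw \<gamma>_int)
    qed
  qed
qed

text \<open>
  The derivative of the gauge of the side from \<open>\<gamma> t\<close> to \<open>\<gamma> (t + w)\<close> is the difference of its two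
  momenta.
\<close>
lemma sides_constant:
  assumes Q: "linear Q" "\<And>t. Q (\<gamma> t) = \<gamma> (t + w)" and w: "0 < w" "w < l"
    and regular: "\<And>t. in_mom t (t + w) = out_mom t (t + w)"
  obtains s where "0 < s" "\<And>t. g (Q (\<gamma> t) - \<gamma> t) = s"
proof -
  define h where "h = (\<lambda>t. g (\<gamma> (t + w) - \<gamma> t))"
  have nz: "\<gamma> (t + w) - \<gamma> t \<noteq> 0" for t using chord_nz[of t "t + w"] w by simp
  have "(h has_real_derivative 0) (at t)" for t
  proof -
    have "((\<lambda>t. \<gamma> (t + w)) has_vector_derivative 1 *\<^sub>R \<gamma>1 (t + w)) (at t)"
      using vector_diff_chain_at[of "\<lambda>s. s + w" 1 t \<gamma> "\<gamma>1 (t + w)"] deriv[of "t + w"]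
      by (simp add: comp_def has_vector_derivative_add_const has_vector_derivative_id)
    then have "((\<lambda>t. \<gamma> (t + w) - \<gamma> t) has_derivative (\<lambda>h. h *\<^sub>R (\<gamma>1 (t + w) - \<gamma>1 t))) (at t)"
      using deriv[of t] unfolding has_vector_derivative_def[symmetric] by (auto intro!: derivative_eq_intros)
    then have "(h has_derivative (\<lambda>h. grad (\<gamma> (t + w) - \<gamma> t) \<bullet> (h *\<^sub>R (\<gamma>1 (t + w) - \<gamma>1 t)))) (at t)"
      unfolding h_def
      by (rule has_derivative_compose[where f = "\<lambda>t. \<gamma> (t + w) - \<gamma> t" and g = g, OF _ gauge_has_gradient[OF nz]])
    moreover have "(\<lambda>h. grad (\<gamma> (t + w) - \<gamma> t) \<bullet> (h *\<^sub>R (\<gamma>1 (t + w) - \<gamma>1 t))) = (*) 0"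
      using regular[of t] by (auto simp: in_mom_def out_mom_def inner_diff_right)
    ultimately show ?thesis by (simp add: has_field_derivative_def)
  qed
  then have "h t = h 0" for t using DERIV_isconst_all by blast
  moreover have "0 < h 0" unfolding h_def by (rule gauge_pos[OF nz])
  ultimately show ?thesis using that[of "h 0"] by (simp add: h_def Q(2))
qed

text \<open>
  The map \<open>B = (Q - id) / s\<close> preserves the gauge of all points of the curve, hence of all vectors. By
  Cayley-Hamilton, \<open>(Q - id) \<circ> (Q - id) = (\<tau> - 2) Q\<close>, so \<open>B \<circ> B\<close> is a negative multiple of \<open>Q\<close>; the factor
  is \<open>- 1\<close>, because \<open>B\<close> and \<open>Q\<close> preserve the gauge.
\<close>
lemma bisecting_symmetry:
  assumes Q: "linear Q" "has_order Q k" "k \<ge> 3" "Q ` \<Gamma> = \<Gamma>"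
    and s: "0 < s" "\<And>t. g (Q (\<gamma> t) - \<gamma> t) = s"
  obtains B where "linear B" "B ` K = K" "B \<circ> B = (\<lambda>x. - Q x)"
proof -
  obtain \<tau> where \<tau>: "\<And>x. Q (Q x) = \<tau> *\<^sub>R Q x - x" "\<tau> < 2" "\<And>v. Q v = v \<Longrightarrow> v = 0"
    using finite_order_plane[OF Q(1-3)] by metis
  have inj_Q: "inj Q" by (rule has_order_inj[OF Q(2)])
  define B where "B = (\<lambda>x. (1 / s) *\<^sub>R (Q x - x))"
  have lin: "linear B"
    unfolding B_def using Q(1)
    by (intro linear_compose_scale_right linear_compose_sub linear_ident) (auto simp: linear_compose_sub)
  have gB: "g (B x) = g x" for x
  proof (cases "x = 0")
    case True
    then show ?thesis using linear_0[OF lin] by simp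
  next
    case False
    then obtain z where z: "z \<in> \<Gamma>" "0 < g x" "x = g x *\<^sub>R z" using polar[of x] by blast
    then obtain t where t: "z = \<gamma> t" using range by blast
    have "g (B z) = 1" using s gauge_homogeneous[of "1 / s" "Q z - z"] by (simp add: B_def t)
    moreover have "B x = g x *\<^sub>R B z" using z(3) linear_scale[OF lin] by metis
    ultimately show ?thesis using gauge_homogeneous[of "g x" "B z"] z(2) by simp
  qed
  have "inj B"
    unfolding linear_injective_0[OF lin] using s(1) \<tau>(3) by (auto simp: B_def)
  then have "surj B" using lin by (simp add: linear_injective_imp_surjective)
  have "B ` K = K"
  proof
    show "B ` K \<subseteq> K" using gB by (auto simp: in_K_iff)
    show "K \<subseteq> B ` K"
    proof
      fix y assume y: "y \<in> K"
      obtain x where x: "y = B x" using \<open>surj B\<close> by (rule surjE)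
      then show "y \<in> B ` K" using y gB[of x] by (simp add: in_K_iff)
    qed
  qed
  moreover have "B \<circ> B = (\<lambda>x. - Q x)"
  proof -
    \<comment> \<open>B \<circ> B is - \<mu> times Q\<close>
    define \<mu> where "\<mu> = (2 - \<tau>) / s\<^sup>2"
    have \<mu>: "0 < \<mu>" using \<tau>(2) s(1) by (simp add: \<mu>_def)
    have BB: "B (B x) = \<mu> *\<^sub>R (- Q x)" for x
    proof -
      have "B (B x) = (1 / s\<^sup>2) *\<^sub>R (Q (Q x) - Q x - (Q x - x))"
        by (simp add: B_def linear_scale[OF Q(1)] linear_diff[OF Q(1)] scaleR_diff_right scaleR_add_right
            power2_eq_square)
      also have "Q (Q x) - Q x - (Q x - x) = (2 - \<tau>) *\<^sub>R (- Q x)"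
        by (simp add: \<tau>(1) algebra_simps scaleR_2)
      finally show ?thesis by (simp add: \<mu>_def)
    qed
    have sym: "\<mu> * g (- y) = g y" for y
    proof -
      obtain x where x: "y = Q x"
        using linear_injective_imp_surjective[OF Q(1) inj_Q] by (meson surjE)
      have "\<mu> * g (- Q x) = g (B (B x))" using gauge_homogeneous[of \<mu> "- Q x"] \<mu> by (simp add: BB)
      also have "\<dots> = g (Q x)" using gB gauge_invariant[OF Q(1) inj_Q Q(4)] by simp
      finally show ?thesis by (simp add: x)
    qed
    have "\<mu> * (\<mu> * g (\<gamma> 0)) = g (\<gamma> 0)" using sym[of "- \<gamma> 0"] sym[of "\<gamma> 0"] by simp
    moreover have "g (\<gamma> 0) = 1" using in_\<Gamma>_iff \<gamma>_in by blast
    ultimately have "\<mu> * \<mu> = 1" by simp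
    then have "\<mu> = 1" using \<mu> by (metis abs_of_pos abs_square_eq_1 power2_eq_square)
    then show ?thesis by (auto simp: BB)
  qed
  ultimately show ?thesis using that lin by blast
qed

text \<open>
  If \<open>k mod 4 = 2\<close>, then \<open>Q\<close> itself has the required order. Otherwise \<open>- Q\<close> has the even order \<open>k\<close> or
  \<open>2 * k\<close>, and its square root \<open>B\<close> has twice this order.
\<close>
theorem more_symmetry:
  assumes A: "linear A" "has_order A k" "k \<ge> 3" "A ` \<Gamma> = \<Gamma>"
    and rot: "has_rotation_number K \<gamma> l C (of_int r / of_nat k)" and r: "coprime r (int k)"
    and C: "C \<subseteq> U" and int: "totally_integrable K \<gamma> l U"
  shows "\<exists>B. linear B \<and>
           has_order B ((if k mod 4 = 2 then 1 else if k mod 4 = 0 then 2 else 4) * k) \<and>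
           B ` K = K"
proof -
  have k: "0 < k" using A(3) by simp
  obtain Q where Q: "linear Q" "has_order Q k" "Q ` \<Gamma> = \<Gamma>" "\<And>t. Q (\<gamma> t) = \<gamma> (t + of_int r * l / k)"
    using ex_rotation_power[OF A r] by metis
  define w where "w = of_int r * l / k"
  have inj_Q: "inj Q" by (rule has_order_inj[OF Q(2)])
  show ?thesis
  proof (cases "k mod 4 = 2")
    case True
    have "Q ` K = K" by (rule linear_image_K[OF Q(1) inj_Q Q(3)])
    then show ?thesis using Q(1,2) True by (intro exI[of _ Q]) simp
  next
    case False
    have L_shift: "L (t + w) (t1 + w) = L t t1" for t t1
      using gauge_invariant[OF Q(1) inj_Q Q(3), of "\<gamma> t1 - \<gamma> t"]
      by (simp add: generating_function_def linear_diff[OF Q(1)] Q(4) w_def)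
    have out_shift: "out_mom (t + w) (t1 + w) = out_mom t t1" if "t < t1" "t1 < t + l" for t t1
    proof -
      have "((\<lambda>\<tau>. L \<tau> (t1 + w)) has_real_derivative - out_mom (t + w) (t1 + w)) (at (t + w))"
        by (rule L_deriv1) (use that in auto)
      then have "((\<lambda>\<tau>. L \<tau> t1) has_real_derivative - out_mom (t + w) (t1 + w)) (at t)"
        by (simp add: DERIV_shift L_shift)
      then show ?thesis using L_deriv1[OF that] DERIV_unique by force
    qed
    have in_shift: "in_mom (t + w) (t1 + w) = in_mom t t1" if "t < t1" "t1 < t + l" for t t1
    proof -
      have "((\<lambda>\<tau>. L (t + w) \<tau>) has_real_derivative in_mom (t + w) (t1 + w)) (at (t1 + w))"
        by (rule L_deriv2) (use that in auto)
      then have "((\<lambda>\<tau>. L t \<tau>) has_real_derivative in_mom (t + w) (t1 + w)) (at t1)"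
        by (simp add: DERIV_shift L_shift)
      then show ?thesis using L_deriv2[OF that] DERIV_unique by force
    qed
    obtain \<F> where \<F>: "C1_foliation U \<F>" "\<And>\<beta>. \<beta> \<in> \<F> \<Longrightarrow> rotational_invariant_curve K \<gamma> l \<beta>"
      using int by (auto simp: totally_integrable_def)
    obtain c0 F0 where c0: "rotational_param l C c0" "\<And>u. (c0 u, c0 (F0 u)) \<in> twist_rel"
      "(\<lambda>n. ((F0 ^^ n) 0 - 0) / real n) \<longlonglongrightarrow> of_int r / of_nat k"
      using rot unfolding has_rotation_number_def billiard_map_eq by blast
    have "\<exists>c F. rotational_param l (range c) c \<and> continuous_on UNIV F \<and> (\<forall>u. (c u, c (F u)) \<in> twist_rel) \<and>
        (\<forall>u. F (u + 1) = F u + 1) \<and> (\<forall>u. (F ^^ k) u = u + of_int r)"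
    proof (rule rational_curve_gives_periodic_leaf[OF \<F>(1) _ _ _ _ c0(1) C c0(2,3) k])
      show "U \<subseteq> chord_out ` chords"
        using int by (simp add: totally_integrable_def phase_cylinder_eq)
      show "(t + l, s) \<in> U \<longleftrightarrow> (t, s) \<in> U" for t s
        using int by (simp add: totally_integrable_def)
      show "\<exists>c. rotational_param l \<beta> c" "twist_rel `` \<beta> = \<beta>" if "\<beta> \<in> \<F>" for \<beta>
        using \<F>(2)[OF that] by (auto simp: rotational_invariant_curve_def billiard_map_eq)
    qed
    then obtain c F where c: "rotational_param l (range c) c" "continuous_on UNIV F"
      "\<forall>u. (c u, c (F u)) \<in> twist_rel" "\<forall>u. F (u + 1) = F u + 1" "\<forall>u. (F ^^ k) u = u + of_int r"
      by (elim exE conjE)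
    note regular = symmetric_rational_curve_regular[OF c(1,2) c(3-5)[rule_format] k out_shift[unfolded w_def] in_shift[unfolded w_def],
        folded w_def]
    obtain s where s: "0 < s" "\<And>t. g (Q (\<gamma> t) - \<gamma> t) = s"
      using sides_constant[OF Q(1) Q(4)[folded w_def] regular] by metis
    obtain B where B: "linear B" "B ` K = K" "B \<circ> B = (\<lambda>x. - Q x)"
      using bisecting_symmetry[OF Q(1,2) A(3) Q(3) s] by metis
    have "\<exists>v :: real^2. v \<noteq> 0" by (rule exI[of _ "axis 1 1"]) simp
    then have ord: "has_order (B \<circ> B) (if k mod 4 = 0 then k else 2 * k)"
      unfolding B(3) using has_order_neg[OF Q(1,2) _ False] by blast
    have "has_order B (2 * (if k mod 4 = 0 then k else 2 * k))"
      by (rule has_order_double[OF ord]) (use False in presburger)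
    then show ?thesis using B(1,2) False by (intro exI[of _ B]) (auto simp: if_distrib)
  qed
qed

end

theorem corollary4:
  fixes k :: nat and r :: int
    and \<Gamma> K :: "(real^2) set" and A :: "real^2 \<Rightarrow> real^2"
    and \<gamma> :: "real \<Rightarrow> real^2" and l :: real
    and C U :: "(real \<times> real) set"
  assumes "k \<ge> 3"
    and "C2_closed_curve \<Gamma>" and "strictly_convex_curve \<Gamma>"
    and "linear A" and "has_order A k" and "A ` \<Gamma> = \<Gamma>"
    and "K = inside \<Gamma>"
    and "gauge_arclength_param \<Gamma> \<gamma> l"
    and "rotational_invariant_curve K \<gamma> l C"
    and "has_rotation_number K \<gamma> l C (of_int r / of_nat k)" and "coprime r (int k)"
    and "C \<subseteq> U" and "totally_integrable K \<gamma> l U"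
  shows "\<exists>B. linear B \<and>
           has_order B ((if k mod 4 = 2 then 1 else if k mod 4 = 0 then 2 else 4) * k) \<and>
           B ` K = K"
proof -
  obtain \<gamma>1 where curve: "gauge_curve \<Gamma> \<gamma> \<gamma>1 l" using gauge_curveI[OF assms(3,8)] by blast
  have "0 \<in> inside \<Gamma>" by (rule gauge_curve.origin_in_K[OF curve assms(4,5,1,6)])
  then have "centred_gauge_curve \<Gamma> \<gamma> \<gamma>1 l"
    using curve by (simp add: centred_gauge_curve_def centred_gauge_curve_axioms_def)
  from centred_gauge_curve.more_symmetry[OF this assms(4,5,1,6) assms(10)[unfolded assms(7)] assms(11,12)
      assms(13)[unfolded assms(7)]]
  show ?thesis by (simp only: assms(7))
qed

end
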